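(* Let $\mathcal V\subseteq M_6(\mathbb C)$ be a $17$-dimensional complex linear subspace satisfying \[ \operatorname{rank}[S,T]\leq 2\quad\text{for all } S,T\in\mathcal V . \] Then there exists $P\in\operatorname{GL}_6(\mathbb C)$ such that either $P^{-1}\mathcal V P=\mathcal A$ or $P^{-1}\mathcal V^{\mathsf T}P=\mathcal A$.
   Context: $M_n(\mathbb C)$ is the space of complex $n\times n$ matrices and $[S,T]=ST-TS$. For a subspace $\mathcal V\subseteq M_6(\mathbb C)$, $\mathcal V^{\mathsf T}=\{S^{\mathsf T}:S\in\mathcal V\}$, and $P^{-1}\mathcal VP=\{P^{-1}SP:S\in\mathcal V\}$. The space $\mathcal A\subseteq M_6(\mathbb C)$ is, in $2\times 2$ blocks, \[ \mathcal A=\left\{\begin{pmatrix}A&B&C\\0&\lambda I_2&D\\0&0&\lambda I_2\end{pmatrix}: A,B,C,D\in M_2(\mathbb C),\ \lambda\in\mathbb C\right\}, \] a $17$-dimensional subspace. *)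

theory Defs
  imports "HOL-Analysis.Analysis"
begin

text \<open>
  The library interprets the locale \<open>vector_space\<close> for the vectors \<open>'a ^ 'n\<close> (prefix \<open>vec\<close>),
  and \<open>subspace\<close>, \<open>dim\<close> without a prefix refer to real scalars. Complex subspaces of matrices
  and their complex dimension are obtained from the following interpretation.
\<close>

definition mat_scale :: "complex \<Rightarrow> complex ^ 'n ^ 'm \<Rightarrow> complex ^ 'n ^ 'm"
  where "mat_scale c M = (\<chi> i j. c * M $ i $ j)"

interpretation cmat: vector_space "mat_scale :: complex \<Rightarrow> complex ^ 'n ^ 'm \<Rightarrow> complex ^ 'n ^ 'm"
  by unfold_locales (simp_all add: mat_scale_def vec_eq_iff algebra_simps)

definition block3 ::
  "complex ^ 2 ^ 2 \<Rightarrow> complex ^ 2 ^ 2 \<Rightarrow> complex ^ 2 ^ 2 \<Rightarrow>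
   complex ^ 2 ^ 2 \<Rightarrow> complex ^ 2 ^ 2 \<Rightarrow> complex ^ 2 ^ 2 \<Rightarrow>
   complex ^ 2 ^ 2 \<Rightarrow> complex ^ 2 ^ 2 \<Rightarrow> complex ^ 2 ^ 2 \<Rightarrow> complex ^ 6 ^ 6"
  where
  "block3 A B C D E F G H K = vector
    [vector [A$1$1, A$1$2, B$1$1, B$1$2, C$1$1, C$1$2],
     vector [A$2$1, A$2$2, B$2$1, B$2$2, C$2$1, C$2$2],
     vector [D$1$1, D$1$2, E$1$1, E$1$2, F$1$1, F$1$2],
     vector [D$2$1, D$2$2, E$2$1, E$2$2, F$2$1, F$2$2],
     vector [G$1$1, G$1$2, H$1$1, H$1$2, K$1$1, K$1$2],
     vector [G$2$1, G$2$2, H$2$1, H$2$2, K$2$1, K$2$2]]"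

text \<open>Here \<open>mat l\<close> is the library's scalar matrix, \<open>l\<close> times the identity.\<close>

definition calA :: "(complex ^ 6 ^ 6) set"
  where "calA = {block3 A B       C
                        0 (mat l) D
                        0 0       (mat l) | A B C D l. True}"

end

theory Submission
  imports Defs "HOL-Computational_Algebra.Fundamental_Theorem_Algebra"
begin

text \<open>
  Choose \<open>S \<in> V\<close> with the maximal number of distinct eigenvalues and put it in block triangular form.
  Conjugating by a one-parameter group of diagonal matrices with generic integer weights and passing
  to the limit degenerates \<open>V\<close> to a space of the same dimension, with the same rank bound, spanned by
  matrix units and diagonal matrices; the matrix units form a digraph \<open>G\<close> on six vertices, coloured by
  the eigenvalues \<open>h\<close> of \<open>S\<close>. The vanishing of \<open>3 \<times> 3\<close> minors of commutators forbids certain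
  configurations in \<open>G\<close>, and a count of edges leaves only one possibility up to reversing all arrows: two
  vertices, each joined to all others, and a complete bipartite graph \<open>K\<^sub>2\<^sub>,\<^sub>2\<close> on the remaining four,
  which have the same colour.

  The weights are at our disposal. If the two special vertices have the lowest weights and arrows go out
  of them, the corresponding eight matrix units lie in \<open>V\<close> itself; dually, if they have the
  highest weights and arrows come into them, this holds for the transpose. The mixed case is excluded by
  a rank argument. Once the two full rows are in \<open>V\<close>, the lower right \<open>4 \<times> 4\<close> blocks of
  \<open>V\<close> commute, and evaluating them at the two targets of \<open>K\<^sub>2\<^sub>,\<^sub>2\<close> shows that they
  consist of the scalars and the maps with image in a fixed plane and kernel containing it.
\<close>

text \<open>Maximality of the number of eigenvalues drives the edge count. It passes to the limit
  space, where a diagonal matrix separating two vertices of one colour, or two opposite arrows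
  inside a colour, would create a further eigenvalue. So at most one leading position per colour is
  diagonal, and at least 17 minus the number of colours are arrows; in the extremal case 17 = 14 +
  3.

  With D = \<open>diag_mat h\<close> in the limit space, [D + sA, X + B/s] tends to [D, X] + [A, B]
  as s tends to 0 if B commutes with D. Thus a single 3 by 3 minor can mix arrows between colours
  with paths inside a colour.

  The obstacle is the way back: a leading position says nothing about the lower entries of its
  matrix. It determines enough only where the positions form the bottom of the order, so the weights
  must be chosen knowing the two special vertices. Hence a preliminary degeneration with weights
  growing along the triangular form finds the colours; then a permutation puts the special vertices
  at 1 and 2, and the final weights are used.\<close>

subsection \<open>Digraphs with coloured vertices\<close>

text \<open>Koenig's theorem for matching number at most two. Two disjoint edges confine all others
  to four lines, and the absence of augmenting paths removes two of these.\<close>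

lemma cover_by_two_lines:
  fixes R :: "'a \<Rightarrow> 'b \<Rightarrow> bool"
  assumes no3: "\<And>i1 i2 i3 j1 j2 j3. R i1 j1 \<Longrightarrow> R i2 j2 \<Longrightarrow> R i3 j3 \<Longrightarrow>
    distinct [i1, i2, i3] \<Longrightarrow> distinct [j1, j2, j3] \<Longrightarrow> False"
  shows "(\<exists>a b. \<forall>x y. R x y \<longrightarrow> x = a \<or> x = b) \<or> (\<exists>a b. \<forall>x y. R x y \<longrightarrow> y = a \<or> y = b)
    \<or> (\<exists>a b. \<forall>x y. R x y \<longrightarrow> x = a \<or> y = b)"
proof (cases "\<exists>i1 i2 j1 j2. R i1 j1 \<and> R i2 j2 \<and> i1 \<noteq> i2 \<and> j1 \<noteq> j2")
  case False
  then have F: "i1 = i2 \<or> j1 = j2" if "R i1 j1" "R i2 j2" for i1 i2 j1 j2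
    using that by blast
  show ?thesis
  proof (cases "\<exists>i j. R i j")
    case True
    then obtain i j where "R i j" by blast
    then have "\<forall>x y. R x y \<longrightarrow> x = i \<or> y = j" using F by blast
    then show ?thesis by blast
  next
    case False
    then show ?thesis by blast
  qed
next
  case True
  then obtain i1 i2 j1 j2 where e: "R i1 j1" "R i2 j2" "i1 \<noteq> i2" "j1 \<noteq> j2" by blast
  have cov: "x = i1 \<or> x = i2 \<or> y = j1 \<or> y = j2" if "R x y" for x y
    using no3[OF e(1,2) that] e(3,4) by auto
  \<comment> \<open>The exclusions are augmenting paths: \<open>aug1\<close> and \<open>aug2\<close>
    reroute one of the two matching edges, \<open>aug3\<close> and \<open>aug4\<close> replace both
    with the help of an edge joining them.\<close>
  have aug1: "\<not> (R i1 y \<and> R x j1)" if "y \<noteq> j1" "y \<noteq> j2" "x \<noteq> i1" "x \<noteq> i2" for x y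
    using no3[of i1 y x j1 i2 j2] e that by auto
  have aug2: "\<not> (R i2 y \<and> R x j2)" if "y \<noteq> j1" "y \<noteq> j2" "x \<noteq> i1" "x \<noteq> i2" for x y
    using no3[of i2 y x j2 i1 j1] e that by auto
  have aug3: "\<not> (R i1 y \<and> R x j2 \<and> R i2 j1)" if "y \<noteq> j1" "y \<noteq> j2" "x \<noteq> i1" "x \<noteq> i2" for x y
    using no3[of i1 y x j2 i2 j1] e that by auto
  have aug4: "\<not> (R i2 y \<and> R x j1 \<and> R i1 j2)" if "y \<noteq> j1" "y \<noteq> j2" "x \<noteq> i1" "x \<noteq> i2" for x y
    using no3[of i2 y x j1 i1 j2] e that by auto
  define r1 where "r1 \<longleftrightarrow> (\<exists>y. y \<noteq> j1 \<and> y \<noteq> j2 \<and> R i1 y)"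
  define r2 where "r2 \<longleftrightarrow> (\<exists>y. y \<noteq> j1 \<and> y \<noteq> j2 \<and> R i2 y)"
  define c1 where "c1 \<longleftrightarrow> (\<exists>x. x \<noteq> i1 \<and> x \<noteq> i2 \<and> R x j1)"
  define c2 where "c2 \<longleftrightarrow> (\<exists>x. x \<noteq> i1 \<and> x \<noteq> i2 \<and> R x j2)"
  have rc: "\<not> (r1 \<and> c1)" "\<not> (r2 \<and> c2)" "\<not> (r1 \<and> c2 \<and> R i2 j1)" "\<not> (r2 \<and> c1 \<and> R i1 j2)"
    unfolding r1_def r2_def c1_def c2_def using aug1 apply blast
    using aug2 apply blast using aug3 apply blast using aug4 apply blast done
  consider "\<not> c1" "\<not> c2" | "\<not> r1" "\<not> r2" | "r1" "c2" | "r2" "c1"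
    using rc by blast
  then show ?thesis
  proof cases
    case 1
    then have "\<forall>x y. R x y \<longrightarrow> x = i1 \<or> x = i2" using cov unfolding c1_def c2_def by blast
    then show ?thesis by blast
  next
    case 2
    then have "\<forall>x y. R x y \<longrightarrow> y = j1 \<or> y = j2" using cov unfolding r1_def r2_def by blast
    then show ?thesis by blast
  next
    case 3
    with rc have "\<not> c1" "\<not> r2" "\<not> R i2 j1" by blast+
    then have "\<forall>x y. R x y \<longrightarrow> x = i1 \<or> y = j2" using cov unfolding c1_def r2_def by metis
    then show ?thesis by blast
  next
    case 4
    with rc have "\<not> c2" "\<not> r1" "\<not> R i1 j2" by blast+
    then have "\<forall>x y. R x y \<longrightarrow> x = i2 \<or> y = j1" using cov unfolding c2_def r1_def by metis
    then show ?thesis by blast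
  qed
qed

lemma obtain_from_card:
  assumes "card A > card B" "finite B"
  obtains x where "x \<in> A" "x \<notin> B"
proof -
  have "\<not> A \<subseteq> B" using assms card_mono[of B A] by linarith
  then show ?thesis using that by blast
qed

text \<open>The vertices of \<open>M\<close> that send an arrow inside \<open>M\<close> form
  \<open>A\<close>; without two-step walks no arrow ends in \<open>A\<close>, so all arrows cross
  from \<open>A\<close> to its complement.\<close>

lemma no_two_path_bipartite:
  fixes R :: "'a \<Rightarrow> 'a \<Rightarrow> bool"
  assumes fin: "finite M" and no2: "\<And>a b c. \<lbrakk>a \<in> M; b \<in> M; c \<in> M; R a b; R b c\<rbrakk> \<Longrightarrow> False"
  obtains A where "A \<subseteq> M" "{(a, b). a \<in> M \<and> b \<in> M \<and> R a b} \<subseteq> A \<times> (M - A)"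
    "card {(a, b). a \<in> M \<and> b \<in> M \<and> R a b} \<le> card A * (card M - card A)"
proof -
  define A where "A = {a \<in> M. \<exists>b\<in>M. R a b}"
  have sub: "A \<subseteq> M" by (auto simp: A_def)
  have 1: "{(a, b). a \<in> M \<and> b \<in> M \<and> R a b} \<subseteq> A \<times> (M - A)"
    using no2 by (auto simp: A_def)
  have "card {(a, b). a \<in> M \<and> b \<in> M \<and> R a b} \<le> card (A \<times> (M - A))"
    by (rule card_mono[OF _ 1]) (use fin sub finite_subset in auto)
  also have "\<dots> = card A * (card M - card A)"
    using fin sub by (simp add: card_cartesian_product card_Diff_subset finite_subset)
  finally show ?thesis using that sub 1 by blast
qed

text \<open>This is the digraph of \<open>calA\<close> itself: two rows with five arrows each and
  the four positions of its block \<open>D\<close>. Its 14 arrows and 3 colours reach the bound 17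
  exactly. The reversed relation describes the transposed space.\<close>

definition full_rows :: "('n \<Rightarrow> 'a) \<Rightarrow> ('n \<Rightarrow> 'n \<Rightarrow> bool) \<Rightarrow> 'n \<Rightarrow> 'n \<Rightarrow> 'n \<Rightarrow> 'n \<Rightarrow> 'n \<Rightarrow> 'n \<Rightarrow> bool" where
  "full_rows h G i j s1 s2 t1 t2 \<longleftrightarrow> distinct [i, j, s1, s2, t1, t2] \<and> h i \<noteq> h j \<and>
     h s1 \<noteq> h i \<and> h s1 \<noteq> h j \<and> h s2 = h s1 \<and> h t1 = h s1 \<and> h t2 = h s1 \<and>
     (\<forall>l. l \<noteq> i \<longrightarrow> G i l) \<and> (\<forall>l. l \<noteq> j \<longrightarrow> G j l) \<and>
     G s1 t1 \<and> G s1 t2 \<and> G s2 t1 \<and> G s2 t2"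

text \<open>Axioms for the off-diagonal leading positions of a degenerate space. Of the 17
  dimensions at most one per colour is diagonal, which gives \<open>size\<close>. Each exclusion
  rule comes from a 3 by 3 minor of a commutator: an arrow between colours enters through a bracket
  with the diagonal matrix of colours, a path inside a colour as a product of two matrix units, and
  a hub through products passing its centre \<open>v\<close>.\<close>

locale pivot_graph =
  fixes h :: "'n::finite \<Rightarrow> 'a" and G :: "'n \<Rightarrow> 'n \<Rightarrow> bool"
  assumes card6: "CARD('n) = 6"
    and irrefl: "\<not> G i i"
    and size: "card {(i, j). G i j} + card (range h) \<ge> 17"
    and antisym: "\<lbrakk>h i = h j; G i j; G j i\<rbrakk> \<Longrightarrow> False"
    and no_matching: "\<lbrakk>G i1 j1; h i1 \<noteq> h j1; G i2 j2; h i2 \<noteq> h j2; G i3 j3; h i3 \<noteq> h j3;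
      distinct [i1, i2, i3]; distinct [j1, j2, j3]\<rbrakk> \<Longrightarrow> False"
    and no_path2: "\<lbrakk>G i1 j1; h i1 \<noteq> h j1; G i2 j2; h i2 \<noteq> h j2; G a b; h a = h b; G b c; h b = h c;
      distinct [a, i1, i2]; distinct [c, j1, j2]\<rbrakk> \<Longrightarrow> False"
    and no_walk3: "\<lbrakk>G y z; h y \<noteq> h z; G a b; h a = h b; G b c; h b = h c; G c d; h c = h d;
      y \<noteq> a; y \<noteq> b; z \<noteq> c; z \<noteq> d\<rbrakk> \<Longrightarrow> False"
    and no_hub: "\<lbrakk>G a b; G b v; G u v; G v y; G v z; distinct [a, u, b, v]; y \<noteq> z\<rbrakk> \<Longrightarrow> False"
    and no_hub': "\<lbrakk>G b a; G v b; G v u; G y v; G z v; distinct [a, u, b, v]; y \<noteq> z\<rbrakk> \<Longrightarrow> False"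
begin

text \<open>The axioms are self-dual, \<open>no_hub\<close> and \<open>no_hub'\<close> changing
  places; every statement on rows thereby yields one on columns.\<close>

lemma converse_pivot_graph: "pivot_graph h (\<lambda>i j. G j i)"
proof
  show "17 \<le> card {(i, j). G j i} + card (range h)"
  proof -
    have "{(i, j). G j i} = prod.swap ` {(i, j). G i j}" by auto
    then have "card {(i, j). G j i} = card {(i, j). G i j}"
      by (simp add: card_image)
    with size show ?thesis by simp
  qed
next
  fix i j show "h i = h j \<Longrightarrow> G j i \<Longrightarrow> G i j \<Longrightarrow> False" using antisym by blast
next
  fix i1 j1 i2 j2 a b c
  assume "G j1 i1" "h i1 \<noteq> h j1" "G j2 i2" "h i2 \<noteq> h j2" "G b a" "h a = h b" "G c b" "h b = h c"
    "distinct [a, i1, i2]" "distinct [c, j1, j2]"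
  then show False using no_path2[of j1 i1 j2 i2 c b a] by auto
next
  fix i1 j1 i2 j2 i3 j3
  assume "G j1 i1" "h i1 \<noteq> h j1" "G j2 i2" "h i2 \<noteq> h j2" "G j3 i3" "h i3 \<noteq> h j3"
    "distinct [i1, i2, i3]" "distinct [j1, j2, j3]"
  then show False using no_matching[of j1 i1 j2 i2 j3 i3] by auto
next
  fix y z a b c d
  assume "G z y" "h y \<noteq> h z" "G b a" "h a = h b" "G c b" "h b = h c" "G d c" "h c = h d"
      "y \<noteq> a" "y \<noteq> b" "z \<noteq> c" "z \<noteq> d"
  then show False using no_walk3[of z y d c b a] by auto
next
  show "CARD('n) = 6" by (rule card6)
next
  fix i show "\<not> G i i" by (rule irrefl)
next
  fix a b v u y z
  assume "G b a" "G v b" "G v u" "G y v" "G z v" "distinct [a, u, b, v]" "y \<noteq> z"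
  then show False by (rule no_hub')
next
  fix a b v u y z
  assume "G a b" "G b v" "G u v" "G v y" "G v z" "distinct [a, u, b, v]" "y \<noteq> z"
  then show False by (rule no_hub)
qed

section \<open>Counting arrows, colours and missing pairs\<close>

definition N :: "'n \<Rightarrow> nat" where "N v = card {u. h u = h v}"

definition off :: "('n \<times> 'n) set" where "off = {(i, j). G i j \<and> h i \<noteq> h j}"
definition inb :: "('n \<times> 'n) set" where "inb = {(i, j). G i j \<and> h i = h j}"

lemma N_pos: "N v \<ge> 1"
proof -
  have "v \<in> {u. h u = h v}" by simp
  then show ?thesis unfolding N_def by (metis One_nat_def Suc_leI card_gt_0_iff empty_iff finite)
qed

lemma N_cong: "h u = h v \<Longrightarrow> N u = N v" by (simp add: N_def)

lemma card_split: "card {(i, j). G i j} = card off + card inb"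
proof -
  have "{(i, j). G i j} = off \<union> inb" "off \<inter> inb = {}" by (auto simp: off_def inb_def)
  then show ?thesis by (simp add: card_Un_disjoint)
qed

text \<open>The reciprocals of the class size add up to one over each colour class.\<close>

lemma card_range: "real (card (range h)) = (\<Sum>v\<in>UNIV. 1 / N v)"
proof -
  have "(\<Sum>v\<in>UNIV. 1 / real (N v)) = (\<Sum>c\<in>range h. \<Sum>v\<in>{v\<in>UNIV. h v = c}. 1 / real (N v))"
    by (rule sum.image_gen) simp
  also have "\<dots> = (\<Sum>c\<in>range h. 1)"
  proof (rule sum.cong[OF refl])
    fix c assume "c \<in> range h"
    then obtain u where u: "c = h u" by auto
    have "(\<Sum>v\<in>{v\<in>UNIV. h v = c}. 1 / real (N v)) = (\<Sum>v\<in>{v. h v = h u}. 1 / real (N u))"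
      by (rule sum.cong) (auto simp: u N_def)
    also have "\<dots> = real (N u) * (1 / real (N u))" by (simp add: N_def)
    also have "\<dots> = 1" using N_pos[of u] by simp
    finally show "(\<Sum>v\<in>{v\<in>UNIV. h v = c}. 1 / real (N v)) = 1" .
  qed
  finally show ?thesis by simp
qed

text \<open>By antisymmetry an ordered pair of distinct vertices of one colour is exactly one of
  three things: an arrow, a reversed arrow or a missing pair. The right-hand side counts all such
  pairs.\<close>

lemma card_inb_pairs: "2 * real (card inb) + real (card {(u, v). h u = h v \<and> u \<noteq> v \<and> \<not> G u v \<and> \<not> G v u})
    = (\<Sum>v\<in>UNIV. real (N v) - 1)"
proof -
  let ?D = "{(u, v). h u = h v \<and> u \<noteq> v \<and> \<not> G u v \<and> \<not> G v u}"
  let ?P = "{(u, v). h v = h u \<and> u \<noteq> v}"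
  have sw: "prod.swap ` inb = {(u, v). G v u \<and> h v = h u}"
    unfolding inb_def by force
  have P: "?P = inb \<union> prod.swap ` inb \<union> ?D"
  proof (rule set_eqI)
    fix z :: "'n \<times> 'n"
    obtain u v where z: "z = (u, v)" by (cases z)
    show "z \<in> ?P \<longleftrightarrow> z \<in> inb \<union> prod.swap ` inb \<union> ?D"
      unfolding z sw unfolding inb_def
      using irrefl[of u] eq_commute[of "h u" "h v"] by (cases "u = v") auto
  qed
  have d1: "inb \<inter> prod.swap ` inb = {}"
    unfolding sw unfolding inb_def by (blast dest: antisym)
  have d2: "(inb \<union> prod.swap ` inb) \<inter> ?D = {}"
    unfolding sw unfolding inb_def by blast
  have "card ?P = card (inb \<union> prod.swap ` inb) + card ?D"
    unfolding P by (rule card_Un_disjoint[OF _ _ d2]) simp_all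
  also have "card (inb \<union> prod.swap ` inb) = card inb + card (prod.swap ` inb)"
    by (rule card_Un_disjoint[OF _ _ d1]) simp_all
  also have "card (prod.swap ` inb) = card inb" by (simp add: card_image)
  finally have 1: "card ?P = 2 * card inb + card ?D" by simp
  have "?P = (SIGMA u:UNIV. {v. h v = h u} - {u})" by auto
  then have "card ?P = (\<Sum>u\<in>UNIV. card ({v. h v = h u} - {u}))"
    by (simp add: card_SigmaI)
  also have "\<dots> = (\<Sum>u\<in>UNIV. N u - 1)" by (simp add: N_def)
  finally have "real (card ?P) = (\<Sum>u\<in>UNIV. real (N u) - 1)"
    using N_pos by (simp add: of_nat_diff)
  with 1 show ?thesis by simp
qed

lemma row_bound: "card {y. G i y \<and> h i \<noteq> h y} \<le> 6 - N i"
proof -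
  have "card {y. G i y \<and> h i \<noteq> h y} \<le> card (UNIV - {u. h u = h i})"
    by (rule card_mono) auto
  also have "\<dots> = 6 - N i" using card6 by (simp add: card_Diff_subset N_def)
  finally show ?thesis .
qed

lemma col_bound: "card {x. G x j \<and> h x \<noteq> h j} \<le> 6 - N j"
proof -
  have "card {x. G x j \<and> h x \<noteq> h j} \<le> card (UNIV - {u. h u = h j})"
    by (rule card_mono) auto
  also have "\<dots> = 6 - N j" using card6 by (simp add: card_Diff_subset N_def)
  finally show ?thesis .
qed

lemma off_rows:
  assumes "\<forall>x y. G x y \<longrightarrow> h x \<noteq> h y \<longrightarrow> x = i \<or> x = j"
  shows "card off \<le> card {y. G i y \<and> h i \<noteq> h y} + card {y. G j y \<and> h j \<noteq> h y}"
proof -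
  have off: "off \<subseteq> Pair i ` {y. G i y \<and> h i \<noteq> h y} \<union> Pair j ` {y. G j y \<and> h j \<noteq> h y}"
    using assms by (auto simp: off_def)
  have c: "card (Pair v ` {y. G v y \<and> h v \<noteq> h y}) = card {y. G v y \<and> h v \<noteq> h y}" for v
    by (rule card_image) (simp add: inj_on_def)
  have "card off \<le> card (Pair i ` {y. G i y \<and> h i \<noteq> h y} \<union> Pair j ` {y. G j y \<and> h j \<noteq> h y})"
    by (rule card_mono[OF _ off]) simp
  also have "\<dots> \<le> card (Pair i ` {y. G i y \<and> h i \<noteq> h y}) + card (Pair j ` {y. G j y \<and> h j \<noteq> h y})"
    by (rule card_Un_le)
  finally show ?thesis by (simp add: c)
qed

lemma off_row:
  assumes "\<forall>x y. G x y \<longrightarrow> h x \<noteq> h y \<longrightarrow> x = i"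
  shows "card off \<le> card {y. G i y \<and> h i \<noteq> h y}"
proof -
  have "off \<subseteq> Pair i ` {y. G i y \<and> h i \<noteq> h y}"
    using assms by (auto simp: off_def)
  then have "card off \<le> card (Pair i ` {y. G i y \<and> h i \<noteq> h y})"
    by (intro card_mono) auto
  also have "\<dots> = card {y. G i y \<and> h i \<noteq> h y}" by (rule card_image) (simp add: inj_on_def)
  finally show ?thesis .
qed

lemma off_cross:
  assumes "\<forall>x y. G x y \<longrightarrow> h x \<noteq> h y \<longrightarrow> x = i \<or> y = j"
  shows "card off \<le> card {y. G i y \<and> h i \<noteq> h y} + card ({x. G x j \<and> h x \<noteq> h j} - {i})"
proof -
  have off: "off \<subseteq> Pair i ` {y. G i y \<and> h i \<noteq> h y} \<union> (\<lambda>x. (x, j)) ` ({x. G x j \<and> h x \<noteq> h j} - {i})"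
    using assms by (auto simp: off_def)
  have c1: "card (Pair i ` {y. G i y \<and> h i \<noteq> h y}) = card {y. G i y \<and> h i \<noteq> h y}"
    by (rule card_image) (simp add: inj_on_def)
  have c2: "card ((\<lambda>x. (x, j)) ` ({x. G x j \<and> h x \<noteq> h j} - {i})) = card ({x. G x j \<and> h x \<noteq> h j} - {i})"
    by (rule card_image) (simp add: inj_on_def)
  have "card off \<le> card (Pair i ` {y. G i y \<and> h i \<noteq> h y} \<union> (\<lambda>x. (x, j)) ` ({x. G x j \<and> h x \<noteq> h j} - {i}))"
    by (rule card_mono[OF _ off]) simp
  also have "\<dots> \<le> card (Pair i ` {y. G i y \<and> h i \<noteq> h y}) + card ((\<lambda>x. (x, j)) ` ({x. G x j \<and> h x \<noteq> h j} - {i}))"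
    by (rule card_Un_le)
  finally show ?thesis by (simp only: c1 c2)
qed

definition R where "R i = {y. G i y \<and> h i \<noteq> h y}"
definition C where "C j = {x. G x j \<and> h x \<noteq> h j}"
definition D where "D = {(u, v). h u = h v \<and> u \<noteq> v \<and> \<not> G u v \<and> \<not> G v u}"

lemma R_bound: "card (R i) \<le> 6 - N i" unfolding R_def by (rule row_bound)
lemma C_bound: "card (C j) \<le> 6 - N j" unfolding C_def by (rule col_bound)
lemma RD: "y \<in> R i \<Longrightarrow> G i y" "y \<in> R i \<Longrightarrow> h i \<noteq> h y" by (auto simp: R_def)
lemma CD: "x \<in> C j \<Longrightarrow> G x j" "x \<in> C j \<Longrightarrow> h x \<noteq> h j" by (auto simp: C_def)

text \<open>Since \<open>R i\<close> contains only vertices of other colours, a row with five such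
  arrows also shows that \<open>i\<close> is alone in its colour.\<close>

lemma R_full:
  assumes "card (R i) \<ge> 5" shows "R i = UNIV - {i}"
proof (rule card_subset_eq)
  show "R i \<subseteq> UNIV - {i}" by (auto simp: R_def irrefl)
  then have "card (R i) \<le> card (UNIV - {i})" by (intro card_mono) auto
  with assms card6 show "card (R i) = card (UNIV - {i})" by (simp add: card_Diff_subset)
qed simp

lemma C_full:
  assumes "card (C i) \<ge> 5" shows "C i = UNIV - {i}"
proof (rule card_subset_eq)
  show "C i \<subseteq> UNIV - {i}" by (auto simp: C_def irrefl)
  then have "card (C i) \<le> card (UNIV - {i})" by (intro card_mono) auto
  with assms card6 show "card (C i) = card (UNIV - {i})" by (simp add: card_Diff_subset)
qed simp

definition edges :: "'n set \<Rightarrow> ('n \<times> 'n) set"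
  where "edges M = {(a, b). a \<in> M \<and> b \<in> M \<and> G a b}"

text \<open>An arrow inside \<open>M\<close> settles two ordered pairs, and an unsettled pair lies
  in \<open>D\<close>. Few arrows thus force many missing pairs, and through
  \<open>weight_sum\<close> these must be paid for by arrows between colours.\<close>

lemma block_pairs:
  assumes M: "\<And>u. u \<in> M \<Longrightarrow> h u = c"
  shows "card M * (card M - 1) \<le> 2 * card (edges M) + card D"
proof -
  have "card M * (card M - 1) = card (SIGMA u:M. M - {u})"
    by (simp add: card_SigmaI)
  also have "\<dots> \<le> card (edges M \<union> (prod.swap ` edges M \<union> D))"
  proof (rule card_mono)
    show "(SIGMA u:M. M - {u}) \<subseteq> edges M \<union> (prod.swap ` edges M \<union> D)"
    proof
      fix z assume "z \<in> (SIGMA u:M. M - {u})"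
      then obtain u v where z: "z = (u, v)" "u \<in> M" "v \<in> M" "u \<noteq> v" by blast
      then have "h u = h v" using M by metis
      with z show "z \<in> edges M \<union> (prod.swap ` edges M \<union> D)"
        unfolding edges_def D_def by (cases "G v u"; cases "G u v") force+
    qed
  qed simp
  also have "\<dots> \<le> card (edges M) + (card (prod.swap ` edges M) + card D)"
    by (meson card_Un_le add_left_mono le_trans)
  also have "card (prod.swap ` edges M) = card (edges M)" by (simp add: card_image)
  finally show ?thesis by simp
qed

text \<open>The right-hand side depends on the class sizes alone: a class of size n contributes n(n
  - 1) + 2. Combined with twice \<open>size'\<close> this gives a lower bound for \<open>off\<close>
  that grows with the number of missing pairs.\<close>

lemma weight_sum:
  "2 * real (card (range h)) + 2 * real (card inb) + real (card D)
    = (\<Sum>v\<in>UNIV. 2 / N v + real (N v) - 1)"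
proof -
  have "(\<Sum>v\<in>UNIV. 2 / N v + real (N v) - 1) = 2 * (\<Sum>v\<in>UNIV. 1 / N v) + (\<Sum>v\<in>UNIV. real (N v) - 1)"
    by (simp add: sum.distrib sum_subtractf sum_distrib_left)
  then show ?thesis using card_range card_inb_pairs unfolding D_def by simp
qed

definition block :: "'n \<Rightarrow> 'n set" where "block v = {u. h u = h v}"

lemma card_block: "card (block v) = N v" by (simp add: block_def N_def)

text \<open>Sizes 1 and 2 have the same weight 2/N + N - 1 = 2, so the vertices outside one large
  class can be treated alike.\<close>

lemma weight_sum_block:
  assumes out: "\<And>u. u \<notin> block v \<Longrightarrow> N u \<le> 2"
  shows "2 * real (card (range h)) + 2 * real (card inb) + real (card D)
    = N v * (2 / N v + real (N v) - 1) + 2 * (6 - real (N v))"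
proof -
  have "(\<Sum>u\<in>UNIV. 2 / N u + real (N u) - 1)
      = (\<Sum>u\<in>block v. 2 / N u + real (N u) - 1) + (\<Sum>u\<in>UNIV - block v. 2 / N u + real (N u) - 1)"
    by (subst sum.subset_diff[of "block v"]) (simp_all add: add.commute)
  also have "(\<Sum>u\<in>block v. 2 / N u + real (N u) - 1) = (\<Sum>u\<in>block v. 2 / N v + real (N v) - 1)"
    by (rule sum.cong) (auto simp: block_def N_def)
  also have "\<dots> = N v * (2 / N v + real (N v) - 1)" by (simp add: card_block)
  also have "(\<Sum>u\<in>UNIV - block v. 2 / N u + real (N u) - 1) = (\<Sum>u\<in>UNIV - block v. 2)"
  proof (rule sum.cong[OF refl])
    fix u assume "u \<in> UNIV - block v"
    with out N_pos[of u] have "N u = 1 \<or> N u = 2" by force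
    then show "2 / N u + real (N u) - 1 = 2" by auto
  qed
  also have "\<dots> = 2 * (6 - real (N v))"
    using card6 card_mono[of UNIV "block v"]
    by (simp add: card_Diff_subset card_block of_nat_diff)
  finally show ?thesis using weight_sum by simp
qed

lemma size': "card off + card inb + card (range h) \<ge> 17"
  using size card_split by simp

lemma outside_block:
  assumes "u \<notin> block v" shows "N u + N v \<le> 6"
proof -
  have "card (block u \<union> block v) = N u + N v"
    unfolding card_block[symmetric]
    by (rule card_Un_disjoint) (use assms in \<open>auto simp: block_def\<close>)
  moreover have "card (block u \<union> block v) \<le> CARD('n)" by (rule card_mono) auto
  ultimately show ?thesis using card6 by simp
qed

text \<open>Of eight arrows out of two vertices each row keeps at least three. This suffices to
  choose one arrow per row with targets different from each other and from the end \<open>c\<close>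
  of the path; then \<open>no_path2\<close> applies.\<close>

lemma no_path_rows:
  assumes cov: "\<forall>x y. G x y \<longrightarrow> h x \<noteq> h y \<longrightarrow> x = i \<or> x = j"
    and off: "card off \<ge> 8" and ij: "i \<notin> block v" "j \<notin> block v"
    and path: "a \<in> block v" "b \<in> block v" "c \<in> block v" "G a b" "G b c"
  shows False
proof -
  have le5: "card (R u) \<le> 5" for u using R_bound[of u] N_pos[of u] by linarith
  have "i \<noteq> j"
  proof
    assume "i = j"
    then have "card off \<le> card (R i)" using off_row[of i] cov unfolding R_def by blast
    then show False using off le5[of i] by linarith
  qed
  have s: "card off \<le> card (R i) + card (R j)" using off_rows[OF cov] unfolding R_def by blast
  have "card (R i) > card {c}" using s off le5[of j] by simp
  then obtain x where x: "x \<in> R i" "x \<notin> {c}" by (rule obtain_from_card) simp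
  have "card {c, x} \<le> 2" by (simp add: card_insert_if)
  then have "card (R j) > card {c, x}" using s off le5[of i] by simp
  then obtain y where y: "y \<in> R j" "y \<notin> {c, x}" by (rule obtain_from_card) simp
  have "h a = h b" "h b = h c" using path by (auto simp: block_def)
  moreover have "a \<noteq> i" "a \<noteq> j" using path ij by auto
  ultimately show False
    using no_path2[OF RD[OF x(1)] RD[OF y(1)] path(4) _ path(5)] \<open>i \<noteq> j\<close> x y by auto
qed

text \<open>The row of \<open>i\<close> and the column of \<open>j\<close> may share the arrow from
  \<open>i\<close> to \<open>j\<close>. Without it both still offer an arrow of the row that avoids
  the end of the path and an arrow of the column that avoids its beginning.\<close>

lemma no_path_cross:
  assumes cov: "\<forall>x y. G x y \<longrightarrow> h x \<noteq> h y \<longrightarrow> x = i \<or> y = j"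
    and off: "card off \<ge> 8" and ij: "i \<notin> block v" "j \<notin> block v"
    and path: "a \<in> block v" "b \<in> block v" "c \<in> block v" "G a b" "G b c"
  shows False
proof -
  have le5: "card (R u) \<le> 5" "card (C u) \<le> 5" for u
    using R_bound[of u] C_bound[of u] N_pos[of u] by linarith+
  have s: "card off \<le> card (R i) + card (C j - {i})" using off_cross[OF cov] unfolding R_def C_def by blast
  have "card (R i - {j}) \<ge> 3"
  proof (cases "j \<in> R i")
    case True
    then have "i \<in> C j" by (auto simp: R_def C_def)
    then have "card (C j - {i}) \<le> 4" using le5(2)[of j] by simp
    with s off True show ?thesis by simp
  next
    case False
    have "card (C j - {i}) \<le> 5" using le5(2)[of j] card_mono[of "C j" "C j - {i}"] by simp
    with s off False show ?thesis by simp
  qed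
  then have "card (R i - {j}) > card {c}" by simp
  then obtain x where x: "x \<in> R i - {j}" "x \<notin> {c}" by (rule obtain_from_card) simp
  have "card (C j - {i}) > card {a}" using s off le5(1)[of i] by simp
  then obtain y where y: "y \<in> C j - {i}" "y \<notin> {a}" by (rule obtain_from_card) simp
  have "h a = h b" "h b = h c" using path by (auto simp: block_def)
  moreover have "a \<noteq> i" "c \<noteq> j" using path ij by auto
  moreover have "x \<in> R i" "y \<in> C j" using x y by auto
  ultimately show False
    using no_path2[OF RD[of x i] CD[of y j] path(4) _ path(5)] x y by auto
qed

section \<open>Case distinction by the size of the largest colour class\<close>

lemma edges_no_path:
  assumes "\<And>a b c. \<lbrakk>a \<in> M; b \<in> M; c \<in> M; G a b; G b c\<rbrakk> \<Longrightarrow> False"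
  obtains A where "A \<subseteq> M" "edges M \<subseteq> A \<times> (M - A)" "card (edges M) \<le> card A * (card M - card A)"
proof -
  have "finite M" by simp
  then show ?thesis
    by (rule no_two_path_bipartite[of M G]) (use assms that in \<open>auto simp: edges_def\<close>)
qed

text \<open>The count is tight. \<open>off\<close> has at least 8 + |D|/2 elements, while a class of
  four without two-step paths has at most 4 arrows and so at least 4 missing ordered pairs. Two rows
  hold at most 10 arrows, so all bounds are attained: both rows are full, and the class carries a
  complete bipartite graph with parts of size 2.\<close>

lemma block4_rows:
  assumes N4: "N v = 4" and cov: "\<forall>x y. G x y \<longrightarrow> h x \<noteq> h y \<longrightarrow> x = i \<or> x = j"
  shows "\<exists>i j s1 s2 t1 t2. full_rows h G i j s1 s2 t1 t2"
proof -
  let ?M = "block v"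
  have M4: "card ?M = 4" using N4 by (simp add: card_block)
  have "N u \<le> 2" if "u \<notin> ?M" for u using outside_block[OF that] N4 by simp
  then have "2 * real (card (range h)) + 2 * real (card inb) + real (card D) = 18"
    using weight_sum_block[of v] N4 by simp
  then have k: "2 * card (range h) + 2 * card inb + card D = 18" by linarith
  then have off: "2 * card off \<ge> 16 + card D" using size' by linarith
  have s: "card off \<le> card (R i) + card (R j)" using off_rows[OF cov] unfolding R_def by blast
  have le5: "card (R u) \<le> 5" for u using R_bound[of u] N_pos[of u] by linarith
  have le2: "card (R u) \<le> 2" if "u \<in> ?M" for u
  proof -
    have "N u = 4" using that N4 N_cong[of u v] by (simp add: block_def)
    then show ?thesis using R_bound[of u] by simp
  qed
  have ij: "i \<notin> ?M" "j \<notin> ?M" using le2[of i] le2[of j] le5[of i] le5[of j] off s by linarith+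
  have "False" if "a \<in> ?M" "b \<in> ?M" "c \<in> ?M" "G a b" "G b c" for a b c
    using no_path_rows[OF cov _ ij that] off by simp
  then obtain A where A: "A \<subseteq> ?M" "edges ?M \<subseteq> A \<times> (?M - A)" "card (edges ?M) \<le> card A * (card ?M - card A)"
    using edges_no_path by metis
  have "card A \<le> 4" using A(1) M4 card_mono[of ?M A] by simp
  then have cA: "card A = 0 \<or> card A = 1 \<or> card A = 2 \<or> card A = 3 \<or> card A = 4" by linarith
  then have e4: "card (edges ?M) \<le> 4" using A(3) M4 by auto
  have bp: "12 \<le> 2 * card (edges ?M) + card D"
    using block_pairs[of ?M "h v"] M4 by (simp add: block_def)
  have off10: "card off \<ge> 10" using e4 bp off by linarith
  have R5: "card (R i) \<ge> 5" "card (R j) \<ge> 5" using off10 s le5[of i] le5[of j] by linarith+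
  note full = R5[THEN R_full]
  have ne: "i \<noteq> j"
  proof
    assume "i = j"
    then have "card off \<le> card (R i)" using off_row[of i] cov unfolding R_def by blast
    then show False using off10 le5[of i] by linarith
  qed
  have hij: "h i \<noteq> h j" using full(1) RD(2)[of j i] ne by auto
  have "card D \<le> 4" using off s le5[of i] le5[of j] by linarith
  then have e: "card (edges ?M) = 4" using e4 bp by linarith
  then have A2: "card A = 2" using cA A(3) M4 by auto
  then have B2: "card (?M - A) = 2" using A(1) M4 by (simp add: card_Diff_subset)
  have EA: "edges ?M = A \<times> (?M - A)"
    by (rule card_subset_eq[OF _ A(2)]) (use e A2 B2 in \<open>simp_all add: card_cartesian_product\<close>)
  obtain s1 s2 where S: "A = {s1, s2}" "s1 \<noteq> s2" using A2 by (meson card_2_iff)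
  obtain t1 t2 where T: "?M - A = {t1, t2}" "t1 \<noteq> t2" using B2 by (meson card_2_iff)
  have mem: "s1 \<in> ?M" "s2 \<in> ?M" "t1 \<in> ?M" "t2 \<in> ?M" using A(1) S T by auto
  have dis: "distinct [i, j, s1, s2, t1, t2]" using ne ij mem S T by auto
  have "G s1 t1" "G s1 t2" "G s2 t1" "G s2 t2" using EA S T unfolding edges_def by blast+
  moreover have "\<forall>l. l \<noteq> i \<longrightarrow> G i l" "\<forall>l. l \<noteq> j \<longrightarrow> G j l" using full RD(1) by auto
  moreover have "h s1 = h v" "h s2 = h v" "h t1 = h v" "h t2 = h v" using mem by (auto simp: block_def)
  moreover have "h v \<noteq> h i" "h v \<noteq> h j" using ij by (auto simp: block_def)
  ultimately have "full_rows h G i j s1 s2 t1 t2"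
    unfolding full_rows_def using dis hij by simp
  then show ?thesis by blast
qed

text \<open>The same count asks for 10 arrows in one row and one column. For distinct
  \<open>i\<close> and \<open>j\<close> the arrow from \<open>i\<close> to \<open>j\<close> lies on
  both lines, leaving at most 9, so the lines belong to one vertex; with an arrow of the class that
  vertex is a forbidden hub.\<close>

lemma block4_cross:
  assumes N4: "N v = 4" and cov: "\<forall>x y. G x y \<longrightarrow> h x \<noteq> h y \<longrightarrow> x = i \<or> y = j"
  shows False
proof -
  let ?M = "block v"
  have M4: "card ?M = 4" using N4 by (simp add: card_block)
  have "N u \<le> 2" if "u \<notin> ?M" for u using outside_block[OF that] N4 by simp
  then have "2 * real (card (range h)) + 2 * real (card inb) + real (card D) = 18"
    using weight_sum_block[of v] N4 by simp
  then have k: "2 * card (range h) + 2 * card inb + card D = 18" by linarith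
  then have off: "2 * card off \<ge> 16 + card D" using size' by linarith
  have s: "card off \<le> card (R i) + card (C j - {i})" using off_cross[OF cov] unfolding R_def C_def by blast
  have C': "card (C j - {i}) \<le> card (C j)" by (rule card_mono) auto
  have le5: "card (R u) \<le> 5" "card (C u) \<le> 5" for u
    using R_bound[of u] C_bound[of u] N_pos[of u] by linarith+
  have le2: "card (R u) \<le> 2" "card (C u) \<le> 2" if "u \<in> ?M" for u
  proof -
    have "N u = 4" using that N4 N_cong[of u v] by (simp add: block_def)
    then show "card (R u) \<le> 2" "card (C u) \<le> 2" using R_bound[of u] C_bound[of u] by simp_all
  qed
  have ij: "i \<notin> ?M" "j \<notin> ?M"
    using le2(1)[of i] le2(2)[of j] le5(1)[of i] le5(2)[of j] off s C' by linarith+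
  have "False" if "a \<in> ?M" "b \<in> ?M" "c \<in> ?M" "G a b" "G b c" for a b c
    using no_path_cross[OF cov _ ij that] off by simp
  then obtain A where A: "A \<subseteq> ?M" "edges ?M \<subseteq> A \<times> (?M - A)" "card (edges ?M) \<le> card A * (card ?M - card A)"
    using edges_no_path by metis
  have "card A \<le> 4" using A(1) M4 card_mono[of ?M A] by simp
  then have cA: "card A = 0 \<or> card A = 1 \<or> card A = 2 \<or> card A = 3 \<or> card A = 4" by linarith
  then have e4: "card (edges ?M) \<le> 4" using A(3) M4 by auto
  have bp: "12 \<le> 2 * card (edges ?M) + card D"
    using block_pairs[of ?M "h v"] M4 by (simp add: block_def)
  have off10: "card off \<ge> 10" using e4 bp off by linarith
  have R5: "card (R i) \<ge> 5" and C5: "card (C j - {i}) \<ge> 5" using off10 s le5(1)[of i] le5(2)[of j] C' by linarith+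
  have Rf: "R i = UNIV - {i}" using R5 by (rule R_full)
  have Cf: "C j = UNIV - {j}" using C5 C' by (intro C_full) linarith
  have "card D \<le> 4" using off s le5(1)[of i] le5(2)[of j] C' by linarith
  then have "card (edges ?M) > 0" using bp by linarith
  then obtain a b where ab: "a \<in> ?M" "b \<in> ?M" "G a b" unfolding edges_def by (auto simp: card_gt_0_iff)
  have "card {a, b} \<le> 2" by (simp add: card_insert_if)
  then have "card ?M > card {a, b}" using M4 by simp
  then obtain u where u: "u \<in> ?M" "u \<notin> {a, b}" by (rule obtain_from_card) simp
  have eq: "i = j"
  proof (rule ccontr)
    assume "i \<noteq> j"
    then have "card (C j - {i}) = 4" unfolding Cf using card6 by (simp add: card_Diff_subset)
    with C5 show False by simp
  qed
  have "G b i" "G u i" using Cf CD(1) ab u ij eq by auto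
  moreover have "G i a" "G i b" using Rf RD(1) ab ij by auto
  moreover have "a \<noteq> b" using ab irrefl by auto
  ultimately show False using no_hub[of a b i u a b] ab u ij by auto
qed

text \<open>With at most one arrow out of \<open>w\<close> there are at most two missing ordered
  pairs. If such an arrow exists, removing its target leaves four vertices without two-step paths,
  hence at least 4 missing pairs. If none exists, nothing is missing: the class is a tournament on
  five vertices, in which \<open>no_walk3\<close> forbids three-step walks.\<close>

lemma block5_low:
  assumes N5: "N v = 5" and cov: "\<forall>u. u \<notin> block v \<longrightarrow> u = w" "w \<notin> block v"
    and low: "card (R w) \<le> 1"
  shows False
proof -
  let ?M = "block v"
  have M5: "card ?M = 5" using N5 by (simp add: card_block)
  have "N u \<le> 2" if "u \<notin> ?M" for u using outside_block[OF that] N5 by simp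
  then have "2 * real (card (range h)) + 2 * real (card inb) + real (card D) = 24"
    using weight_sum_block[of v] N5 by simp
  then have k: "2 * card (range h) + 2 * card inb + card D = 24" by linarith
  then have off: "2 * card off \<ge> 10 + card D" using size' by linarith
  have cr: "\<forall>x y. G x y \<longrightarrow> h x \<noteq> h y \<longrightarrow> x = w \<or> y = w"
  proof (intro allI impI)
    fix x y assume "G x y" "h x \<noteq> h y"
    then have "x \<notin> block v \<or> y \<notin> block v" by (auto simp: block_def)
    then show "x = w \<or> y = w" using cov(1) by blast
  qed
  have s: "card off \<le> card (R w) + card (C w - {w})"
    using off_cross[OF cr] unfolding R_def C_def .
  have C': "card (C w - {w}) \<le> card (C w)" by (rule card_mono) auto
  have C5: "card (C w) \<le> 5" using C_bound[of w] N_pos[of w] by linarith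
  have D2: "card D \<le> 2" and C4: "card (C w) \<ge> 4" using off s C' C5 low by linarith+
  show False
  proof (cases "R w = {}")
    case False
    then obtain x where x: "x \<in> R w" by blast
    have "False" if "a \<in> ?M - {x}" "b \<in> ?M - {x}" "c \<in> ?M - {x}" "G a b" "G b c" for a b c
    proof -
      have "card (C w) > card {a}" using C4 by simp
      then obtain y where y: "y \<in> C w" "y \<notin> {a}" by (rule obtain_from_card) simp
      have "a \<noteq> w" "c \<noteq> w" using that cov(2) by auto
      moreover have "h a = h b" "h b = h c" using that by (auto simp: block_def)
      moreover have "x \<noteq> w" "y \<noteq> w" using RD(2)[OF x] CD(2)[OF y(1)] by auto
      ultimately show False
        using no_path2[OF RD[OF x] CD[OF y(1)] that(4) _ that(5)] that(3) y by auto
    qed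
    then obtain A where A: "A \<subseteq> ?M - {x}" "edges (?M - {x}) \<subseteq> A \<times> (?M - {x} - A)"
      "card (edges (?M - {x})) \<le> card A * (card (?M - {x}) - card A)"
      using edges_no_path by metis
    have xM: "x \<in> ?M" using cov RD(2)[OF x] by blast
    then have M4: "card (?M - {x}) = 4" using M5 by simp
    have "card A \<le> 4" using A(1) M4 card_mono[of "?M - {x}" A] by simp
    then have cA: "card A = 0 \<or> card A = 1 \<or> card A = 2 \<or> card A = 3 \<or> card A = 4" by linarith
    then have e4: "card (edges (?M - {x})) \<le> 4" using A(3) M4 by auto
    have bp: "12 \<le> 2 * card (edges (?M - {x})) + card D"
      using block_pairs[of "?M - {x}" "h v"] M4 by (simp add: block_def)
    then show False using e4 D2 by linarith
  next
    case True
    then have "card (R w) = 0" by simp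
    then have D0: "card D = 0" and C5': "card (C w) \<ge> 5" using off s C' C5 by linarith+
    have tour: "G a b \<or> G b a" if "a \<in> ?M" "b \<in> ?M" "a \<noteq> b" for a b
    proof (rule ccontr)
      assume "\<not> ?thesis"
      then have "(a, b) \<in> D" using that unfolding D_def block_def by auto
      then show False using D0 by auto
    qed
    have walk: False if "a \<in> ?M" "b \<in> ?M" "c \<in> ?M" "d \<in> ?M" "G a b" "G b c" "G c d" for a b c d
    proof -
      have "card {a, b} \<le> 2" by (simp add: card_insert_if)
      then have "card ?M > card {a, b}" using M5 by simp
      then obtain y where y: "y \<in> ?M" "y \<notin> {a, b}" by (rule obtain_from_card) simp
      have "y \<in> C w" using C_full[OF C5'] y(1) cov(2) by auto
      moreover have "h a = h b" "h b = h c" "h c = h d" using that by (auto simp: block_def)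
      moreover have "w \<noteq> c" "w \<noteq> d" using that cov(2) by auto
      ultimately show False using no_walk3[OF CD[of y w] that(5) _ that(6) _ that(7)] y by auto
    qed
    \<comment> \<open>In a tournament a two-step path gives a three-step walk: any further vertex d
      can be appended, put in front, or inserted.\<close>
    have "False" if "a \<in> ?M" "b \<in> ?M" "c \<in> ?M" "G a b" "G b c" for a b c
    proof -
      have "card {a, b, c} \<le> 3" by (simp add: card_insert_if)
      then have "card ?M > card {a, b, c}" using M5 by simp
      then obtain d where d: "d \<in> ?M" "d \<notin> {a, b, c}" by (rule obtain_from_card) simp
      have n1: "\<not> G c d" using walk[of a b c d] that d by blast
      then have dc: "G d c" using tour[of c d] that d by auto
      have "\<not> G d a" using walk[of d a b c] that d by blast
      then have ad: "G a d" using tour[of a d] that d by auto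
      show False
      proof (cases "G b d")
        case True
        then show False using walk[of a b d c] that d dc by blast
      next
        case False
        then have "G d b" using tour[of b d] that d by auto
        then show False using walk[of a d b c] that d ad by blast
      qed
    qed
    then obtain A where A: "A \<subseteq> ?M" "edges ?M \<subseteq> A \<times> (?M - A)" "card (edges ?M) \<le> card A * (card ?M - card A)"
      using edges_no_path by metis
    have "card A \<le> 5" using A(1) M5 card_mono[of ?M A] by simp
    then have cA: "card A = 0 \<or> card A = 1 \<or> card A = 2 \<or> card A = 3 \<or> card A = 4 \<or> card A = 5" by linarith
    then have e6: "card (edges ?M) \<le> 6" using A(3) M5 by auto
    have bp: "20 \<le> 2 * card (edges ?M) + card D"
      using block_pairs[of ?M "h v"] M5 by (simp add: block_def)
    then show False using e6 D2 by linarith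
  qed
qed

text \<open>Two arrows into \<open>w\<close> and two out of it exclude two-step paths in the class
  by \<open>no_path2\<close>. So at most 6 of its 10 pairs are arrows, and \<open>off\<close> has at
  least 9 elements. Then at least four of the five vertices point to \<open>w\<close>, some inner
  arrow ends at one of them, and \<open>w\<close> is a forbidden hub.\<close>

lemma block5_high:
  assumes N5: "N v = 5" and cov: "\<forall>u. u \<notin> block v \<longrightarrow> u = w" "w \<notin> block v"
    and high: "card (R w) \<ge> 2" "card (C w) \<ge> 2"
  shows False
proof -
  let ?M = "block v"
  have M5: "card ?M = 5" using N5 by (simp add: card_block)
  have "N u \<le> 2" if "u \<notin> ?M" for u using outside_block[OF that] N5 by simp
  then have "2 * real (card (range h)) + 2 * real (card inb) + real (card D) = 24"
    using weight_sum_block[of v] N5 by simp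
  then have k: "2 * card (range h) + 2 * card inb + card D = 24" by linarith
  then have off: "2 * card off \<ge> 10 + card D" using size' by linarith
  have cr: "\<forall>x y. G x y \<longrightarrow> h x \<noteq> h y \<longrightarrow> x = w \<or> y = w"
  proof (intro allI impI)
    fix x y assume "G x y" "h x \<noteq> h y"
    then have "x \<notin> block v \<or> y \<notin> block v" by (auto simp: block_def)
    then show "x = w \<or> y = w" using cov(1) by blast
  qed
  have s: "card off \<le> card (R w) + card (C w - {w})"
    using off_cross[OF cr] unfolding R_def C_def .
  have C': "card (C w - {w}) \<le> card (C w)" by (rule card_mono) auto
  have le5: "card (R w) \<le> 5" "card (C w) \<le> 5"
    using R_bound[of w] C_bound[of w] N_pos[of w] by linarith+
  have "False" if "a \<in> ?M" "b \<in> ?M" "c \<in> ?M" "G a b" "G b c" for a b c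
  proof -
    have "card (R w) > card {c}" using high by simp
    then obtain x where x: "x \<in> R w" "x \<notin> {c}" by (rule obtain_from_card) simp
    have "card (C w) > card {a}" using high by simp
    then obtain y where y: "y \<in> C w" "y \<notin> {a}" by (rule obtain_from_card) simp
    have "a \<noteq> w" "c \<noteq> w" using that cov(2) by auto
    moreover have "h a = h b" "h b = h c" using that by (auto simp: block_def)
    moreover have "x \<noteq> w" "y \<noteq> w" using RD(2)[OF x(1)] CD(2)[OF y(1)] by auto
    ultimately show False
      using no_path2[OF RD[OF x(1)] CD[OF y(1)] that(4) _ that(5)] x y by auto
  qed
  then obtain A where A: "A \<subseteq> ?M" "edges ?M \<subseteq> A \<times> (?M - A)" "card (edges ?M) \<le> card A * (card ?M - card A)"
    using edges_no_path by metis
  have "card A \<le> 5" using A(1) M5 card_mono[of ?M A] by simp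
  then have cA: "card A = 0 \<or> card A = 1 \<or> card A = 2 \<or> card A = 3 \<or> card A = 4 \<or> card A = 5" by linarith
  then have e6: "card (edges ?M) \<le> 6" using A(3) M5 by auto
  have bp: "20 \<le> 2 * card (edges ?M) + card D"
    using block_pairs[of ?M "h v"] M5 by (simp add: block_def)
  have C4: "card (C w) \<ge> 4" and e5: "card (edges ?M) \<ge> 5" using e6 bp off s C' le5 by linarith+
  have CM: "C w \<subseteq> ?M" using cov CD(2) by blast
  \<comment> \<open>At most one vertex \<open>m\<close> of the class has no arrow to
    \<open>w\<close>, and at most four inner arrows end at \<open>m\<close>; among the at least five
    inner arrows one ends elsewhere.\<close>
  have "\<exists>a b. a \<in> ?M \<and> b \<in> C w \<and> G a b"
  proof (rule ccontr)
    assume no: "\<not> ?thesis"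
    have "card (?M - C w) \<le> 1" using CM C4 M5 by (simp add: card_Diff_subset)
    then obtain m where m: "?M - C w \<subseteq> {m}" using card_le_Suc0_iff_eq[of "?M - C w"] by (cases "?M - C w = {}") auto
    have sub: "edges ?M \<subseteq> (?M - {m}) \<times> {m}"
    proof
      fix z assume "z \<in> edges ?M"
      then obtain a b where z: "z = (a, b)" "a \<in> ?M" "b \<in> ?M" "G a b" unfolding edges_def by auto
      with no m have "b = m" by blast
      with z irrefl show "z \<in> (?M - {m}) \<times> {m}" by auto
    qed
    show False
    proof (cases "m \<in> ?M")
      case True
      then have "card ((?M - {m}) \<times> {m}) = 4" using M5 by (simp add: card_cartesian_product)
      then show False using card_mono[OF _ sub] e5 by simp
    next
      case False
      then have "edges ?M = {}" using sub unfolding edges_def by auto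
      then show False using e5 by simp
    qed
  qed
  then obtain a b where ab: "a \<in> ?M" "b \<in> C w" "G a b" by blast
  have "card {a, b} \<le> 2" by (simp add: card_insert_if)
  then have "card (C w) > card {a, b}" using C4 by simp
  then obtain u where u: "u \<in> C w" "u \<notin> {a, b}" by (rule obtain_from_card) simp
  have "card (R w) > card ({} :: 'n set)" using high by simp
  then obtain y where y: "y \<in> R w" by (rule obtain_from_card) simp_all
  have "card (R w) > card {y}" using high by simp
  then obtain z where z: "z \<in> R w" "z \<notin> {y}" by (rule obtain_from_card) simp_all
  have "a \<noteq> w" "b \<noteq> w" "u \<noteq> w" "a \<noteq> b" using ab u(1) cov(2) CM irrefl by auto
  then show False
    using no_hub[OF ab(3) CD(1)[OF ab(2)] CD(1)[OF u(1)] RD(1)[OF y] RD(1)[OF z(1)]] u z by auto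
qed

lemma conv_R: "pivot_graph.R h (\<lambda>i j. G j i) = C"
proof
  interpret conv: pivot_graph h "\<lambda>i j. G j i" by (rule converse_pivot_graph)
  show "conv.R i = C i" for i
    unfolding conv.R_def C_def by (rule Collect_cong) metis
qed

lemma card_conv_off: "card (pivot_graph.off h (\<lambda>i j. G j i)) = card off"
proof -
  interpret conv: pivot_graph h "\<lambda>i j. G j i" by (rule converse_pivot_graph)
  have "conv.off = prod.swap ` off" unfolding conv.off_def off_def by force
  then show ?thesis by (simp add: card_image)
qed

lemma cover:
  obtains (rows) i j where "\<forall>x y. G x y \<longrightarrow> h x \<noteq> h y \<longrightarrow> x = i \<or> x = j"
  | (cols) i j where "\<forall>x y. G x y \<longrightarrow> h x \<noteq> h y \<longrightarrow> y = i \<or> y = j"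
  | (cross) i j where "\<forall>x y. G x y \<longrightarrow> h x \<noteq> h y \<longrightarrow> x = i \<or> y = j"
proof -
  have "(\<exists>a b. \<forall>x y. (G x y \<and> h x \<noteq> h y) \<longrightarrow> x = a \<or> x = b) \<or>
        (\<exists>a b. \<forall>x y. (G x y \<and> h x \<noteq> h y) \<longrightarrow> y = a \<or> y = b) \<or>
        (\<exists>a b. \<forall>x y. (G x y \<and> h x \<noteq> h y) \<longrightarrow> x = a \<or> y = b)"
  proof (rule cover_by_two_lines)
    fix i1 i2 i3 j1 j2 j3
    assume "G i1 j1 \<and> h i1 \<noteq> h j1" "G i2 j2 \<and> h i2 \<noteq> h j2" "G i3 j3 \<and> h i3 \<noteq> h j3"
      "distinct [i1, i2, i3]" "distinct [j1, j2, j3]"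
    then show False using no_matching[of i1 j1 i2 j2 i3 j3] by blast
  qed
  then consider (1) a b where "\<forall>x y. G x y \<and> h x \<noteq> h y \<longrightarrow> x = a \<or> x = b"
    | (2) a b where "\<forall>x y. G x y \<and> h x \<noteq> h y \<longrightarrow> y = a \<or> y = b"
    | (3) a b where "\<forall>x y. G x y \<and> h x \<noteq> h y \<longrightarrow> x = a \<or> y = b"
    by (elim disjE exE)
  then show ?thesis
  proof cases
    case 1 then show ?thesis by (intro rows[of a b]) blast
  next
    case 2 then show ?thesis by (intro cols[of a b]) blast
  next
    case 3 then show ?thesis by (intro cross[of a b]) blast
  qed
qed

text \<open>A class of three without two-step paths has at most 2 arrows, hence a missing pair. The
  count then asks for 11 arrows between colours, where two lines hold at most 10.\<close>

lemma block3:
  assumes N3: "N v = 3" and out: "\<And>u. u \<notin> block v \<Longrightarrow> N u \<le> 2"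
  shows False
proof -
  let ?M = "block v"
  have M3: "card ?M = 3" using N3 by (simp add: card_block)
  have "2 * real (card (range h)) + 2 * real (card inb) + real (card D) = 14"
    using weight_sum_block[OF out] N3 by simp
  then have k: "2 * card (range h) + 2 * card inb + card D = 14" by linarith
  then have off: "2 * card off \<ge> 20 + card D" using size' by linarith
  have le5: "card (R u) \<le> 5" "card (C u) \<le> 5" for u
    using R_bound[of u] C_bound[of u] N_pos[of u] by linarith+
  have le3: "card (R u) \<le> 3" "card (C u) \<le> 3" if "u \<in> ?M" for u
  proof -
    have "N u = 3" using that N3 N_cong[of u v] by (simp add: block_def)
    then show "card (R u) \<le> 3" "card (C u) \<le> 3" using R_bound[of u] C_bound[of u] by simp_all
  qed
  have C': "card (C j - {i}) \<le> card (C j)" for i j by (rule card_mono) auto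
  interpret conv: pivot_graph h "\<lambda>i j. G j i" by (rule converse_pivot_graph)
  note coff = card_conv_off
  have no: "False" if "a \<in> ?M" "b \<in> ?M" "c \<in> ?M" "G a b" "G b c" for a b c
  proof (cases rule: cover)
    case (rows i j)
    have "card off \<le> card (R i) + card (R j)" using off_rows[OF rows] unfolding R_def by blast
    then have "i \<notin> ?M" "j \<notin> ?M"
      using le3(1)[of i] le3(1)[of j] le5(1)[of i] le5(1)[of j] off by linarith+
    then show False using no_path_rows[OF rows _ _ _ that] off by simp
  next
    case (cols i j)
    have cov: "\<forall>x y. G y x \<longrightarrow> h x \<noteq> h y \<longrightarrow> x = i \<or> x = j" using cols by metis
    have "card off \<le> card (C i) + card (C j)"
      using conv.off_rows[OF cov] unfolding conv.R_def[symmetric] coff conv_R .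
    then have "i \<notin> ?M" "j \<notin> ?M"
      using le3(2)[of i] le3(2)[of j] le5(2)[of i] le5(2)[of j] off by linarith+
    then show False using conv.no_path_rows[of i j v c b a] cov off that by (simp add: coff)
  next
    case (cross i j)
    have "card off \<le> card (R i) + card (C j - {i})" using off_cross[OF cross] unfolding R_def C_def by blast
    then have "i \<notin> ?M" "j \<notin> ?M"
      using le3(1)[of i] le3(2)[of j] le5(1)[of i] le5(2)[of j] off C'[of j i] by linarith+
    then show False using no_path_cross[OF cross _ _ _ that] off by simp
  qed
  then obtain A where A: "A \<subseteq> ?M" "edges ?M \<subseteq> A \<times> (?M - A)" "card (edges ?M) \<le> card A * (card ?M - card A)"
    using edges_no_path by metis
  have "card A \<le> 3" using A(1) M3 card_mono[of ?M A] by simp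
  then have cA: "card A = 0 \<or> card A = 1 \<or> card A = 2 \<or> card A = 3" by linarith
  then have e2: "card (edges ?M) \<le> 2" using A(3) M3 by auto
  have bp: "6 \<le> 2 * card (edges ?M) + card D"
    using block_pairs[of ?M "h v"] M3 by (simp add: block_def)
  have off11: "card off \<ge> 11" using e2 bp off by linarith
  show False
  proof (cases rule: cover)
    case (rows i j)
    have "card off \<le> card (R i) + card (R j)" using off_rows[OF rows] unfolding R_def by blast
    then show False using le5(1)[of i] le5(1)[of j] off11 by linarith
  next
    case (cols i j)
    have cov: "\<forall>x y. G y x \<longrightarrow> h x \<noteq> h y \<longrightarrow> x = i \<or> x = j" using cols by metis
    have "card off \<le> card (C i) + card (C j)"
      using conv.off_rows[OF cov] unfolding conv.R_def[symmetric] coff conv_R .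
    then show False using le5(2)[of i] le5(2)[of j] off11 by linarith
  next
    case (cross i j)
    have "card off \<le> card (R i) + card (C j - {i})" using off_cross[OF cross] unfolding R_def C_def by blast
    then show False using le5(1)[of i] le5(2)[of j] off11 C'[of j i] by linarith
  qed
qed

lemma off_le10: "card off \<le> 10"
proof -
  have le5: "card (R u) \<le> 5" "card (C u) \<le> 5" for u
    using R_bound[of u] C_bound[of u] N_pos[of u] by linarith+
  have C': "card (C j - {i}) \<le> card (C j)" for i j by (rule card_mono) auto
  interpret conv: pivot_graph h "\<lambda>i j. G j i" by (rule converse_pivot_graph)
  note coff = card_conv_off
  show ?thesis
  proof (cases rule: cover)
    case (rows i j)
    have "card off \<le> card (R i) + card (R j)" using off_rows[OF rows] unfolding R_def by blast
    then show ?thesis using le5(1)[of i] le5(1)[of j] by linarith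
  next
    case (cols i j)
    have cov: "\<forall>x y. G y x \<longrightarrow> h x \<noteq> h y \<longrightarrow> x = i \<or> x = j" using cols by metis
    have "card off \<le> card (C i) + card (C j)"
      using conv.off_rows[OF cov] unfolding conv.R_def[symmetric] coff conv_R .
    then show ?thesis using le5(2)[of i] le5(2)[of j] by linarith
  next
    case (cross i j)
    have "card off \<le> card (R i) + card (C j - {i})" using off_cross[OF cross] unfolding R_def C_def by blast
    then show ?thesis using le5(1)[of i] le5(2)[of j] C'[of j i] by linarith
  qed
qed

text \<open>Sizes up to 2 would require 11 arrows between colours. Two classes of size 3 require 9,
  but then two lines hold at most 6. A single colour leaves at most 16 for arrows and colours
  together. What remains are one class of size 3, 4 or 5 among smaller ones, and only size 4
  survives.\<close>

theorem full_rows_or_cols: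
  "\<exists>i j s1 s2 t1 t2. full_rows h G i j s1 s2 t1 t2 \<or> full_rows h (\<lambda>i j. G j i) i j s1 s2 t1 t2"
proof -
  interpret conv: pivot_graph h "\<lambda>i j. G j i" by (rule converse_pivot_graph)
  obtain v where vmax: "\<And>u. N u \<le> N v"
  proof -
    have "finite (range N)" "range N \<noteq> {}" by auto
    then obtain v where "Max (range N) = N v" using Max_in by blast
    moreover have "N u \<le> Max (range N)" for u by simp
    ultimately show ?thesis using that[of v] by simp
  qed
  have v6: "N v \<le> 6" using card_mono[of UNIV "block v"] card6 by (simp add: card_block)
  have off10: "card off \<le> 10" by (rule off_le10)
  consider "N v \<le> 2" | "N v = 3" | "N v = 4" | "N v = 5" | "N v = 6" using v6 by linarith
  then show ?thesis
  proof cases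
    case 1
    have "N u \<le> 2" for u using vmax[of u] 1 by linarith
    then have "2 * real (card (range h)) + 2 * real (card inb) + real (card D)
      = N v * (2 / N v + real (N v) - 1) + 2 * (6 - real (N v))" by (intro weight_sum_block)
    moreover have "N v = 1 \<or> N v = 2" using 1 N_pos[of v] by linarith
    ultimately have "2 * real (card (range h)) + 2 * real (card inb) + real (card D) = 12" by auto
    then show ?thesis using size' off10 by linarith
  next
    case 2
    have le: "N u \<le> 3" for u using vmax[of u] 2 by simp
    show ?thesis
    proof (cases "\<forall>u. N u = 3")
      case True
      have "2 * real (card (range h)) + 2 * real (card inb) + real (card D) = 16"
        using weight_sum True card6 by simp
      then have off9: "card off \<ge> 9" using size' by linarith
      have le3: "card (R u) \<le> 3" "card (C u) \<le> 3" for u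
        using R_bound[of u] C_bound[of u] True by simp_all
      have C': "card (C j - {i}) \<le> card (C j)" for i j by (rule card_mono) auto
      note coff = card_conv_off
      have False
      proof (cases rule: cover)
        case (rows i j)
        have "card off \<le> card (R i) + card (R j)" using off_rows[OF rows] unfolding R_def by blast
        then show False using le3(1)[of i] le3(1)[of j] off9 by linarith
      next
        case (cols i j)
        have cov: "\<forall>x y. G y x \<longrightarrow> h x \<noteq> h y \<longrightarrow> x = i \<or> x = j" using cols by metis
        have "card off \<le> card (C i) + card (C j)"
          using conv.off_rows[OF cov] unfolding conv.R_def[symmetric] coff conv_R .
        then show False using le3(2)[of i] le3(2)[of j] off9 by linarith
      next
        case (cross i j)
        have "card off \<le> card (R i) + card (C j - {i})" using off_cross[OF cross] unfolding R_def C_def by blast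
        then show False using le3(1)[of i] le3(2)[of j] off9 C'[of j i] by linarith
      qed
      then show ?thesis by blast
    next
      case False
      then obtain u0 where u0: "N u0 \<noteq> 3" by blast
      have "N u \<le> 2" if "u \<notin> block v" for u
      proof (rule ccontr)
        assume "\<not> N u \<le> 2"
        then have Nu: "N u = 3" using le[of u] by simp
        have "card (block u \<union> block v) = N u + N v" unfolding card_block[symmetric]
          by (rule card_Un_disjoint) (use that in \<open>auto simp: block_def\<close>)
        then have "card (block u \<union> block v) = 6" using Nu 2 by simp
        then have "block u \<union> block v = UNIV" using card6 by (simp add: card_eq_UNIV_imp_eq_UNIV)
        then have "u0 \<in> block u \<or> u0 \<in> block v" by blast
        then show False using N_cong[of u0 u] N_cong[of u0 v] Nu 2 u0 by (auto simp: block_def)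
      qed
      then show ?thesis using block3 2 by blast
    qed
  next
    case 3
    show ?thesis
    proof (cases rule: cover)
      case (rows i j)
      then show ?thesis using block4_rows[OF 3] by blast
    next
      case (cols i j)
      have cov: "\<forall>x y. G y x \<longrightarrow> h x \<noteq> h y \<longrightarrow> x = i \<or> x = j" using cols by metis
      then show ?thesis using conv.block4_rows[OF 3 cov] by blast
    next
      case (cross i j)
      then show ?thesis using block4_cross[OF 3] by blast
    qed
  next
    case 4
    have "card (- block v) = 1" using card6 4 by (simp add: Compl_eq_Diff_UNIV card_Diff_subset card_block)
    then obtain w where w: "- block v = {w}" by (meson card_1_singletonE)
    have c: "\<forall>u. u \<notin> block v \<longrightarrow> u = w" "w \<notin> block v" using w by auto
    have "card (R w) \<ge> 2" using block5_low[OF 4 c] by fastforce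
    moreover have "card (conv.R w) \<ge> 2" using conv.block5_low[OF 4 c] by fastforce
    then have "card (C w) \<ge> 2" unfolding conv_R .
    ultimately show ?thesis using block5_high[OF 4 c] by blast
  next
    case 5
    have "block v = UNIV" using card6 5 card_block[of v] by (simp add: card_eq_UNIV_imp_eq_UNIV)
    then have hv: "h u = h v" for u by (auto simp: block_def)
    have "h a = h b" for a b using hv[of a] hv[of b] by simp
    then have "off = {}" unfolding off_def by blast
    moreover have "2 * real (card (range h)) + 2 * real (card inb) + real (card D) = 32"
      using weight_sum_block[of v] 5 \<open>block v = UNIV\<close> by simp
    ultimately show ?thesis using size' by simp
  qed
qed

end

subsection \<open>Commutators of rank at most two\<close>

definition minor3 :: "'a::comm_ring_1 ^ 'n ^ 'm \<Rightarrow> 'm \<Rightarrow> 'm \<Rightarrow> 'm \<Rightarrow> 'n \<Rightarrow> 'n \<Rightarrow> 'n \<Rightarrow> 'a" where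
  "minor3 M i1 i2 i3 j1 j2 j3 =
     M$i1$j1 * (M$i2$j2 * M$i3$j3 - M$i2$j3 * M$i3$j2)
   - M$i1$j2 * (M$i2$j1 * M$i3$j3 - M$i2$j3 * M$i3$j1)
   + M$i1$j3 * (M$i2$j1 * M$i3$j2 - M$i2$j2 * M$i3$j1)"

text \<open>A sum of two outer products. In this form the bound visibly survives multiplication,
  transposition and change of sign, and the vanishing of the 3 by 3 minors is a polynomial
  identity.\<close>

definition rank_le2 :: "'a::comm_ring_1 ^ 'n ^ 'm \<Rightarrow> bool" where
  "rank_le2 M \<longleftrightarrow> (\<exists>a b c d. \<forall>i j. M$i$j = a$i * b$j + c$i * d$j)"

lemma rank_le2_minor3: "rank_le2 M \<Longrightarrow> minor3 M i1 i2 i3 j1 j2 j3 = 0"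
  unfolding rank_le2_def minor3_def by (elim exE) (simp add: algebra_simps)

lemma rank_le2I:
  fixes M :: "'a::field ^ 'n ^ 'm"
  assumes "rank M \<le> 2"
  shows "rank_le2 M"
proof -
  obtain B where B: "B \<subseteq> rows M" "vec.independent B" "rows M \<subseteq> vec.span B" "card B = vec.dim (rows M)"
    using vec.basis_exists[of "rows M"] by blast
  have fB: "finite B" using B(2) by (rule vec.finiteI_independent)
  have "card B \<le> 2" using B(4) assms by (simp add: row_rank_def_gen)
  then obtain b d where bd: "B \<subseteq> {b, d}"
  proof -
    assume that: "\<And>b d. B \<subseteq> {b, d} \<Longrightarrow> thesis"
    consider "card B = 0" | "card B = 1" | "card B = 2" using \<open>card B \<le> 2\<close> by linarith
    then show thesis
    proof cases
      case 1 then show thesis using that fB by auto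
    next
      case 2 then obtain x where "B = {x}" by (rule card_1_singletonE)
      then show thesis using that[of x x] by simp
    next
      case 3 then obtain x y where "B = {x, y}" by (auto simp: card_2_iff)
      then show thesis using that[of x y] by simp
    qed
  qed
  have "\<exists>x y. row i M = x *s b + y *s d" for i
  proof -
    have "row i M \<in> vec.span {b, d}"
      using B(3) vec.span_mono[OF bd] by (auto simp: rows_def)
    then obtain k where "row i M - k *s b \<in> vec.span {d}" by (auto simp: vec.span_breakdown_eq)
    then obtain y where "row i M - k *s b = y *s d" unfolding vec.span_singleton by auto
    then have "row i M = k *s b + y *s d" by (simp add: diff_eq_eq add.commute)
    then show ?thesis by blast
  qed
  then obtain x y where xy: "\<And>i. row i M = x i *s b + y i *s d" by metis
  have "M$i$j = (\<chi> i. x i)$i * b$j + (\<chi> i. y i)$i * d$j" for i j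
    using xy[of i] by (simp add: row_def vec_eq_iff)
  then show ?thesis unfolding rank_le2_def by blast
qed

lemma rank_le2_mult:
  assumes "rank_le2 M" shows "rank_le2 (A ** M ** B)"
proof -
  obtain a b c d where *: "\<And>i j. M$i$j = a$i * b$j + c$i * d$j"
    using assms unfolding rank_le2_def by blast
  have "(A ** M ** B)$i$j = (A *v a)$i * (b v* B)$j + (A *v c)$i * (d v* B)$j" for i j
  proof -
    have "(A ** M)$i$k = (A *v a)$i * b$k + (A *v c)$i * d$k" for k
      by (simp add: matrix_matrix_mult_def matrix_vector_mult_def * sum.distrib sum_distrib_right distrib_left mult.assoc)
    then show ?thesis
      by (simp add: matrix_matrix_mult_def[of "A ** M"] vector_matrix_mult_def sum.distrib sum_distrib_left algebra_simps)
  qed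
  then show ?thesis unfolding rank_le2_def by blast
qed

lemma rank_le2_transpose: "rank_le2 M \<Longrightarrow> rank_le2 (transpose M)"
  unfolding rank_le2_def transpose_def by (auto simp: mult.commute) metis

lemma rank_le2_uminus: "rank_le2 M \<Longrightarrow> rank_le2 (- M)"
  unfolding rank_le2_def
proof (elim exE)
  fix a b c d assume *: "\<forall>i j. M$i$j = a$i * b$j + c$i * d$j"
  have "\<forall>i j. (- M)$i$j = (- a)$i * b$j + (- c)$i * d$j" using * by simp
  then show "\<exists>a b c d. \<forall>i j. (- M)$i$j = a$i * b$j + c$i * d$j" by blast
qed

definition comm :: "complex ^ 'n ^ 'n \<Rightarrow> complex ^ 'n ^ 'n \<Rightarrow> complex ^ 'n ^ 'n" where
  "comm S T = S ** T - T ** S"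

lemma comm_nth: "comm S T $ i $ j = (\<Sum>k\<in>UNIV. S$i$k * T$k$j) - (\<Sum>k\<in>UNIV. T$i$k * S$k$j)"
  by (simp add: comm_def matrix_matrix_mult_def)

lemma comm_transpose: "comm (transpose S) (transpose T) = - transpose (comm S T)"
  by (simp add: vec_eq_iff comm_nth transpose_def mult.commute)

lemma matrix_mult_diff:
  fixes A B C :: "complex ^ 'n ^ 'n"
  shows "A ** (B - C) = A ** B - A ** C" "(B - C) ** A = B ** A - C ** A"
  by (simp_all add: vec_eq_iff matrix_matrix_mult_def sum_subtractf algebra_simps)

lemma comm_conj:
  fixes P Q :: "complex ^ 'n ^ 'n"
  assumes "P ** Q = mat 1"
  shows "comm (Q ** S ** P) (Q ** T ** P) = Q ** comm S T ** P"
proof -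
  have "(Q ** S ** P) ** (Q ** T ** P) = Q ** (S ** (P ** Q) ** T) ** P" for S T :: "complex ^ 'n ^ 'n"
    by (simp add: matrix_mul_assoc)
  then have "(Q ** S ** P) ** (Q ** T ** P) = Q ** (S ** T) ** P" for S T :: "complex ^ 'n ^ 'n"
    using assms by simp
  then show ?thesis
    by (simp add: comm_def matrix_mult_diff)
qed

subsection \<open>Block triangular form and eigenvalues\<close>

text \<open>A nonzero polynomial p with p(T) x = 0 exists among the combinations of the iterates T^k
  x. If r is a root and p = (X - r) q, then q(T) x is either zero, and q has smaller degree, or an
  eigenvector for r. All these vectors stay in the invariant space \<open>W\<close>.\<close>

lemma eigenvector_exists:
  fixes T :: "complex ^ 'n ^ 'n"
  assumes W: "vec.subspace W" "\<forall>x\<in>W. T *v x \<in> W" and x: "x \<in> W" "x \<noteq> 0"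
  obtains \<mu> y where "y \<in> W" "y \<noteq> 0" "T *v y = \<mu> *s y"
proof -
  define F where "F k = (((*v) T) ^^ k) x" for k
  have F0: "F 0 = x" and FS: "F (Suc k) = T *v F k" for k by (simp_all add: F_def)
  \<comment> \<open>\<open>ap p N\<close> is p(T) x as soon as \<open>N\<close> is at least the
    degree of \<open>p\<close>.\<close>
  define ap where "ap p N = (\<Sum>i\<le>N. coeff p i *s F i)" for p :: "complex poly" and N
  have FW: "F k \<in> W" for k by (induction k) (use x W F0 FS in auto)
  have apW: "ap p N \<in> W" for p N
    unfolding ap_def by (intro vec.subspace_sum W(1) vec.subspace_scale FW)
  have step: "ap ([:-r, 1:] * q) (Suc N) = T *v ap q N - r *s ap q N" if "degree q \<le> N" for r q N
  proof -
    have q0: "coeff q (Suc N) = 0" using that by (simp add: coeff_eq_0)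
    have c: "coeff ([:-r, 1:] * q) i = (case i of 0 \<Rightarrow> 0 | Suc j \<Rightarrow> coeff q j) - r * coeff q i" for i
      by (simp add: mult_pCons_left coeff_pCons)
    have "ap ([:-r, 1:] * q) (Suc N) = (\<Sum>i\<le>Suc N. (case i of 0 \<Rightarrow> 0 | Suc j \<Rightarrow> coeff q j) *s F i) - (\<Sum>i\<le>Suc N. (r * coeff q i) *s F i)"
      unfolding ap_def c by (simp add: vec.scale_left_diff_distrib sum_subtractf del: sum.atMost_Suc)
    also have "(\<Sum>i\<le>Suc N. (case i of 0 \<Rightarrow> 0 | Suc j \<Rightarrow> coeff q j) *s F i) = (\<Sum>i\<le>N. coeff q i *s F (Suc i))"
      by (subst sum.atMost_Suc_shift) simp
    also have "\<dots> = T *v ap q N"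
      unfolding ap_def FS by (simp add: vec.linear_sum[OF matrix_vector_mul_linear_gen] vec.linear_scale[OF matrix_vector_mul_linear_gen])
    also have "(\<Sum>i\<le>Suc N. (r * coeff q i) *s F i) = r *s ap q N"
      unfolding ap_def by (simp add: q0 vec.scale_sum_right)
    finally show ?thesis .
  qed
  have *: "\<exists>\<mu> y. y \<in> W \<and> y \<noteq> 0 \<and> T *v y = \<mu> *s y" if "p \<noteq> 0" "degree p = N" "ap p N = 0" for p N
    using that
  proof (induction N arbitrary: p)
    case 0
    then have "coeff p 0 *s x = 0" by (simp add: ap_def F0)
    moreover have "coeff p 0 \<noteq> 0" using 0 by (metis leading_coeff_0_iff)
    ultimately show ?case using x by simp
  next
    case (Suc N)
    have "\<not> constant (poly p)" using Suc.prems by (simp add: constant_degree)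
    then obtain r where "poly p r = 0" using fundamental_theorem_of_algebra by blast
    then obtain q where q: "p = [:-r, 1:] * q" by (metis poly_eq_0_iff_dvd dvdE)
    have q0: "q \<noteq> 0" using q Suc.prems by auto
    have dq: "degree q = N" using Suc.prems(2) unfolding q by (simp add: degree_mult_eq q0 del: mult_pCons_left)
    have "T *v ap q N - r *s ap q N = 0" using Suc.prems(3) step[of q N r] dq q by simp
    then show ?case using Suc.IH[OF q0 dq] apW by (cases "ap q N = 0") auto
  qed
  \<comment> \<open>Among one more iterate than the dimension, either two coincide or they form a
    dependent set. The coincidence is a case of its own because dependence is a property of the set
    of vectors.\<close>
  obtain p N where "p \<noteq> 0" "degree p = N" "ap p N = 0"
  proof (cases "inj_on F {..CARD('n)}")
    case True
    have "card (F ` {..CARD('n)}) > CARD('n)" using True by (simp add: card_image)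
    then have "vec.dependent (F ` {..CARD('n)})"
      using vec.independent_card_le_dim[of "F ` {..CARD('n)}" UNIV] by (auto simp: vec.dim_UNIV card_cart_basis)
    then obtain u where u: "\<exists>v\<in>F ` {..CARD('n)}. u v \<noteq> 0" "(\<Sum>v\<in>F ` {..CARD('n)}. u v *s v) = 0"
      using vec.dependent_finite[of "F ` {..CARD('n)}"] by auto
    define p where "p = (\<Sum>i\<le>CARD('n). monom (u (F i)) i)"
    have cp: "coeff p i = (if i \<le> CARD('n) then u (F i) else 0)" for i
      by (simp add: p_def coeff_sum coeff_monom)
    have p0: "p \<noteq> 0" using u(1) cp by (metis (no_types, lifting) atMost_iff coeff_0 imageE)
    have le: "degree p \<le> CARD('n)" by (rule degree_le) (simp add: cp)
    have "ap p CARD('n) = 0"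
      using u(2) unfolding sum.reindex[OF True] ap_def by (simp add: cp)
    also have "ap p CARD('n) = ap p (degree p)"
      unfolding ap_def by (rule sum.mono_neutral_right) (use le in \<open>auto simp: coeff_eq_0\<close>)
    finally show ?thesis using that p0 by blast
  next
    case False
    then obtain a b where ab: "a \<noteq> b" "F a = F b" by (auto simp: inj_on_def)
    define p :: "complex poly" where "p = monom 1 a - monom 1 b"
    have cp: "coeff p i = (if i = a then 1 else 0) - (if i = b then 1 else 0)" for i
      by (auto simp: p_def coeff_monom)
    have p0: "p \<noteq> 0" using cp[of a] ab by auto
    have le: "degree p \<le> max a b" by (rule degree_le) (auto simp: cp)
    have "ap p (max a b) = F a - F b"
      unfolding ap_def cp by (simp add: vec.scale_left_diff_distrib sum_subtractf if_distrib[of "\<lambda>c. c *s _"] sum.delta cong: if_cong)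
    also have "ap p (max a b) = ap p (degree p)"
      unfolding ap_def by (rule sum.mono_neutral_right) (use le in \<open>auto simp: coeff_eq_0\<close>)
    finally show ?thesis using that[OF p0 refl] ab by simp
  qed
  from *[OF this] show ?thesis using that by blast
qed

lemma subspace_image_shift:
  fixes T :: "complex ^ 'n ^ 'n"
  assumes "vec.subspace W"
  shows "vec.subspace ((\<lambda>x. T *v x - m *s x) ` W)"
proof (rule vec.subspaceI)
  show "0 \<in> (\<lambda>x. T *v x - m *s x) ` W"
    using vec.subspace_0[OF assms] by (intro image_eqI[of _ _ 0]) auto
next
  fix x y assume "x \<in> (\<lambda>x. T *v x - m *s x) ` W" "y \<in> (\<lambda>x. T *v x - m *s x) ` W"
  then obtain a b where "a \<in> W" "b \<in> W" "x = T *v a - m *s a" "y = T *v b - m *s b" by auto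
  then show "x + y \<in> (\<lambda>x. T *v x - m *s x) ` W"
    using vec.subspace_add[OF assms, of a b]
    by (intro image_eqI[of _ _ "a + b"]) (auto simp: matrix_vector_right_distrib vec.scale_right_distrib)
next
  fix c x assume "x \<in> (\<lambda>x. T *v x - m *s x) ` W"
  then obtain a where "a \<in> W" "x = T *v a - m *s a" by auto
  then show "c *s x \<in> (\<lambda>x. T *v x - m *s x) ` W"
    using vec.subspace_scale[OF assms, of a c]
    by (intro image_eqI[of _ _ "c *s a"]) (auto simp: vector_scalar_commute vec.scale_right_diff_distrib mult.commute)
qed

text \<open>For an eigenvalue \<mu> on \<open>W\<close> the map T - \<mu> kills an eigenvector, so
  it is not onto \<open>W\<close>. Every subspace between its image and \<open>W\<close> is
  invariant; \<open>W'\<close> is a hyperplane of this kind.\<close>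

lemma invariant_hyperplane:
  fixes T :: "complex ^ 'n ^ 'n"
  assumes W: "vec.subspace W" "\<forall>x\<in>W. T *v x \<in> W" and d: "vec.dim W = Suc d"
  obtains \<mu> W' w where "vec.subspace W'" "W' \<subseteq> W" "vec.dim W' = d" "\<forall>x\<in>W'. T *v x \<in> W'"
    "w \<in> W" "T *v w - \<mu> *s w \<in> W'" "vec.span (insert w W') = W"
proof -
  have "\<not> W \<subseteq> {0}" using d vec.dim_eq_0[of W] by simp
  then obtain x where x: "x \<in> W" "x \<noteq> 0" by blast
  obtain \<mu> y where y: "y \<in> W" "y \<noteq> 0" "T *v y = \<mu> *s y"
    by (rule eigenvector_exists[OF W x])
  define R where "R = (\<lambda>x. T *v x - \<mu> *s x) ` W"
  have sR: "vec.subspace R" unfolding R_def by (rule subspace_image_shift[OF W(1)])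
  have RW: "R \<subseteq> W" unfolding R_def using W by (auto intro: vec.subspace_diff vec.subspace_scale)
  have "R \<noteq> W"
  proof
    assume RW': "R = W"
    obtain B where B: "B \<subseteq> W" "vec.independent B" "W \<subseteq> vec.span B" "y \<in> B"
    proof -
      have "vec.independent {y}" using y(2) by simp
      then obtain B where "{y} \<subseteq> B" "B \<subseteq> W" "vec.independent B" "W \<subseteq> vec.span B"
        using vec.maximal_independent_subset_extend[of "{y}" W] y(1) by auto
      then show ?thesis using that by blast
    qed
    have fB: "finite B" using B(2) by (rule vec.finiteI_independent)
    have cB: "card B = vec.dim W" using B by (intro vec.basis_card_eq_dim) auto
    define f where "f x = T *v x - \<mu> *s x" for x
    have lf: "Vector_Spaces.linear (*s) (*s) f"
      unfolding f_def by (unfold_locales) (auto simp: matrix_vector_right_distrib vector_scalar_commute vec.scale_right_distrib vec.scale_right_diff_distrib mult.commute)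
    have "R \<subseteq> vec.span (f ` (B - {y}))"
    proof -
      have "R \<subseteq> f ` vec.span B" unfolding R_def f_def using B(3) by auto
      also have "\<dots> = vec.span (f ` B)" by (rule vec.linear_span_image[OF lf, symmetric])
      also have "f ` B = insert (f y) (f ` (B - {y}))" using B(4) by auto
      also have "f y = 0" using y(3) by (simp add: f_def)
      finally show ?thesis by (simp add: vec.span_insert_0)
    qed
    then have "vec.dim R \<le> card (f ` (B - {y}))" using fB by (intro vec.dim_le_card) auto
    also have "\<dots> \<le> card (B - {y})" using fB by (intro card_image_le) auto
    also have "\<dots> = d" using fB B(4) cB d by simp
    finally show False using RW' d by simp
  qed
  obtain B C where BC: "B \<subseteq> R" "vec.independent B" "R \<subseteq> vec.span B"
     "B \<subseteq> C" "C \<subseteq> W" "vec.independent C" "W \<subseteq> vec.span C"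
  proof -
    obtain B where B: "B \<subseteq> R" "vec.independent B" "R \<subseteq> vec.span B"
      by (rule vec.basis_exists[of R])
    have BW: "B \<subseteq> W" using B(1) RW by simp
    obtain C where C: "B \<subseteq> C" "C \<subseteq> W" "vec.independent C" "W \<subseteq> vec.span C"
      by (rule vec.maximal_independent_subset_extend[OF BW B(2)])
    show ?thesis by (rule that[OF B C])
  qed
  have "C \<noteq> B"
  proof
    assume "C = B"
    then have "W \<subseteq> vec.span R" using BC(7) vec.span_mono[OF BC(1)] by blast
    then have "W \<subseteq> R" using vec.span_minimal[OF subset_refl sR] by blast
    then show False using \<open>R \<noteq> W\<close> RW by simp
  qed
  then obtain w where w: "w \<in> C" "w \<notin> B" using BC(4) by blast
  have fC: "finite C" using BC(6) by (rule vec.finiteI_independent)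
  have cC: "card C = Suc d" using vec.basis_card_eq_dim[OF BC(5,7,6)] d by simp
  define W' where "W' = vec.span (C - {w})"
  have RW': "R \<subseteq> W'" unfolding W'_def using BC(3) vec.span_mono[of B "C - {w}"] BC(4) w(2) by blast
  have W'W: "W' \<subseteq> W" unfolding W'_def by (rule vec.span_minimal) (use BC(5) W(1) in auto)
  have "vec.independent (C - {w})" using BC(6) by (rule vec.independent_mono) auto
  then have dW': "vec.dim W' = d" unfolding W'_def using fC cC w(1) by (simp add: vec.dim_eq_card_independent)
  have sW': "vec.subspace W'" unfolding W'_def by (rule vec.subspace_span)
  have inv: "\<forall>x\<in>W'. T *v x \<in> W'"
  proof
    fix x assume that: "x \<in> W'"
    have "T *v x - \<mu> *s x \<in> W'" using that W'W RW' unfolding R_def by blast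
    then have "(T *v x - \<mu> *s x) + \<mu> *s x \<in> W'" by (intro vec.subspace_add[OF sW'] vec.subspace_scale[OF sW'] that)
    then show "T *v x \<in> W'" by simp
  qed
  have wW: "w \<in> W" using w BC by blast
  have Tw: "T *v w - \<mu> *s w \<in> W'" using RW' wW unfolding R_def by blast
  have spn: "vec.span (insert w W') = W"
  proof
    show "vec.span (insert w W') \<subseteq> W" by (rule vec.span_minimal) (use wW W'W W(1) in auto)
    have "C \<subseteq> insert w W'" unfolding W'_def using vec.span_superset[of "C - {w}"] by blast
    then show "W \<subseteq> vec.span (insert w W')" using BC(7) vec.span_mono[of C "insert w W'"] by blast
  qed
  show ?thesis by (rule that[OF sW' W'W dW' inv wW Tw spn])
qed

text \<open>\<open>g i\<close> is the eigenvalue whose generalized eigenspace contains \<open>b i\<close>.\<close>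

lemma block_triangular_basis:
  fixes T :: "complex ^ 'n ^ 'n"
  assumes "vec.subspace W" "\<forall>x\<in>W. T *v x \<in> W" "vec.dim W = d"
  shows "\<exists>(b :: nat \<Rightarrow> complex ^ 'n) g. vec.span (b ` {..<d}) = W \<and>
    (\<forall>i<d. T *v b i - g i *s b i \<in> vec.span (b ` {j. j < i \<and> g j = g i}))"
  using assms
proof (induction d arbitrary: W)
  case 0
  then have "W = {0}" using vec.dim_eq_0[of W] vec.subspace_0[of W] by auto
  then show ?case by auto
next
  case (Suc d)
  obtain \<mu> W' w where W': "vec.subspace W'" "W' \<subseteq> W" "vec.dim W' = d" "\<forall>x\<in>W'. T *v x \<in> W'"
    and w: "w \<in> W" "T *v w - \<mu> *s w \<in> W'" "vec.span (insert w W') = W"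
    by (rule invariant_hyperplane[OF Suc.prems])
  obtain b :: "nat \<Rightarrow> complex ^ 'n" and g where bg: "vec.span (b ` {..<d}) = W'"
    and tri: "\<And>i. i < d \<Longrightarrow> T *v b i - g i *s b i \<in> vec.span (b ` {j. j < i \<and> g j = g i})"
    using Suc.IH[OF W'(1,4,3)] by blast
  define A where "A = vec.span (b ` {j. j < d \<and> g j = \<mu>})"
  define B where "B = vec.span (b ` {j. j < d \<and> g j \<noteq> \<mu>})"
  define f where "f x = T *v x - \<mu> *s x" for x
  have sfB: "vec.subspace (f ` B)" unfolding f_def B_def by (intro subspace_image_shift vec.subspace_span)
  \<comment> \<open>On the span \<open>B\<close> of the basis vectors with other eigenvalues the map
    T - \<mu> is onto, by induction along the triangular basis. Hence \<open>w\<close> can be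
    corrected by some \<open>u\<close> in \<open>B\<close> so that only the component in
    \<open>A\<close> of (T - \<mu>) w survives.\<close>
  have inB: "b j \<in> f ` B" if "j < d" "g j \<noteq> \<mu>" for j
    using that
  proof (induction j rule: less_induct)
    case (less j)
    have "b ` {l. l < j \<and> g l = g j} \<subseteq> f ` B" using less by auto
    then have "vec.span (b ` {l. l < j \<and> g l = g j}) \<subseteq> f ` B" using sfB by (rule vec.span_minimal)
    then have 1: "T *v b j - g j *s b j \<in> f ` B" using tri[OF less(2)] by blast
    have "f (b j) \<in> f ` B" unfolding B_def using less.prems by (auto intro!: imageI vec.span_base)
    then have "f (b j) - (T *v b j - g j *s b j) \<in> f ` B" using 1 by (rule vec.subspace_diff[OF sfB])
    moreover have "f (b j) - (T *v b j - g j *s b j) = (g j - \<mu>) *s b j"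
      by (simp add: f_def vec.scale_left_diff_distrib)
    ultimately have "inverse (g j - \<mu>) *s ((g j - \<mu>) *s b j) \<in> f ` B"
      using vec.subspace_scale[OF sfB] by metis
    moreover have "inverse c *s (c *s x) = x" if "c \<noteq> 0" for c :: complex and x :: "complex ^ 'n"
      using that by simp
    ultimately show ?case using less.prems by (metis right_minus_eq)
  qed
  have "b ` {..<d} = b ` {j. j < d \<and> g j = \<mu>} \<union> b ` {j. j < d \<and> g j \<noteq> \<mu>}" by auto
  then have "W' = {x + y | x y. x \<in> A \<and> y \<in> B}"
    using bg unfolding A_def B_def by (simp add: vec.span_Un)
  then obtain ya yb where y: "f w = ya + yb" "ya \<in> A" "yb \<in> B" using w(2) unfolding f_def by auto
  have "B \<subseteq> f ` B" unfolding B_def by (rule vec.span_minimal) (use inB sfB in \<open>auto simp: B_def\<close>)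
  then obtain u where u: "u \<in> B" "yb = f u" using y by blast
  define b' where "b' i = (if i = d then w - u else b i)" for i
  define g' where "g' i = (if i = d then \<mu> else g i)" for i
  have "B \<subseteq> vec.span (b ` {..<d})" unfolding B_def by (rule vec.span_mono) auto
  then have uW': "u \<in> W'" using u bg by auto
  have "f (w - u) = ya" using y u by (simp add: f_def matrix_vector_mult_diff_distrib vec.scale_right_diff_distrib algebra_simps)
  have "b' ` {..<Suc d} = insert (w - u) (b ` {..<d})"
    unfolding lessThan_Suc by (auto simp: b'_def)
  then have "vec.span (b' ` {..<Suc d}) = vec.span (insert (w - u) W')"
    using vec.span_Un[of "{w - u}" "b ` {..<d}"] vec.span_Un[of "{w - u}" W'] bg
    by (simp add: vec.span_eq_iff[THEN iffD2, OF W'(1)])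
  also have "\<dots> = W"
  proof
    have "w - u \<in> W" using w(1) uW' W'(2) Suc.prems(1) by (auto intro: vec.subspace_diff)
    then show "vec.span (insert (w - u) W') \<subseteq> W"
      by (intro vec.span_minimal) (use W'(2) Suc.prems(1) in auto)
    have "w - u \<in> vec.span (insert (w - u) W')" "u \<in> vec.span (insert (w - u) W')"
      using uW' by (auto intro: vec.span_base)
    then have "(w - u) + u \<in> vec.span (insert (w - u) W')" by (rule vec.span_add)
    then have "insert w W' \<subseteq> vec.span (insert (w - u) W')" by (auto intro: vec.span_base)
    then have "vec.span (insert w W') \<subseteq> vec.span (insert (w - u) W')"
      by (intro vec.span_minimal vec.subspace_span)
    then show "W \<subseteq> vec.span (insert (w - u) W')" using w(3) by simp
  qed
  finally have "vec.span (b' ` {..<Suc d}) = W" .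
  moreover have "T *v b' i - g' i *s b' i \<in> vec.span (b' ` {j. j < i \<and> g' j = g' i})" if "i < Suc d" for i
  proof (cases "i = d")
    case True
    have "b' ` {j. j < i \<and> g' j = g' i} = b ` {j. j < d \<and> g j = \<mu>}"
      using True by (auto simp: b'_def g'_def)
    moreover have "T *v b' i - g' i *s b' i = ya"
      using True \<open>f (w - u) = ya\<close> by (simp add: b'_def g'_def f_def)
    ultimately show ?thesis using y(2) by (simp add: A_def)
  next
    case False
    then have "b' ` {j. j < i \<and> g' j = g' i} = b ` {j. j < i \<and> g j = g i}"
      using that by (auto simp: b'_def g'_def)
    then show ?thesis using tri[of i] False that by (simp add: b'_def g'_def)
  qed
  ultimately show ?case by blast
qed

text \<open>Zeros of the characteristic polynomial rather than values admitting eigenvectors, so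
  that continuity of the determinant governs limits.\<close>

definition eigenvals :: "complex ^ 'n ^ 'n \<Rightarrow> complex set" where
  "eigenvals T = {\<mu>. det (T - mat \<mu>) = 0}"

lemma mat_mult_commute: "A ** mat (c :: complex) = mat c ** A" for A :: "complex ^ 'n ^ 'n"
proof -
  have "(A ** mat c) $ i $ j = A $ i $ j * c" "(mat c ** A) $ i $ j = c * A $ i $ j" for i j
    by (simp_all add: matrix_matrix_mult_def mat_def if_distrib[of "\<lambda>x. _ * x"] if_distrib[of "\<lambda>x. x * _"] cong: if_cong)
  then show ?thesis by (simp add: vec_eq_iff mult.commute)
qed

lemma det_conj:
  fixes P Q T :: "complex ^ 'n ^ 'n"
  assumes "Q ** P = mat 1"
  shows "det (Q ** T ** P - mat \<mu>) = det (T - mat \<mu>)"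
proof -
  have "Q ** (T - mat \<mu>) ** P = Q ** T ** P - Q ** (mat \<mu> ** P)"
    by (simp add: matrix_mult_diff matrix_mul_assoc)
  also have "Q ** (mat \<mu> ** P) = mat \<mu>"
    using assms by (metis mat_mult_commute matrix_mul_assoc matrix_mul_rid)
  finally have "det (Q ** T ** P - mat \<mu>) = det Q * det (T - mat \<mu>) * det P"
    by (metis det_mul)
  also have "\<dots> = det (T - mat \<mu>) * det (Q ** P)" by (simp add: det_mul)
  finally show ?thesis using assms by simp
qed

lemma eigenvals_conj: "Q ** P = mat 1 \<Longrightarrow> eigenvals (Q ** T ** P) = eigenvals T"
  for P Q T :: "complex ^ 'n ^ 'n"
  unfolding eigenvals_def by (simp only: det_conj)

lemma eigenvalue_in_eigenvals:
  fixes T :: "complex ^ 'n ^ 'n"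
  assumes "T *v x = \<mu> *s x" "x \<noteq> 0" shows "\<mu> \<in> eigenvals T"
proof -
  have "(mat \<mu> :: complex ^ 'n ^ 'n) *v x = \<mu> *s x"
    by (simp add: vec_eq_iff matrix_vector_mult_def mat_def if_distrib[of "\<lambda>c. c * _"] cong: if_cong)
  then have "(T - mat \<mu>) *v x = 0" using assms(1) by (simp add: matrix_vector_mult_diff_rdistrib)
  then have "\<not> inj ((*v) (T - mat \<mu>))" using assms(2) by (metis injD matrix_vector_mult_0_right)
  then show ?thesis
    using det_nz_iff_inj_gen[OF matrix_vector_mul_linear_gen, of "T - mat \<mu>"]
    by (simp add: eigenvals_def matrix_of_matrix_vector_mul)
qed

text \<open>Two properties serve two ends. Triangularity lets the one-parameter group contract the
  matrix to its diagonal. The absence of entries between different eigenvalues allows vertices of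
  different colours to be reordered freely afterwards.\<close>

lemma block_triangular_form:
  fixes T :: "complex ^ 'n::{finite,wellorder} ^ 'n::{finite,wellorder}"
  obtains P Q :: "complex ^ 'n::{finite,wellorder} ^ 'n::{finite,wellorder}" where "P ** Q = mat 1" "Q ** P = mat 1"
    "\<And>i j. (Q ** T ** P) $ i $ j \<noteq> 0 \<Longrightarrow> i \<noteq> j \<Longrightarrow>
       i < j \<and> (Q ** T ** P) $ i $ i = (Q ** T ** P) $ j $ j"
proof -
  let ?n = "CARD('n)"
  obtain b :: "nat \<Rightarrow> (complex, 'n) vec" and g where b: "vec.span (b ` {..<?n}) = UNIV"
    and tri: "\<And>i. i < ?n \<Longrightarrow> T *v b i - g i *s b i \<in> vec.span (b ` {j. j < i \<and> g j = g i})"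
    using block_triangular_basis[of UNIV T ?n] by (auto simp: card_cart_basis)
  \<comment> \<open>\<open>idx\<close> is the rank of an index in the order of its type; it carries
    the basis numbered from 0 over to the columns.\<close>
  define idx where "idx i = card {k. k < i}" for i :: 'n
  have mono: "idx i < idx j" if "i < j" for i j
    unfolding idx_def by (rule psubset_card_mono) (use that in auto)
  then have inj: "inj idx" by (metis injI linorder_neqE order.strict_implies_not_eq)
  have lt: "idx i < ?n" for i unfolding idx_def by (rule psubset_card_mono) auto
  have "idx ` UNIV = {..<?n}"
    by (rule card_subset_eq) (use lt inj in \<open>auto simp: card_image\<close>)
  then have rng: "range (\<lambda>i. b (idx i)) = b ` {..<?n}" by (metis image_image)
  define P where "P = (\<chi> i j. b (idx j) $ i)"
  have col: "column j P = b (idx j)" for j by (simp add: P_def column_def vec_eq_iff)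
  have "columns P = range (\<lambda>i. b (idx i))" unfolding columns_def col by auto
  then have "vec.span (columns P) = UNIV" using b rng by simp
  then obtain Q where PQ: "P ** Q = mat 1"
    using matrix_right_invertible_span_columns[of P] by auto
  then have QP: "Q ** P = mat 1" by (simp add: matrix_left_right_inverse)
  have Qb: "(Q *v b (idx j)) $ k = (if k = j then 1 else 0)" for j k
  proof -
    have "(Q *v b (idx j)) $ k = (Q ** P) $ k $ j"
      by (simp add: matrix_vector_mult_def matrix_matrix_mult_def P_def)
    then show ?thesis unfolding QP by (simp add: mat_def)
  qed
  have M: "(Q ** T ** P) $ k $ i = (if k = i then g (idx i) else 0)
      + (Q *v (T *v b (idx i) - g (idx i) *s b (idx i))) $ k" for k i
  proof -
    have "(Q ** T ** P) $ k $ i = ((Q ** T) *v b (idx i)) $ k"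
      by (simp add: matrix_vector_mult_def matrix_matrix_mult_def[of "Q ** T"] P_def)
    also have "\<dots> = (Q *v (T *v b (idx i))) $ k" by (simp add: matrix_vector_mul_assoc)
    also have "\<dots> = (Q *v (T *v b (idx i) - g (idx i) *s b (idx i))) $ k + g (idx i) * (Q *v b (idx i)) $ k"
      by (simp add: matrix_vector_mult_diff_distrib vector_scalar_commute)
    finally show ?thesis by (simp add: Qb)
  qed
  have z: "(Q *v (T *v b (idx i) - g (idx i) *s b (idx i))) $ k = 0"
    if "\<not> (k < i \<and> g (idx k) = g (idx i))" for k i
  proof -
    let ?Z = "{x. (Q *v x) $ k = 0}"
    have sZ: "vec.subspace ?Z" by (rule vec.subspaceI) (auto simp: matrix_vector_right_distrib vector_scalar_commute)
    have "b ` {j. j < idx i \<and> g j = g (idx i)} \<subseteq> ?Z"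
    proof
      fix x assume "x \<in> b ` {j. j < idx i \<and> g j = g (idx i)}"
      then obtain j where j: "x = b j" "j < idx i" "g j = g (idx i)" by blast
      then have "j < ?n" using lt[of i] by simp
      then obtain l where l: "j = idx l" using \<open>idx ` UNIV = {..<?n}\<close> by (metis imageE lessThan_iff)
      then have "l < i" using j mono by (metis not_less_iff_gr_or_eq order.asym)
      then have "k \<noteq> l" using that j l by auto
      then show "x \<in> ?Z" using j l Qb by simp
    qed
    then have "vec.span (b ` {j. j < idx i \<and> g j = g (idx i)}) \<subseteq> ?Z" using sZ by (rule vec.span_minimal)
    then show ?thesis using tri[OF lt[of i]] by blast
  qed
  have Mii: "(Q ** T ** P) $ i $ i = g (idx i)" for i using M[of i i] z[of i i] by simp
  show ?thesis
  proof (rule that[OF PQ QP])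
    fix i j assume "(Q ** T ** P) $ i $ j \<noteq> 0" "i \<noteq> j"
    then have "i < j \<and> g (idx i) = g (idx j)" using M[of i j] z[of i j] by auto
    then show "i < j \<and> (Q ** T ** P) $ i $ i = (Q ** T ** P) $ j $ j" by (simp add: Mii)
  qed
qed

section \<open>The number of distinct eigenvalues under limits\<close>

lemma det_char:
  fixes T :: "complex ^ 'n::{finite,wellorder} ^ 'n::{finite,wellorder}"
  obtains d :: "'n \<Rightarrow> complex" where "\<And>\<mu>. det (T - mat \<mu>) = (\<Prod>i\<in>UNIV. d i - \<mu>)"
proof -
  obtain P Q :: "complex ^ 'n::{finite,wellorder} ^ 'n::{finite,wellorder}" where PQ: "P ** Q = mat 1" "Q ** P = mat 1"
    "\<And>i j. (Q ** T ** P) $ i $ j \<noteq> 0 \<Longrightarrow> i \<noteq> j \<Longrightarrow>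
       i < j \<and> (Q ** T ** P) $ i $ i = (Q ** T ** P) $ j $ j"
    by (rule block_triangular_form[of T]) (rule that)
  have "det (T - mat \<mu>) = (\<Prod>i\<in>UNIV. (Q ** T ** P) $ i $ i - \<mu>)" for \<mu>
  proof -
    have "det (Q ** T ** P - mat \<mu>) = (\<Prod>i\<in>UNIV. (Q ** T ** P - mat \<mu>) $ i $ i)"
    proof (rule det_upperdiagonal)
      fix i j :: 'n assume "j < i"
      then have "i \<noteq> j" "\<not> i < j" by auto
      then show "(Q ** T ** P - mat \<mu>) $ i $ j = 0" using PQ(3)[of i j] by (simp add: mat_def) blast
    qed
    then show ?thesis using det_conj[OF PQ(2)] by (simp add: mat_def)
  qed
  then show ?thesis by (rule that)
qed

lemma eigenvals_range:
  fixes T :: "complex ^ 'n::{finite,wellorder} ^ 'n::{finite,wellorder}"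
  obtains d :: "'n \<Rightarrow> complex" where "eigenvals T = range d"
proof -
  obtain d :: "'n \<Rightarrow> complex" where "\<And>\<mu>. det (T - mat \<mu>) = (\<Prod>i\<in>UNIV. d i - \<mu>)"
    by (rule det_char[of T]) blast
  then have "eigenvals T = range d" unfolding eigenvals_def by (auto simp: prod_zero_iff)
  then show ?thesis by (rule that)
qed

lemma finite_eigenvals: "finite (eigenvals T)"
  for T :: "complex ^ 'n::{finite,wellorder} ^ 'n::{finite,wellorder}"
  by (rule eigenvals_range[of T]) simp

lemma card_eigenvals_le: "card (eigenvals T) \<le> CARD('n)"
  for T :: "complex ^ 'n::{finite,wellorder} ^ 'n::{finite,wellorder}"
  by (rule eigenvals_range[of T]) (simp add: card_image_le)

text \<open>The modulus of the determinant is the product of the distances from \<mu> to the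
  eigenvalues counted with multiplicity, so one of them is below \<epsilon>.\<close>

lemma eigenval_near:
  fixes T :: "complex ^ 'n::{finite,wellorder} ^ 'n::{finite,wellorder}"
  assumes "\<epsilon> > 0" "cmod (det (T - mat \<mu>)) < \<epsilon> ^ CARD('n)"
  shows "\<exists>\<nu>\<in>eigenvals T. dist \<nu> \<mu> < \<epsilon>"
proof (rule ccontr)
  assume no: "\<not> ?thesis"
  obtain d :: "'n \<Rightarrow> complex" where d: "\<And>\<mu>. det (T - mat \<mu>) = (\<Prod>i\<in>UNIV. d i - \<mu>)" by (rule det_char[of T]) blast
  then have din: "d i \<in> eigenvals T" for i unfolding eigenvals_def by (auto simp: prod_zero_iff)
  have "\<not> dist (d i) \<mu> < \<epsilon>" for i using no din[of i] by blast
  then have "\<epsilon> \<le> cmod (d i - \<mu>)" for i by (simp add: dist_norm not_less)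
  then have "(\<Prod>i\<in>(UNIV :: 'n set). \<epsilon>) \<le> (\<Prod>i\<in>UNIV. cmod (d i - \<mu>))"
    using assms(1) by (intro prod_mono) auto
  then show False using assms(2) d by (simp add: prod_norm)
qed

text \<open>Lower semicontinuity: for large n every eigenvalue of the limit has an eigenvalue of
  \<open>F n\<close> within \<open>e\<close>. As \<open>e\<close> is at most half of the smallest
  gap, different eigenvalues of the limit receive different ones.\<close>

lemma card_eigenvals_limit:
  fixes F :: "nat \<Rightarrow> complex ^ 'n::{finite,wellorder} ^ 'n::{finite,wellorder}"
  assumes lim: "\<And>i j. (\<lambda>n. F n $ i $ j) \<longlonglongrightarrow> X $ i $ j"
    and k: "\<And>n. card (eigenvals (F n)) \<le> k"
  shows "card (eigenvals X) \<le> k"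
proof -
  have fA: "finite (eigenvals X)" by (rule finite_eigenvals)
  obtain e where e: "e > 0" "\<And>x y. x \<in> eigenvals X \<Longrightarrow> y \<in> eigenvals X \<Longrightarrow> x \<noteq> y \<Longrightarrow> dist x y \<ge> 2 * e"
  proof -
    \<comment> \<open>The additional 1 keeps the minimum defined when there is only one
      eigenvalue.\<close>
    let ?D = "insert 1 ((\<lambda>(x, y). dist x y / 2) ` {(x, y). x \<in> eigenvals X \<and> y \<in> eigenvals X \<and> x \<noteq> y})"
    have "finite {(x, y). x \<in> eigenvals X \<and> y \<in> eigenvals X \<and> x \<noteq> y}"
      by (rule finite_subset[of _ "eigenvals X \<times> eigenvals X"]) (use fA in auto)
    then have fD: "finite ?D" by auto
    have "Min ?D > 0" by (subst Min_gr_iff) (use fD in auto)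
    moreover have "dist x y \<ge> 2 * Min ?D" if "x \<in> eigenvals X" "y \<in> eigenvals X" "x \<noteq> y" for x y
    proof -
      have "dist x y / 2 \<in> ?D" using that by force
      then have "Min ?D \<le> dist x y / 2" using fD by (rule Min_le[rotated])
      then show ?thesis by simp
    qed
    ultimately show ?thesis using that by blast
  qed
  have "\<forall>\<^sub>F n in sequentially. \<exists>\<nu>\<in>eigenvals (F n). dist \<nu> \<mu> < e" if "\<mu> \<in> eigenvals X" for \<mu>
  proof -
    have "(\<lambda>n. det (F n - mat \<mu>)) \<longlonglongrightarrow> det (X - mat \<mu>)"
      unfolding det_def by (simp, intro tendsto_intros lim)
    then have "(\<lambda>n. det (F n - mat \<mu>)) \<longlonglongrightarrow> 0" using that by (simp add: eigenvals_def)
    then have "\<forall>\<^sub>F n in sequentially. dist (det (F n - mat \<mu>)) 0 < e ^ CARD('n)"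
      using e(1) by (intro tendstoD) auto
    then show ?thesis
      by (rule eventually_mono) (use eigenval_near e(1) in auto)
  qed
  then have "\<forall>\<^sub>F n in sequentially. \<forall>\<mu>\<in>eigenvals X. \<exists>\<nu>\<in>eigenvals (F n). dist \<nu> \<mu> < e"
    using fA by (simp add: eventually_ball_finite)
  then obtain n where "\<forall>\<mu>\<in>eigenvals X. \<exists>\<nu>\<in>eigenvals (F n). dist \<nu> \<mu> < e"
    using eventually_happens' sequentially_bot by blast
  then obtain v where v: "\<And>\<mu>. \<mu> \<in> eigenvals X \<Longrightarrow> v \<mu> \<in> eigenvals (F n) \<and> dist (v \<mu>) \<mu> < e" by metis
  have "inj_on v (eigenvals X)"
  proof
    fix x y assume xy: "x \<in> eigenvals X" "y \<in> eigenvals X" "v x = v y"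
    then have "dist x y < 2 * e" using v[of x] v[of y] dist_triangle2[of x y "v x"]
      by (simp add: dist_commute)
    then show "x = y" using e(2)[of x y] xy by force
  qed
  then have "card (eigenvals X) \<le> card (eigenvals (F n))"
    by (rule card_inj_on_le) (use v finite_eigenvals in auto)
  then show ?thesis using k[of n] by simp
qed

subsection \<open>Degeneration along a one-parameter group\<close>

definition unit_mat :: "'n \<Rightarrow> 'n \<Rightarrow> complex ^ 'n ^ 'n" where
  "unit_mat i j = (\<chi> p q. if p = i \<and> q = j then 1 else 0)"

definition diag_mat :: "('n \<Rightarrow> complex) \<Rightarrow> complex ^ 'n ^ 'n" where
  "diag_mat d = (\<chi> p q. if p = q then d p else 0)"

lemma mat_scale_nth [simp]: "mat_scale c M $ i $ j = c * M $ i $ j"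
  by (simp add: mat_scale_def)

lemma unit_mat_nth: "unit_mat i j $ p $ q = (if p = i \<and> q = j then 1 else 0)" by (simp add: unit_mat_def)
lemma diag_mat_nth: "diag_mat d $ p $ q = (if p = q then d p else 0)" by (simp add: diag_mat_def)

lemma comm_unit_mat: "comm (unit_mat i j) (unit_mat k l) = (if j = k then unit_mat i l else 0) - (if l = i then unit_mat k j else 0)"
proof -
  have "unit_mat i j ** unit_mat k l = (if j = k then unit_mat i l else 0)" for i j k l :: 'a
  proof -
    have "(unit_mat i j ** unit_mat k l) $ p $ q = (if j = k then unit_mat i l else 0) $ p $ q" for p q
    proof -
      have "(unit_mat i j ** unit_mat k l) $ p $ q = (\<Sum>r\<in>UNIV. if r = j then (if p = i then unit_mat k l $ r $ q else 0) else 0)"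
        unfolding matrix_matrix_mult_def vec_lambda_beta by (rule sum.cong) (simp_all add: unit_mat_nth)
      then show ?thesis by (simp add: unit_mat_nth)
    qed
    then show ?thesis by (simp add: vec_eq_iff)
  qed
  then show ?thesis by (auto simp: comm_def)
qed

lemma diag_mat_mult: "(diag_mat d ** X) $ i $ j = d i * X $ i $ j"
  by (simp add: matrix_matrix_mult_def diag_mat_nth if_distrib[of "\<lambda>c. c * _"] cong: if_cong)

lemma mult_diag_mat: "(X ** diag_mat d) $ i $ j = X $ i $ j * d j"
  by (simp add: matrix_matrix_mult_def diag_mat_nth if_distrib[of "\<lambda>c. _ * c"] cong: if_cong)

lemma comm_zero [simp]: "comm 0 A = 0" "comm A 0 = 0"
  by (simp_all add: vec_eq_iff comm_nth)

lemma comm_diag_mat: "comm (diag_mat d) X $ p $ q = (d p - d q) * X $ p $ q"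
  by (simp add: comm_def diag_mat_mult mult_diag_mat algebra_simps)

lemma comm_diag_unit_mat: "comm (diag_mat d) (unit_mat i j) = mat_scale (d i - d j) (unit_mat i j)"
  by (simp add: vec_eq_iff comm_diag_mat unit_mat_nth)

lemma comm_add: "comm (A + B) C = comm A C + comm B C" "comm C (A + B) = comm C A + comm C B"
  by (simp_all add: vec_eq_iff comm_nth sum.distrib algebra_simps)

lemma comm_scale: "comm (mat_scale c A) B = mat_scale c (comm A B)" "comm A (mat_scale c B) = mat_scale c (comm A B)"
  by (simp_all add: vec_eq_iff comm_nth sum_distrib_left algebra_simps)

lemma eq_zero_at_0_by_continuity:
  fixes f :: "complex \<Rightarrow> complex"
  assumes "isCont f 0" "\<And>s. s \<noteq> 0 \<Longrightarrow> f s = 0"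
  shows "f 0 = 0"
proof -
  have "(f \<longlongrightarrow> f 0) (at 0)" using assms(1) by (simp add: isCont_def)
  moreover have "(f \<longlongrightarrow> 0) (at 0)"
    by (rule tendsto_eventually) (use assms in \<open>auto simp: eventually_at_filter\<close>)
  ultimately show ?thesis by (intro tendsto_unique[of "at (0::complex)"]) auto
qed

lemma minor3_eq_0_limit:
  assumes "\<And>s. s \<noteq> 0 \<Longrightarrow> minor3 (M + mat_scale s K) i1 i2 i3 j1 j2 j3 = 0"
  shows "minor3 M i1 i2 i3 j1 j2 j3 = 0"
proof -
  let ?f = "\<lambda>s. minor3 (M + mat_scale s K) i1 i2 i3 j1 j2 j3"
  have "isCont ?f 0" unfolding minor3_def by (simp add: continuous_intros)
  then have "?f 0 = 0" by (rule eq_zero_at_0_by_continuity) (rule assms)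
  then show ?thesis by (simp add: minor3_def)
qed

text \<open>The leading positions of Gaussian elimination, where entries with larger \<kappa>
  lead.\<close>

definition pivot :: "(complex ^ 'n ^ 'n) set \<Rightarrow> ('n \<Rightarrow> 'n \<Rightarrow> real) \<Rightarrow> 'n \<Rightarrow> 'n \<Rightarrow> bool" where
  "pivot V \<kappa> i j \<longleftrightarrow> (\<exists>X\<in>V. X$i$j = 1 \<and> (\<forall>p q. \<kappa> p q > \<kappa> i j \<longrightarrow> X$p$q = 0))"

lemma leading_position:
  fixes \<kappa> :: "'n::finite \<Rightarrow> 'n \<Rightarrow> real"
  assumes "Y \<noteq> 0" and inj: "\<And>i j p q. \<kappa> i j = \<kappa> p q \<Longrightarrow> i = p \<and> j = q"
  obtains i j where "Y$i$j \<noteq> 0" "\<And>p q. \<kappa> p q > \<kappa> i j \<Longrightarrow> Y$p$q = 0"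
proof -
  let ?N = "{(i, j). Y$i$j \<noteq> 0}"
  let ?k = "\<lambda>(i, j). \<kappa> i j"
  have ne: "?N \<noteq> {}" using assms(1) by (auto simp: vec_eq_iff)
  have fin: "finite ?N" by simp
  have "Max (?k ` ?N) \<in> ?k ` ?N" using ne fin by (intro Max_in) auto
  then obtain i j where ij: "Y$i$j \<noteq> 0" "Max (?k ` ?N) = \<kappa> i j" by auto
  have "Y$p$q = 0" if "\<kappa> p q > \<kappa> i j" for p q
  proof (rule ccontr)
    assume "Y$p$q \<noteq> 0"
    then have "\<kappa> p q \<in> ?k ` ?N" by force
    then have "\<kappa> p q \<le> Max (?k ` ?N)" using fin by (intro Max_ge) auto
    then show False using ij that by simp
  qed
  then show ?thesis by (rule that[OF ij(1)])
qed

text \<open>Elimination: subtracting a multiple of the chosen pivot matrix clears the leading entry,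
  and the set of positions at or below the leading one shrinks. So the pivot matrices span
  \<open>V\<close>.\<close>

lemma dim_le_card_pivots:
  fixes \<kappa> :: "'n::finite \<Rightarrow> 'n \<Rightarrow> real"
  assumes sub: "cmat.subspace V" and inj: "\<And>i j p q. \<kappa> i j = \<kappa> p q \<Longrightarrow> i = p \<and> j = q"
  shows "cmat.dim V \<le> card {(i, j). pivot V \<kappa> i j}"
proof -
  let ?P = "{(i, j). pivot V \<kappa> i j}"
  have "\<forall>z\<in>?P. \<exists>X\<in>V. X $ fst z $ snd z = 1 \<and> (\<forall>p q. \<kappa> p q > \<kappa> (fst z) (snd z) \<longrightarrow> X$p$q = 0)"
    by (auto simp: pivot_def)
  then obtain x where x: "\<And>z. z \<in> ?P \<Longrightarrow> x z \<in> V \<and> x z $ fst z $ snd z = 1 \<and>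
      (\<forall>p q. \<kappa> p q > \<kappa> (fst z) (snd z) \<longrightarrow> x z $p$q = 0)"
    by metis
  have "Y \<in> cmat.span (x ` ?P)" if "Y \<in> V" for Y
    using that
  proof (induction "card {(p, q). \<exists>i j. Y$i$j \<noteq> 0 \<and> \<kappa> p q \<le> \<kappa> i j}" arbitrary: Y rule: less_induct)
    case less
    show ?case
    proof (cases "Y = 0")
      case True then show ?thesis by (simp add: cmat.span_zero)
    next
      case False
      obtain i j where ij: "Y$i$j \<noteq> 0" "\<And>p q. \<kappa> p q > \<kappa> i j \<Longrightarrow> Y$p$q = 0"
        by (rule leading_position[OF False inj]) auto
      have "mat_scale (1 / Y$i$j) Y \<in> V" using less.prems sub by (rule cmat.subspace_scale[rotated])
      then have P: "(i, j) \<in> ?P" unfolding pivot_def using ij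
        by (auto intro!: bexI[of _ "mat_scale (1 / Y$i$j) Y"])
      define Z where "Z = Y - mat_scale (Y$i$j) (x (i, j))"
      have ZV: "Z \<in> V" unfolding Z_def using less.prems sub x[OF P]
        by (intro cmat.subspace_diff cmat.subspace_scale) auto
      have Z0: "Z$p$q = 0" if "\<kappa> p q \<ge> \<kappa> i j" for p q
      proof (cases "\<kappa> p q = \<kappa> i j")
        case True then show ?thesis using inj[OF True] x[OF P] by (auto simp: Z_def)
      next
        case False then show ?thesis using that ij(2)[of p q] x[OF P] by (simp add: Z_def)
      qed
      have "{(p, q). \<exists>i j. Z$i$j \<noteq> 0 \<and> \<kappa> p q \<le> \<kappa> i j} \<subset> {(p, q). \<exists>i j. Y$i$j \<noteq> 0 \<and> \<kappa> p q \<le> \<kappa> i j}"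
      proof
        show "{(p, q). \<exists>i j. Z$i$j \<noteq> 0 \<and> \<kappa> p q \<le> \<kappa> i j} \<subseteq> {(p, q). \<exists>i j. Y$i$j \<noteq> 0 \<and> \<kappa> p q \<le> \<kappa> i j}"
        proof safe
          fix p q a b assume "Z$a$b \<noteq> 0" "\<kappa> p q \<le> \<kappa> a b"
          then have "\<kappa> a b < \<kappa> i j" using Z0[of a b] by force
          then show "\<exists>i j. Y$i$j \<noteq> 0 \<and> \<kappa> p q \<le> \<kappa> i j" using ij(1) \<open>\<kappa> p q \<le> \<kappa> a b\<close>
            by (intro exI[of _ i] exI[of _ j]) simp
        qed
        have "(i, j) \<in> {(p, q). \<exists>i j. Y$i$j \<noteq> 0 \<and> \<kappa> p q \<le> \<kappa> i j}" using ij(1) by auto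
        moreover have "(i, j) \<notin> {(p, q). \<exists>i j. Z$i$j \<noteq> 0 \<and> \<kappa> p q \<le> \<kappa> i j}"
          using Z0 by auto
        ultimately show "{(p, q). \<exists>i j. Z$i$j \<noteq> 0 \<and> \<kappa> p q \<le> \<kappa> i j} \<noteq> {(p, q). \<exists>i j. Y$i$j \<noteq> 0 \<and> \<kappa> p q \<le> \<kappa> i j}"
          by blast
      qed
      then have "card {(p, q). \<exists>i j. Z$i$j \<noteq> 0 \<and> \<kappa> p q \<le> \<kappa> i j} < card {(p, q). \<exists>i j. Y$i$j \<noteq> 0 \<and> \<kappa> p q \<le> \<kappa> i j}"
        by (intro psubset_card_mono) auto
      then have "Z \<in> cmat.span (x ` ?P)" using less.hyps ZV by blast
      moreover have "x (i, j) \<in> cmat.span (x ` ?P)" using P by (intro cmat.span_base) auto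
      ultimately have "Z + mat_scale (Y$i$j) (x (i, j)) \<in> cmat.span (x ` ?P)"
        by (intro cmat.span_add cmat.span_scale)
      then show ?thesis by (simp add: Z_def)
    qed
  qed
  then have "cmat.dim V \<le> card (x ` ?P)" by (intro cmat.dim_le_card) auto
  also have "\<dots> \<le> card ?P" by (rule card_image_le) simp
  finally show ?thesis .
qed

text \<open>Positions are ordered by the growth rate under conjugation by the one-parameter group. The diagonal
  values, in \<open>(0, 1)\<close>, only serve to break ties.\<close>

definition weight_order :: "('n \<Rightarrow> nat) \<Rightarrow> 'n \<Rightarrow> 'n \<Rightarrow> real" where
  "weight_order w i j = (if i = j then 1 / (2 + real (w i)) else real (w i) - real (w j))"

text \<open>Off the diagonal the values are nonzero integers, pairwise distinct by the Sidon
  property of the weights; diagonal values lie strictly between 0 and 1.\<close>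

lemma weight_order_inj:
  assumes "\<And>i j p q. w i + w q = w p + w j \<Longrightarrow> i \<noteq> j \<Longrightarrow> p \<noteq> q \<Longrightarrow> i = p \<and> j = q"
    and "weight_order w i j = weight_order w p q"
  shows "i = p \<and> j = q"
proof -
  have inj: "w a = w b \<Longrightarrow> a = b" for a b
    using assms(1)[where i = a and j = b and p = b and q = a] by (cases "a = b") auto
  have ge: "real (w a) - real (w b) \<ge> 1 \<or> real (w a) - real (w b) \<le> -1" if "a \<noteq> b" for a b
    using inj[of a b] that by linarith
  have diag_mat: "0 < weight_order w a a" "weight_order w a a < 1" for a by (simp_all add: weight_order_def)
  have of: "weight_order w a b = real (w a) - real (w b)" if "a \<noteq> b" for a b using that by (simp add: weight_order_def)
  consider "i = j" "p = q" | "i = j" "p \<noteq> q" | "i \<noteq> j" "p = q" | "i \<noteq> j" "p \<noteq> q" by blast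
  then show ?thesis
  proof cases
    case 1
    then have "w i = w p" using assms(2) by (simp add: weight_order_def)
    then show ?thesis using inj 1 by blast
  next
    case 2
    then have False using assms(2) diag_mat[of i] ge[of p q] of[of p q] by force
    then show ?thesis by blast
  next
    case 3
    then have False using assms(2) diag_mat[of p] ge[of i j] of[of i j] by force
    then show ?thesis by blast
  next
    case 4
    then have "real (w i) - real (w j) = real (w p) - real (w q)" using assms(2) of by simp
    then have "w i + w q = w p + w j" by linarith
    then show ?thesis using assms(1) 4 by blast
  qed
qed

text \<open>\<open>h\<close> is the diagonal of a member of \<open>V\<close> with the largest number
  of eigenvalues, and \<open>w\<close> increases along its other nonzero entries, so that the
  one-parameter group contracts this member to its diagonal. By \<open>sidon\<close> all
  off-diagonal positions have different growth rates, which makes the limit of an off-diagonal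
  leading part a single matrix unit.\<close>

locale degeneration =
  fixes V :: "((complex, 'n::{finite,wellorder}) vec, 'n) vec set" and h :: "'n \<Rightarrow> complex" and w :: "'n \<Rightarrow> nat"
  assumes card6: "CARD('n) = 6"
    and sub: "cmat.subspace V"
    and rank2: "\<And>S T. S \<in> V \<Longrightarrow> T \<in> V \<Longrightarrow> rank_le2 (comm S T)"
    and dim: "cmat.dim V \<ge> 17"
    and eigenvals_bound: "\<And>T. T \<in> V \<Longrightarrow> card (eigenvals T) \<le> card (range h)"
    and S: "\<exists>S\<in>V. (\<forall>i. S$i$i = h i) \<and> (\<forall>i j. i \<noteq> j \<longrightarrow> S$i$j \<noteq> 0 \<longrightarrow> h i = h j \<and> w i < w j)"
    and sidon: "\<And>i j p q. w i + w q = w p + w j \<Longrightarrow> i \<noteq> j \<Longrightarrow> p \<noteq> q \<Longrightarrow> i = p \<and> j = q"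
begin

lemma inj_w: "w i = w j \<longleftrightarrow> i = j"
  using sidon[where i = i and j = j and p = j and q = i] by (cases "i = j") auto

abbreviation "\<omega> i j \<equiv> real (w i) - real (w j)"

lemma sidon': "\<omega> i j = \<omega> p q \<Longrightarrow> i \<noteq> j \<Longrightarrow> i = p \<and> j = q"
proof -
  assume a: "\<omega> i j = \<omega> p q" "i \<noteq> j"
  then have "w i + w q = w p + w j" by linarith
  moreover have "p \<noteq> q" using a inj_w by auto
  ultimately show ?thesis using sidon a(2) by blast
qed

lemma weight_order_diag: "0 < weight_order w i i" "weight_order w i i < 1"
  by (simp_all add: weight_order_def)

lemma omega_ge1: "\<omega> i j \<ge> 1 \<or> \<omega> i j \<le> -1" if "i \<noteq> j"
  using inj_w[of i j] that by linarith

lemma weight_order_off: "i \<noteq> j \<Longrightarrow> weight_order w i j = \<omega> i j" by (simp add: weight_order_def)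

definition torus :: "real \<Rightarrow> ((complex, 'n) vec, 'n) vec" where
  "torus t = diag_mat (\<lambda>i. of_real (exp (t * w i)))"

lemma torus_inverse: "torus t ** torus (-t) = mat 1"
proof -
  have "(torus t ** torus (-t)) $ i $ j = mat 1 $ i $ j" for i j
    by (simp add: torus_def diag_mat_mult diag_mat_nth mat_def flip: of_real_mult exp_add)
  then show ?thesis by (simp add: vec_eq_iff)
qed

lemma torus_conj_nth: "(torus t ** X ** torus (-t)) $ i $ j = of_real (exp (t * \<omega> i j)) * X $ i $ j"
proof -
  have "(torus t ** X ** torus (-t)) $ i $ j = of_real (exp (t * w i) * exp (- t * w j)) * X $ i $ j"
    by (simp add: torus_def diag_mat_mult mult_diag_mat)
  also have "exp (t * w i) * exp (- t * w j) = exp (t * \<omega> i j)"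
    by (simp add: right_diff_distrib flip: exp_add)
  finally show ?thesis .
qed

text \<open>The matrix \<open>f n\<close> may change with n, so a member of \<open>V\<close> can be
  rescaled at each stage until its leading part survives in the limit.\<close>

definition limits :: "((complex, 'n) vec, 'n) vec set" where
  "limits = {X. \<exists>f. (\<forall>n. f n \<in> V) \<and>
     (\<forall>i j. (\<lambda>n. (torus (real n) ** f n ** torus (- real n)) $ i $ j) \<longlonglongrightarrow> X $ i $ j)}"

lemma limits_add: "X \<in> limits \<Longrightarrow> Y \<in> limits \<Longrightarrow> X + Y \<in> limits"
proof -
  assume "X \<in> limits" "Y \<in> limits"
  then obtain f g where fg: "\<And>n. f n \<in> V" "\<And>n. g n \<in> V"
    "\<And>i j. (\<lambda>n. (torus (real n) ** f n ** torus (- real n)) $ i $ j) \<longlonglongrightarrow> X $ i $ j"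
    "\<And>i j. (\<lambda>n. (torus (real n) ** g n ** torus (- real n)) $ i $ j) \<longlonglongrightarrow> Y $ i $ j"
    unfolding limits_def by blast
  have "(\<lambda>n. (torus (real n) ** (f n + g n) ** torus (- real n)) $ i $ j) \<longlonglongrightarrow> (X + Y) $ i $ j" for i j
    using tendsto_add[OF fg(3)[of i j] fg(4)[of i j]] by (simp add: torus_conj_nth distrib_left)
  moreover have "f n + g n \<in> V" for n using fg sub by (intro cmat.subspace_add)
  ultimately show ?thesis unfolding limits_def mem_Collect_eq
    by (intro exI[of _ "\<lambda>n. f n + g n"] conjI allI)
qed

lemma limits_scale: "X \<in> limits \<Longrightarrow> mat_scale c X \<in> limits"
proof -
  assume "X \<in> limits"
  then obtain f where f: "\<And>n. f n \<in> V"
    "\<And>i j. (\<lambda>n. (torus (real n) ** f n ** torus (- real n)) $ i $ j) \<longlonglongrightarrow> X $ i $ j"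
    unfolding limits_def by blast
  have "(\<lambda>n. (torus (real n) ** (mat_scale c (f n)) ** torus (- real n)) $ i $ j) \<longlonglongrightarrow> (mat_scale c X) $ i $ j" for i j
    using tendsto_mult[OF tendsto_const f(2)[of i j], of c] by (simp add: torus_conj_nth mult_ac)
  moreover have "mat_scale c (f n) \<in> V" for n using f sub by (intro cmat.subspace_scale)
  ultimately show ?thesis unfolding limits_def mem_Collect_eq
    by (intro exI[of _ "\<lambda>n. mat_scale c (f n)"] conjI allI)
qed

lemma limits_minor3:
  assumes "X \<in> limits" "Y \<in> limits" shows "minor3 (comm X Y) i1 i2 i3 j1 j2 j3 = 0"
proof -
  obtain f g where fg: "\<And>n. f n \<in> V" "\<And>n. g n \<in> V"
    "\<And>i j. (\<lambda>n. (torus (real n) ** f n ** torus (- real n)) $ i $ j) \<longlonglongrightarrow> X $ i $ j"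
    "\<And>i j. (\<lambda>n. (torus (real n) ** g n ** torus (- real n)) $ i $ j) \<longlonglongrightarrow> Y $ i $ j"
    using assms unfolding limits_def by blast
  let ?c = "\<lambda>n. comm (torus (real n) ** f n ** torus (- real n)) (torus (real n) ** g n ** torus (- real n))"
  have "torus (- t) ** torus t = mat 1" for t using torus_inverse[of "-t"] by simp
  then have "?c n = torus (real n) ** comm (f n) (g n) ** torus (- real n)" for n by (intro comm_conj)
  then have "rank_le2 (?c n)" for n using rank2 fg rank_le2_mult by metis
  then have "minor3 (?c n) i1 i2 i3 j1 j2 j3 = 0" for n by (rule rank_le2_minor3)
  moreover have lim: "(\<lambda>n. ?c n $ i $ j) \<longlonglongrightarrow> comm X Y $ i $ j" for i j
    unfolding comm_nth by (intro tendsto_intros fg)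
  have "(\<lambda>n. minor3 (?c n) i1 i2 i3 j1 j2 j3) \<longlonglongrightarrow> minor3 (comm X Y) i1 i2 i3 j1 j2 j3"
    unfolding minor3_def by (intro tendsto_add tendsto_diff tendsto_mult lim)
  ultimately show ?thesis by (simp add: LIMSEQ_const_iff)
qed

lemma limits_spec:
  assumes "X \<in> limits" shows "card (eigenvals X) \<le> card (range h)"
proof -
  obtain f where f: "\<And>n. f n \<in> V"
    "\<And>i j. (\<lambda>n. (torus (real n) ** f n ** torus (- real n)) $ i $ j) \<longlonglongrightarrow> X $ i $ j"
    using assms unfolding limits_def by blast
  show ?thesis
  proof (rule card_eigenvals_limit)
    show "(\<lambda>n. (torus (real n) ** f n ** torus (- real n)) $ i $ j) \<longlonglongrightarrow> X $ i $ j" for i j by (rule f)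
    show "card (eigenvals (torus (real n) ** f n ** torus (- real n))) \<le> card (range h)" for n
      using eigenvals_bound[OF f(1)] eigenvals_conj[OF torus_inverse] by simp
  qed
qed

text \<open>After rescaling by exp(-n r) the entries of growth rate below \<open>r\<close> tend to
  0, those of rate \<open>r\<close> are constant, and those of larger rate vanish by
  assumption.\<close>

lemma limits_top:
  assumes X: "X \<in> V" and z: "\<And>p q. \<omega> p q > r \<Longrightarrow> X $ p $ q = 0"
  shows "(\<chi> p q. if \<omega> p q = r then X $ p $ q else 0) \<in> limits"
proof -
  define f where "f n = mat_scale (of_real (exp (- (real n * r)))) X" for n
  have fV: "f n \<in> V" for n unfolding f_def using X sub by (intro cmat.subspace_scale)
  have lim: "(\<lambda>n. (torus (real n) ** f n ** torus (- real n)) $ p $ q) \<longlonglongrightarrow> (if \<omega> p q = r then X $ p $ q else 0)" for p q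
  proof -
    have e: "(torus (real n) ** f n ** torus (- real n)) $ p $ q = of_real (exp (real n * (\<omega> p q - r))) * X $ p $ q" for n
    proof -
      have "(torus (real n) ** f n ** torus (- real n)) $ p $ q =
        of_real (exp (real n * \<omega> p q) * exp (- (real n * r))) * X $ p $ q"
        by (simp add: torus_conj_nth f_def)
      also have "exp (real n * \<omega> p q) * exp (- (real n * r)) = exp (real n * (\<omega> p q - r))"
        by (simp add: algebra_simps flip: exp_add)
      finally show ?thesis .
    qed
    consider "\<omega> p q > r" | "\<omega> p q = r" | "\<omega> p q < r" by linarith
    then show ?thesis
    proof cases
      case 1 then show ?thesis using z unfolding e by simp
    next
      case 2 then show ?thesis unfolding e by simp
    next
      case 3
      have "(\<lambda>n. exp (real n * (\<omega> p q - r))) = (\<lambda>n. exp (\<omega> p q - r) ^ n)"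
        by (simp add: exp_of_nat_mult)
      moreover have "(\<lambda>n. exp (\<omega> p q - r) ^ n) \<longlonglongrightarrow> 0" using 3 by (intro LIMSEQ_power_zero) simp
      ultimately have "(\<lambda>n. complex_of_real (exp (real n * (\<omega> p q - r))) * X $ p $ q) \<longlonglongrightarrow> of_real 0 * X $ p $ q"
        by (intro tendsto_intros) simp
      then show ?thesis using 3 unfolding e by simp
    qed
  qed
  show ?thesis unfolding limits_def mem_Collect_eq vec_lambda_beta
    by (intro exI[of _ f] conjI allI fV lim)
qed

lemma diag_mat_h: "diag_mat h \<in> limits"
proof -
  obtain S where S: "S \<in> V" "\<And>i. S$i$i = h i" "\<And>i j. i \<noteq> j \<Longrightarrow> S$i$j \<noteq> 0 \<Longrightarrow> w i < w j"
    using local.S by blast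
  have "(\<chi> p q. if \<omega> p q = 0 then S $ p $ q else 0) \<in> limits"
  proof (rule limits_top[OF S(1)])
    fix p q assume "\<omega> p q > 0"
    then show "S $ p $ q = 0" using S(3)[of p q] by fastforce
  qed
  also have "(\<chi> p q. if \<omega> p q = 0 then S $ p $ q else 0) = diag_mat h"
    using S(2) inj_w by (auto simp: vec_eq_iff diag_mat_nth)
  finally show ?thesis .
qed

definition G :: "'n \<Rightarrow> 'n \<Rightarrow> bool" where "G i j \<longleftrightarrow> i \<noteq> j \<and> pivot V (weight_order w) i j"

lemma unit_mat_in_limits: "G i j \<Longrightarrow> unit_mat i j \<in> limits"
proof -
  assume "G i j"
  then obtain X where X: "i \<noteq> j" "X \<in> V" "X$i$j = 1" "\<And>p q. weight_order w p q > weight_order w i j \<Longrightarrow> X$p$q = 0"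
    unfolding G_def pivot_def by blast
  have "(\<chi> p q. if \<omega> p q = \<omega> i j then X $ p $ q else 0) \<in> limits"
  proof (rule limits_top[OF X(2)])
    fix p q assume a: "\<omega> p q > \<omega> i j"
    have "weight_order w p q > weight_order w i j"
    proof (cases "p = q")
      case True
      then have "\<omega> i j < 0" using a by simp
      then show ?thesis using True weight_order_off[OF X(1)] weight_order_diag[of p] by simp
    next
      case False
      then show ?thesis using a weight_order_off[OF X(1)] weight_order_off[OF False] by simp
    qed
    then show "X$p$q = 0" by (rule X(4))
  qed
  also have "(\<chi> p q. if \<omega> p q = \<omega> i j then X $ p $ q else 0) = unit_mat i j"
  proof -
    have "\<omega> p q = \<omega> i j \<longleftrightarrow> p = i \<and> q = j" for p q using sidon'[of i j p q] X(1) by auto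
    then show ?thesis using X(3) by (auto simp: vec_eq_iff unit_mat_nth)
  qed
  finally show ?thesis .
qed

text \<open>All diagonal positions have growth rate 0, so the limit keeps the whole diagonal; the
  tie-breaking order makes its leading entry 1 and the higher ones 0.\<close>

lemma diag_in_limits:
  assumes "pivot V (weight_order w) i i"
  obtains d where "diag_mat d \<in> limits" "d i = 1" "\<And>j. weight_order w j j > weight_order w i i \<Longrightarrow> d j = 0"
proof -
  obtain X where X: "X \<in> V" "X$i$i = 1" "\<And>p q. weight_order w p q > weight_order w i i \<Longrightarrow> X$p$q = 0"
    using assms unfolding pivot_def by blast
  have "(\<chi> p q. if \<omega> p q = 0 then X $ p $ q else 0) \<in> limits"
  proof (rule limits_top[OF X(1)])
    fix p q assume a: "\<omega> p q > 0"
    then have "p \<noteq> q" by auto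
    then have "weight_order w p q > weight_order w i i" using a omega_ge1[of p q] weight_order_diag[of i] weight_order_off[of p q] by linarith
    then show "X$p$q = 0" by (rule X(3))
  qed
  also have "(\<chi> p q. if \<omega> p q = 0 then X $ p $ q else 0) = diag_mat (\<lambda>p. X$p$p)"
    using inj_w by (auto simp: vec_eq_iff diag_mat_nth)
  finally show ?thesis using that[of "\<lambda>p. X$p$p"] X by auto
qed

lemma infinite_avoid: "finite (A :: complex set) \<Longrightarrow> \<exists>e. e \<noteq> 0 \<and> e \<notin> A"
proof -
  assume "finite A"
  then have "\<exists>e. e \<notin> insert 0 A"
    by (intro ex_new_if_finite) (simp_all add: infinite_UNIV_char_0)
  then show ?thesis by auto
qed

lemma eigenvals_diag_mat: "range d \<subseteq> eigenvals (diag_mat d)" for d :: "'n \<Rightarrow> complex"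
proof safe
  fix i :: 'n
  have "diag_mat d *v axis i 1 = d i *s axis i 1"
    by (simp add: vec_eq_iff matrix_vector_mult_def diag_mat_nth axis_def if_distrib[of "\<lambda>c. c * _"] cong: if_cong)
  moreover have "axis i (1 :: complex) \<noteq> 0" by simp
  ultimately show "d i \<in> eigenvals (diag_mat d)" by (rule eigenvalue_in_eigenvals)
qed

text \<open>If \<open>d\<close> separated two vertices of one colour, h + e d for generic e would
  keep all colours apart and split one of them, giving more eigenvalues than the bound
  allows.\<close>

lemma diag_block_scalar:
  assumes "diag_mat d \<in> limits" "h i = h j" shows "d i = d j"
proof (rule ccontr)
  assume ne: "d i \<noteq> d j"
  \<comment> \<open>These finitely many values contain every e for which h + e d coincides at two
    vertices where \<open>d\<close> differs.\<close>
  let ?A = "(\<lambda>(p, q). (h p - h q) / (d q - d p)) ` UNIV"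
  obtain e where e: "e \<noteq> 0" "e \<notin> ?A" using infinite_avoid[of ?A] by auto
  have sep: "h p = h q \<and> d p = d q" if "h p + e * d p = h q + e * d q" for p q
  proof (cases "d p = d q")
    case False
    then have "e = (h p - h q) / (d q - d p)" using that by (simp add: field_simps)
    then have "e \<in> ?A" by (intro image_eqI[of _ _ "(p, q)"]) auto
    then show ?thesis using e(2) by simp
  qed (use that in auto)
  have "diag_mat h + mat_scale e (diag_mat d) \<in> limits" by (intro limits_add limits_scale diag_mat_h assms)
  also have "diag_mat h + mat_scale e (diag_mat d) = diag_mat (\<lambda>p. h p + e * d p)" by (simp add: vec_eq_iff diag_mat_nth)
  finally have "card (eigenvals (diag_mat (\<lambda>p. h p + e * d p))) \<le> card (range h)" by (rule limits_spec)
  moreover have "card (range (\<lambda>p. h p + e * d p)) \<le> card (eigenvals (diag_mat (\<lambda>p. h p + e * d p)))"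
    by (rule card_mono[OF finite_eigenvals eigenvals_diag_mat])
  moreover have "card (range h) < card (range (\<lambda>p. h p + e * d p))"
  proof -
    define g where "g x = h (SOME p. h p + e * d p = x)" for x
    have g: "g (h p + e * d p) = h p" for p
    proof -
      have "h (SOME q. h q + e * d q = h p + e * d p) + e * d (SOME q. h q + e * d q = h p + e * d p) = h p + e * d p"
        by (rule someI[of "\<lambda>q. h q + e * d q = h p + e * d p" p]) simp
      then show ?thesis
        unfolding g_def using sep[of "SOME q. h q + e * d q = h p + e * d p" p]
        by (metis (mono_tags, lifting) sep someI)
    qed
    have "range h = g ` range (\<lambda>p. h p + e * d p)" using g by (auto simp: image_image)
    moreover have "\<not> inj_on g (range (\<lambda>p. h p + e * d p))"
    proof
      assume inj: "inj_on g (range (\<lambda>p. h p + e * d p))"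
      have "g (h i + e * d i) = g (h j + e * d j)" unfolding g by (rule assms(2))
      then have "h i + e * d i = h j + e * d j" by (rule inj_onD[OF inj]) auto
      then show False using sep ne by blast
    qed
    moreover have "card (g ` range (\<lambda>p. h p + e * d p)) \<le> card (range (\<lambda>p. h p + e * d p))"
      by (rule card_image_le) simp
    ultimately show ?thesis
      using eq_card_imp_inj_on[of "range (\<lambda>p. h p + e * d p)" g] by (simp add: order.strict_iff_order) auto
  qed
  ultimately show False by simp
qed

text \<open>Two opposite arrows inside a colour put D + e(E_ij + E_ji) into the limit space, where D
  is the diagonal matrix of colours. It has the eigenvalues h i + e and h i - e; for generic e both
  are new, and at most the value h i is lost, so the number of eigenvalues exceeds the
  bound.\<close>

lemma antisym_G: "h i = h j \<Longrightarrow> G i j \<Longrightarrow> G j i \<Longrightarrow> False"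
proof -
  assume a: "h i = h j" "G i j" "G j i"
  then have ij: "i \<noteq> j" by (simp add: G_def)
  let ?B = "(\<lambda>c. c - h i) ` range h \<union> (\<lambda>c. h i - c) ` range h"
  obtain e where e: "e \<noteq> 0" "e \<notin> ?B" using infinite_avoid[of ?B] by auto
  have n: "h i + e \<notin> range h" "h i - e \<notin> range h"
    using e(2) by (auto simp: image_iff algebra_simps)
  define X where "X = diag_mat h + mat_scale e (unit_mat i j + unit_mat j i)"
  have XU: "X \<in> limits" unfolding X_def by (intro limits_add limits_scale diag_mat_h unit_mat_in_limits a)
  have 1: "h i + s * e \<in> eigenvals X" if "s * s = 1" for s
  proof (rule eigenvalue_in_eigenvals)
    show "axis i 1 + s *s axis j 1 \<noteq> (0 :: (complex, 'n) vec)"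
      using ij by (simp add: vec_eq_iff axis_def) (metis zero_neq_one)
    have "(X *v (axis i 1 + s *s axis j 1)) $ p = ((h i + s * e) *s (axis i 1 + s *s axis j 1)) $ p" for p
    proof -
      have "(X *v (axis i 1 + s *s axis j 1)) $ p = X$p$i + s * X$p$j"
        by (simp add: matrix_vector_mult_def axis_def distrib_left sum.distrib if_distrib[of "\<lambda>c. _ * c"] cong: if_cong)
      then show ?thesis using ij a(1) that
        by (auto simp: X_def diag_mat_nth unit_mat_nth axis_def algebra_simps)
    qed
    then show "X *v (axis i 1 + s *s axis j 1) = (h i + s * e) *s (axis i 1 + s *s axis j 1)"
      by (simp add: vec_eq_iff)
  qed
  have 2: "h l \<in> eigenvals X" if "h l \<noteq> h i" for l
  proof (rule eigenvalue_in_eigenvals)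
    show "axis l 1 \<noteq> (0 :: (complex, 'n) vec)" by simp
    have l: "l \<noteq> i" "l \<noteq> j" using that a(1) by auto
    have "(X *v axis l 1) $ p = (h l *s axis l 1) $ p" for p
    proof -
      have "(X *v axis l 1) $ p = X$p$l"
        by (simp add: matrix_vector_mult_def axis_def if_distrib[of "\<lambda>c. _ * c"] cong: if_cong)
      then show ?thesis using l by (auto simp: X_def diag_mat_nth unit_mat_nth axis_def)
    qed
    then show "X *v axis l 1 = h l *s axis l 1" by (simp add: vec_eq_iff)
  qed
  have sub: "insert (h i + e) (insert (h i - e) (range h - {h i})) \<subseteq> eigenvals X"
    using 1[of 1] 1[of "-1"] 2 by auto
  have "h i + e \<noteq> h i - e" using e(1) by auto
  then have "card (insert (h i + e) (insert (h i - e) (range h - {h i}))) = Suc (Suc (card (range h - {h i})))"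
    using n by simp
  also have "\<dots> = Suc (card (range h))" by (simp add: card_Suc_Diff1 del: card_Diff_insert)
  finally have "Suc (card (range h)) \<le> card (eigenvals X)" using card_mono[OF finite_eigenvals sub] by simp
  then show False using limits_spec[OF XU] by simp
qed

lemma weight_order_w_inj: "weight_order w i j = weight_order w p q \<Longrightarrow> i = p \<and> j = q"
  by (rule weight_order_inj[of w]) (rule sidon, assumption+)

text \<open>Two diagonal pivots of one colour are impossible: the limit belonging to the lower one
  is constant on the colour, yet it is 1 at its own position and 0 at the higher one. So all pivots
  except at most one per colour are arrows.\<close>

lemma card_G: "card {(i, j). G i j} + card (range h) \<ge> 17"
proof -
  let ?P = "{(i, j). pivot V (weight_order w) i j}"
  let ?Q = "{i. pivot V (weight_order w) i i}"
  have "inj_on h ?Q"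
  proof
    fix i j assume ij: "i \<in> ?Q" "j \<in> ?Q" "h i = h j"
    have le: "\<not> weight_order w q q > weight_order w p p" if pv: "pivot V (weight_order w) p p" and hh: "h p = h q" for p q
    proof
      assume k: "weight_order w q q > weight_order w p p"
      obtain d where d: "diag_mat d \<in> limits" "d p = 1" "\<And>j. weight_order w j j > weight_order w p p \<Longrightarrow> d j = 0"
        by (rule diag_in_limits[OF pv]) blast
      then show False using diag_block_scalar[OF d(1) hh] k by simp
    qed
    have "weight_order w i i = weight_order w j j" using le[of i j] le[of j i] ij by force
    then show "i = j" using weight_order_w_inj by blast
  qed
  then have "card ?Q \<le> card (range h)" by (intro card_inj_on_le[of h]) auto
  moreover have "?P = {(i, j). G i j} \<union> (\<lambda>i. (i, i)) ` ?Q" by (auto simp: G_def)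
  then have "card ?P \<le> card {(i, j). G i j} + card ((\<lambda>i. (i, i)) ` ?Q)"
    by (metis card_Un_le)
  moreover have "card ((\<lambda>i. (i, i)) ` ?Q) \<le> card ?Q" by (rule card_image_le) simp
  moreover have "cmat.dim V \<le> card ?P" by (rule dim_le_card_pivots[OF sub]) (rule weight_order_w_inj)
  then have "17 \<le> card ?P" using dim by linarith
  ultimately show ?thesis by linarith
qed

text \<open>[D + s A, X + B/s] = [D, X] + [A, B] + s [A, X] + [D, B]/s. The last term is 0 by
  assumption, and the third disappears as s tends to 0.\<close>

lemma minor3_combined:
  assumes "X \<in> limits" "A \<in> limits" "B \<in> limits" "comm (diag_mat h) B = 0"
  shows "minor3 (comm (diag_mat h) X + comm A B) i1 i2 i3 j1 j2 j3 = 0"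
proof (rule minor3_eq_0_limit[where K = "comm A X"])
  fix s :: complex assume s: "s \<noteq> 0"
  have "comm (diag_mat h + mat_scale s A) (X + mat_scale (1/s) B) = comm (diag_mat h) X + comm A B + mat_scale s (comm A X)"
    using s assms(4) by (simp add: comm_add comm_scale vec_eq_iff)
  moreover have "diag_mat h + mat_scale s A \<in> limits" "X + mat_scale (1/s) B \<in> limits"
    by (intro limits_add limits_scale diag_mat_h assms)+
  ultimately show "minor3 (comm (diag_mat h) X + comm A B + mat_scale s (comm A X)) i1 i2 i3 j1 j2 j3 = 0"
    by (metis limits_minor3)
qed

lemma limits_zero: "0 \<in> limits"
proof -
  have "mat_scale 0 (diag_mat h) = 0" by (simp add: vec_eq_iff)
  then show ?thesis using limits_scale[OF diag_mat_h, of 0] by simp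
qed

lemma off_edge:
  assumes "G i j" "h i \<noteq> h j" obtains X where "X \<in> limits" "comm (diag_mat h) X = unit_mat i j"
proof
  show "mat_scale (1 / (h i - h j)) (unit_mat i j) \<in> limits" by (intro limits_scale unit_mat_in_limits assms)
  show "comm (diag_mat h) (mat_scale (1 / (h i - h j)) (unit_mat i j)) = unit_mat i j"
    using assms(2) by (simp add: comm_scale comm_diag_unit_mat vec_eq_iff)
qed

text \<open>In every case the commutator restricted to the chosen rows and columns is a permutation
  matrix up to signs. In the two hub cases further terms may occur, but only in row
  \<open>v\<close>, respectively column \<open>v\<close>, outside the minor.\<close>

lemma pivot_graph: "pivot_graph h G"
proof
  show "CARD('n) = 6" by (rule card6)
  show "\<not> G i i" for i by (simp add: G_def)
  show "17 \<le> card {(i, j). G i j} + card (range h)" by (rule card_G)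
  show "h i = h j \<Longrightarrow> G i j \<Longrightarrow> G j i \<Longrightarrow> False" for i j by (rule antisym_G)
next
  fix i1 j1 i2 j2 i3 j3
  assume a: "G i1 j1" "h i1 \<noteq> h j1" "G i2 j2" "h i2 \<noteq> h j2" "G i3 j3" "h i3 \<noteq> h j3"
    "distinct [i1, i2, i3]" "distinct [j1, j2, j3]"
  obtain X1 X2 X3 where X: "X1 \<in> limits" "comm (diag_mat h) X1 = unit_mat i1 j1" "X2 \<in> limits" "comm (diag_mat h) X2 = unit_mat i2 j2"
    "X3 \<in> limits" "comm (diag_mat h) X3 = unit_mat i3 j3"
    using off_edge[OF a(1,2)] off_edge[OF a(3,4)] off_edge[OF a(5,6)] by metis
  have "minor3 (comm (diag_mat h) (X1 + X2 + X3) + comm 0 0) i1 i2 i3 j1 j2 j3 = 0"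
    by (intro minor3_combined limits_add X limits_zero comm_zero)
  moreover have "i2 \<noteq> i1" "i3 \<noteq> i1" "i3 \<noteq> i2" "j2 \<noteq> j1" "j3 \<noteq> j1" "j3 \<noteq> j2" using a(7,8) by auto
  ultimately show False using a(7,8) by (simp add: comm_add X minor3_def unit_mat_nth)
next
  fix i1 j1 i2 j2 a b c
  assume a: "G i1 j1" "h i1 \<noteq> h j1" "G i2 j2" "h i2 \<noteq> h j2" "G a b" "h a = h b" "G b c" "h b = h c"
    "distinct [a, i1, i2]" "distinct [c, j1, j2]"
  obtain X1 X2 where X: "X1 \<in> limits" "comm (diag_mat h) X1 = unit_mat i1 j1" "X2 \<in> limits" "comm (diag_mat h) X2 = unit_mat i2 j2"
    using off_edge[OF a(1,2)] off_edge[OF a(3,4)] by metis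
  have "comm (diag_mat h) (unit_mat b c) = 0" using a(8) by (simp add: comm_diag_unit_mat vec_eq_iff)
  then have m: "minor3 (comm (diag_mat h) (X1 + X2) + comm (unit_mat a b) (unit_mat b c)) a i1 i2 c j1 j2 = 0"
    by (intro minor3_combined limits_add X unit_mat_in_limits a)
  have "c \<noteq> a" using a antisym_G[of a b] by auto
  then have "comm (unit_mat a b) (unit_mat b c) = unit_mat a c" by (simp add: comm_unit_mat)
  moreover have "i1 \<noteq> a" "i2 \<noteq> a" "i2 \<noteq> i1" "j1 \<noteq> c" "j2 \<noteq> c" "j2 \<noteq> j1" using a(9,10) by auto
  ultimately show False using m a(9,10) by (simp add: comm_add X minor3_def unit_mat_nth)
next
  fix y z a b c d
  assume a: "G y z" "h y \<noteq> h z" "G a b" "h a = h b" "G b c" "h b = h c" "G c d" "h c = h d"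
    "y \<noteq> a" "y \<noteq> b" "z \<noteq> c" "z \<noteq> d"
  obtain X where X: "X \<in> limits" "comm (diag_mat h) X = unit_mat y z"
    using off_edge[OF a(1,2)] by metis
  have "comm (diag_mat h) (unit_mat b c + unit_mat c d) = 0" using a(6,8) by (simp add: comm_add comm_diag_unit_mat vec_eq_iff)
  then have m: "minor3 (comm (diag_mat h) X + comm (unit_mat a b + unit_mat b c) (unit_mat b c + unit_mat c d)) y a b z c d = 0"
    by (intro minor3_combined limits_add X unit_mat_in_limits a)
  have n: "a \<noteq> b" "b \<noteq> c" "c \<noteq> d" "a \<noteq> c" "b \<noteq> d"
    using a(3,5,7) antisym_G[of a b] antisym_G[of b c] a by (auto simp: G_def)
  \<comment> \<open>If d = a the commutator has the further term -E_cb. It meets the minor only for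
    y = c and z = b, which the equal colours of b and c exclude.\<close>
  have "\<not> (y = c \<and> z = b)" using a(2,6) by auto
  then show False using m n a(9-12) by (auto simp: comm_add X comm_unit_mat minor3_def unit_mat_nth split: if_splits)
next
  fix a b v u y z
  assume a: "G a b" "G b v" "G u v" "G v y" "G v z" "distinct [a, u, b, v]" "y \<noteq> z"
  have n: "y \<noteq> v" "z \<noteq> v" using a by (auto simp: G_def)
  have "minor3 (comm (unit_mat a b + unit_mat u v + unit_mat v z) (unit_mat b v + unit_mat v y)) a u b v y z = 0"
    by (intro limits_minor3 limits_add unit_mat_in_limits a)
  then show False using a(6,7) n by (auto simp: comm_add comm_unit_mat minor3_def unit_mat_nth split: if_splits)
next
  fix a b v u y z
  assume a: "G b a" "G v b" "G v u" "G y v" "G z v" "distinct [a, u, b, v]" "y \<noteq> z"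
  have n: "y \<noteq> v" "z \<noteq> v" using a by (auto simp: G_def)
  have "minor3 (comm (unit_mat b a + unit_mat v u + unit_mat z v) (unit_mat v b + unit_mat y v)) v y z a u b = 0"
    by (intro limits_minor3 limits_add unit_mat_in_limits a)
  then show False using a(6,7) n by (auto simp: comm_add comm_unit_mat minor3_def unit_mat_nth split: if_splits)
qed

end

subsection \<open>Subspaces containing the first two rows\<close>

lemma exhaust_6: "x = 1 \<or> x = 2 \<or> x = 3 \<or> x = 4 \<or> x = 5 \<or> x = 6" for x :: 6
proof (induct x)
  case (of_int z)
  then have "z = 0 \<or> z = 1 \<or> z = 2 \<or> z = 3 \<or> z = 4 \<or> z = 5" by fastforce
  then show ?case by auto
qed

lemma forall_6: "(\<forall>i::6. P i) \<longleftrightarrow> P 1 \<and> P 2 \<and> P 3 \<and> P 4 \<and> P 5 \<and> P 6"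
  by (metis exhaust_6)

lemma UNIV_6: "UNIV = {1, 2, 3, 4, 5, 6 :: 6}"
  using exhaust_6 by auto

lemma sum_6: "sum f (UNIV :: 6 set) = f 1 + f 2 + f 3 + f 4 + f 5 + f 6"
  unfolding UNIV_6 by (simp add: ac_simps)

text \<open>The bilinear pairing, without conjugation: \<open>f\<close> plays the part of a linear
  form.\<close>

definition dot :: "complex ^ 'n \<Rightarrow> complex ^ 'n \<Rightarrow> complex" where
  "dot f x = (\<Sum>k\<in>UNIV. f$k * x$k)"

lemma dot_add: "dot f (x + y) = dot f x + dot f y" and dot_scale: "dot f (c *s x) = c * dot f x"
  and dot_diff: "dot f (x - y) = dot f x - dot f y" and dot_zero: "dot f 0 = 0"
  by (simp_all add: dot_def sum.distrib sum_subtractf sum_distrib_left algebra_simps)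

text \<open>The vectors are laid out as rows of a square matrix whose remaining rows are zero; its
  determinant vanishes.\<close>

lemma orthogonal_exists:
  fixes X :: "(complex ^ 'n) set"
  assumes "finite X" "card X < CARD('n)"
  shows "\<exists>f. f \<noteq> 0 \<and> (\<forall>x\<in>X. dot f x = 0)"
proof -
  obtain g :: "complex ^ 'n \<Rightarrow> 'n" where g: "inj_on g X"
    using assms card_le_inj[of X "UNIV :: 'n set"] by auto
  have "card (g ` X) < CARD('n)" using assms card_image_le[of X g] by simp
  then obtain i0 where i0: "i0 \<notin> g ` X" by (metis UNIV_eq_I less_irrefl)
  define A where "A = (\<chi> i. if i \<in> g ` X then inv_into X g i else 0)"
  have "row i0 A = 0" using i0 by (simp add: row_def A_def vec_eq_iff)
  then have "det A = 0" by (rule det_zero_row)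
  then have "\<not> invertible A" by (simp add: invertible_det_nz)
  then have "\<not> (\<exists>B. B ** A = mat 1)" by (simp add: invertible_left_inverse)
  then obtain f where f: "f \<noteq> 0" "A *v f = 0" using matrix_left_invertible_ker[of A] by blast
  have "dot f x = 0" if "x \<in> X" for x
  proof -
    have "(A *v f) $ g x = dot f x"
      using that g by (simp add: A_def matrix_vector_mult_def dot_def mult.commute)
    then show ?thesis using f by simp
  qed
  then show ?thesis using f(1) by blast
qed

text \<open>Half of the rank-nullity formula for a linear map from matrices to vectors: a basis of
  the image lifted to \<open>V\<close>, together with \<open>B\<close>, spans
  \<open>V\<close>.\<close>

lemma dim_kernel_image:
  fixes f :: "complex ^ 'n ^ 'm \<Rightarrow> complex ^ 'k" and V :: "(complex ^ 'n ^ 'm) set"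
  assumes sub: "cmat.subspace V"
    and add: "\<And>S T. f (S + T) = f S + f T" and scale: "\<And>c S. f (mat_scale c S) = c *s f S"
    and B: "{T\<in>V. f T = 0} \<subseteq> cmat.span B" "finite B"
  shows "cmat.dim V \<le> vec.dim (f ` V) + card B"
proof -
  obtain C where C: "C \<subseteq> f ` V" "vec.independent C" "f ` V \<subseteq> vec.span C" "card C = vec.dim (f ` V)"
    by (rule vec.basis_exists)
  have fC: "finite C" using C(2) by (rule vec.finiteI_independent)
  have "\<forall>c\<in>C. \<exists>T. T \<in> V \<and> f T = c" using C(1) by blast
  then obtain g where g: "\<And>c. c \<in> C \<Longrightarrow> g c \<in> V \<and> f (g c) = c" by metis
  have sum_f: "f (\<Sum>x\<in>A. mat_scale (r x) (g x)) = (\<Sum>x\<in>A. r x *s f (g x))" if "finite A" for A r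
    using that
  proof (induction A rule: finite_induct)
    case empty
    have "mat_scale 0 0 = (0 :: complex ^ 'n ^ 'm)" by (simp add: vec_eq_iff)
    then show ?case using scale[of 0 0] by simp
  next
    case (insert x A)
    then show ?case by (simp add: add scale)
  qed
  have "T \<in> cmat.span (B \<union> g ` C)" if T: "T \<in> V" for T
  proof -
    have "f T \<in> vec.span C" using C(3) T by blast
    then obtain r where r: "f T = (\<Sum>x\<in>C. r x *s x)" using vec.span_finite[OF fC] by auto
    define R where "R = (\<Sum>x\<in>C. mat_scale (r x) (g x))"
    have RV: "R \<in> V" unfolding R_def using g sub by (intro cmat.subspace_sum cmat.subspace_scale) auto
    have "f R = f T" unfolding R_def r sum_f[OF fC] using g by (intro sum.cong) auto
    moreover have "f (T - R) = f T - f R"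
      using add[of "T - R" R] by simp
    ultimately have "T - R \<in> {T\<in>V. f T = 0}" using T RV sub by (auto intro: cmat.subspace_diff)
    then have "T - R \<in> cmat.span (B \<union> g ` C)" using B(1) cmat.span_mono[of B "B \<union> g ` C"] by blast
    moreover have "R \<in> cmat.span (B \<union> g ` C)" unfolding R_def
      by (intro cmat.span_sum cmat.span_scale cmat.span_base) auto
    ultimately have "T - R + R \<in> cmat.span (B \<union> g ` C)" by (rule cmat.span_add)
    then show ?thesis by simp
  qed
  then have "cmat.dim V \<le> card (B \<union> g ` C)" using B(2) fC by (intro cmat.dim_le_card) auto
  also have "\<dots> \<le> card B + card (g ` C)" by (rule card_Un_le)
  also have "\<dots> \<le> card B + card C" using card_image_le[OF fC, of g] by simp
  finally show ?thesis using C(4) by simp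
qed

definition emb :: "4 \<Rightarrow> 6" where
  "emb k = (if k = 1 then 3 else if k = 2 then 4 else if k = 3 then 5 else 6)"

lemma emb_simps [simp]: "emb 1 = 3" "emb 2 = 4" "emb 3 = 5" "emb 4 = 6"
  by (simp_all add: emb_def)

lemma emb_neq [simp]: "emb k \<noteq> 1" "emb k \<noteq> 2" "1 \<noteq> emb k" "2 \<noteq> emb k"
  using exhaust_4[of k] by auto

lemma emb_inj [simp]: "emb k = emb l \<longleftrightarrow> k = l"
  using exhaust_4[of k] exhaust_4[of l] by auto

lemma cases_6: obtains "x = 1" | "x = 2" | k where "x = emb k"
  using exhaust_6[of x] emb_simps by metis

lemma sum_6_split: "sum f (UNIV :: 6 set) = f 1 + f 2 + (\<Sum>k\<in>UNIV. f (emb k))"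
  by (simp add: sum_6 sum_4 add.assoc)

definition lower_block :: "complex ^ 6 ^ 6 \<Rightarrow> complex ^ 4 ^ 4" where
  "lower_block X = (\<chi> i j. X $ emb i $ emb j)"

definition top_rows :: "complex ^ 4 \<Rightarrow> complex ^ 4 \<Rightarrow> complex ^ 6 ^ 6" where
  "top_rows x y = (\<Sum>k\<in>UNIV. mat_scale (x$k) (unit_mat 1 (emb k)) + mat_scale (y$k) (unit_mat 2 (emb k)))"

lemma top_rows_nth [simp]:
  "top_rows x y $ 1 $ emb k = x$k" "top_rows x y $ 2 $ emb k = y$k" "top_rows x y $ emb l $ j = 0"
  "top_rows x y $ i $ 1 = 0" "top_rows x y $ i $ 2 = 0"
  by (simp_all add: top_rows_def unit_mat_nth if_distrib[of "\<lambda>c. _ * c"] cong: if_cong)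

lemma comm_top_rows:
  "comm T (top_rows x y) $ 1 $ 1 = - (\<Sum>k\<in>UNIV. x$k * T $ emb k $ 1)"
  "comm T (top_rows x y) $ 1 $ 2 = - (\<Sum>k\<in>UNIV. x$k * T $ emb k $ 2)"
  "comm T (top_rows x y) $ 2 $ 1 = - (\<Sum>k\<in>UNIV. y$k * T $ emb k $ 1)"
  "comm T (top_rows x y) $ 2 $ 2 = - (\<Sum>k\<in>UNIV. y$k * T $ emb k $ 2)"
  "comm T (top_rows x y) $ 1 $ emb l = T$1$1 * x$l + T$1$2 * y$l - (\<Sum>k\<in>UNIV. x$k * T $ emb k $ emb l)"
  "comm T (top_rows x y) $ 2 $ emb l = T$2$1 * x$l + T$2$2 * y$l - (\<Sum>k\<in>UNIV. y$k * T $ emb k $ emb l)"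
  "comm T (top_rows x y) $ emb i $ 1 = 0"
  "comm T (top_rows x y) $ emb i $ 2 = 0"
  "comm T (top_rows x y) $ emb i $ emb l = T $ emb i $ 1 * x$l + T $ emb i $ 2 * y$l"
  by (simp_all add: comm_nth sum_6_split)

lemma avoid_two:
  fixes x y :: 4
  obtains k where "k \<noteq> x" "k \<noteq> y"
proof -
  have "card {x, y} < CARD(4)" by (simp add: card_insert_if)
  then have "{x, y} \<noteq> UNIV" by (metis less_irrefl)
  then show ?thesis using that by auto
qed

text \<open>The upper right 2 by 4 block is full in \<open>V\<close>, and \<open>S\<close> is block
  diagonal. By \<open>reg1\<close> and \<open>reg2\<close> its first two diagonal entries are not
  eigenvalues of its lower right block, so bracketing top rows with \<open>S\<close> is bijective on
  them.\<close>

locale lift =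
  fixes V :: "(complex ^ 6 ^ 6) set" and S :: "complex ^ 6 ^ 6"
  assumes sub: "cmat.subspace V"
    and rank2: "\<And>S T. S \<in> V \<Longrightarrow> T \<in> V \<Longrightarrow> rank_le2 (comm S T)"
    and dim: "cmat.dim V \<ge> 17"
    and one: "mat 1 \<in> V"
    and K1: "\<And>k. unit_mat 1 (emb k) \<in> V" and K2: "\<And>k. unit_mat 2 (emb k) \<in> V"
    and S: "S \<in> V"
    and S_zero: "S$1$2 = 0" "S$2$1 = 0" "\<And>k. S $ 1 $ emb k = 0" "\<And>k. S $ 2 $ emb k = 0"
      "\<And>k. S $ emb k $ 1 = 0" "\<And>k. S $ emb k $ 2 = 0"
    and reg1: "\<And>x. (\<And>l. (\<Sum>k\<in>UNIV. x$k * S $ emb k $ emb l) = S$1$1 * x$l) \<Longrightarrow> x = 0"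
    and reg2: "\<And>x. (\<And>l. (\<Sum>k\<in>UNIV. x$k * S $ emb k $ emb l) = S$2$2 * x$l) \<Longrightarrow> x = 0"
begin

lemma top_rows_in: "top_rows x y \<in> V"
  unfolding top_rows_def by (intro cmat.subspace_sum cmat.subspace_add cmat.subspace_scale sub K1 K2)

lemma minor: "X \<in> V \<Longrightarrow> Y \<in> V \<Longrightarrow> minor3 (comm X Y) i1 i2 i3 j1 j2 j3 = 0"
  using rank2 rank_le2_minor3 by blast

lemma S_add: "T \<in> V \<Longrightarrow> S + mat_scale s T \<in> V"
  by (intro cmat.subspace_add cmat.subspace_scale sub S)

text \<open>The hyperplane annihilated by \<open>c\<close> has dimension 3, and only 0 is parallel
  to all its vectors.\<close>

lemma not_all_parallel:
  fixes g c :: "complex ^ 4"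
  assumes par: "\<And>w k l. dot c w = 0 \<Longrightarrow> g$k * w$l = g$l * w$k" and c: "c \<noteq> 0"
  shows "g = 0"
proof -
  obtain i where i: "c$i \<noteq> 0" using c by (auto simp: vec_eq_iff)
  have w: "dot c (c$i *s axis k 1 - c$k *s axis i 1) = 0" for k
    by (simp add: dot_def axis_def right_diff_distrib sum_subtractf if_distrib[of "\<lambda>x. _ * x"] cong: if_cong)
  have ne: "g$x = 0" if "x \<noteq> i" for x
  proof -
    obtain k where k: "k \<noteq> x" "k \<noteq> i"
      by (rule avoid_two)
    show ?thesis using par[OF w[of k], of x k] k that i by (simp add: axis_def)
  qed
  obtain k where k: "k \<noteq> i" by (rule avoid_two[of i i])
  have "g$i = 0" using par[OF w[of k], of i k] k i ne[OF k] by (simp add: axis_def)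
  then show ?thesis using ne by (metis vec_eq_iff zero_index)
qed

text \<open>Let \<open>x\<close> annihilate the second column of the lower left block of
  \<open>T\<close>. The minor of [S + s T, top_rows x y] on rows 1, 2, i and columns 2, k, l then
  contains the factor s^2. Dividing and letting s tend to 0 shows that the row g = S_11 x - x N,
  with N the lower right block of \<open>S\<close>, is parallel to T_i1 x + T_i2 y whenever
  \<open>y\<close> does not annihilate that column. Varying \<open>y\<close> gives g = 0, and
  \<open>reg1\<close> gives x = 0.\<close>

lemma lower_left_zero2: assumes T: "T \<in> V" shows "T $ emb i $ 2 = 0"
proof (rule ccontr)
  assume ci: "T $ emb i $ 2 \<noteq> 0"
  define c1 c2 where "c1 = (\<chi> k. T $ emb k $ 1)" and "c2 = (\<chi> k. T $ emb k $ 2)"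
  have "card {c1, c2} < CARD(4)" by (simp add: card_insert_if)
  then obtain x where x: "x \<noteq> 0" "dot x c1 = 0" "dot x c2 = 0"
    using orthogonal_exists[of "{c1, c2}"] by auto
  define g where "g = (\<chi> l. S$1$1 * x$l - (\<Sum>k\<in>UNIV. x$k * S $ emb k $ emb l))"
  define Z where "Z y l = T $ emb i $ 1 * x$l + T $ emb i $ 2 * y$l" for y :: "complex ^ 4" and l
  have par: "g$k * Z y l = g$l * Z y k" if y: "dot c2 y \<noteq> 0" for y k l
  proof -
    define Y where "Y s l = g$l + s * (T$1$1 * x$l + T$1$2 * y$l - (\<Sum>k\<in>UNIV. x$k * T $ emb k $ emb l))" for s l
    have "Y s k * Z y l - Y s l * Z y k = 0" if s: "s \<noteq> 0" for s
    proof -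
      let ?c = "comm (S + mat_scale s T) (top_rows x y)"
      have m0: "minor3 ?c 1 2 (emb i) 2 (emb k) (emb l) = 0"
        by (rule minor[OF S_add[OF T] top_rows_in])
      have e1: "?c $ 1 $ 2 = 0" using x(3) by (simp add: comm_top_rows S_zero dot_def c2_def sum_distrib_left[symmetric] mult.left_commute[of _ s])
      have e2: "?c $ 2 $ 2 = - s * dot c2 y"
        by (simp add: comm_top_rows S_zero dot_def c2_def sum_distrib_left sum_negf[symmetric] mult_ac)
      have e3: "?c $ 1 $ emb l = Y s l" for l
        by (simp add: comm_top_rows S_zero Y_def g_def sum.distrib sum_distrib_left algebra_simps)
      have e4: "?c $ emb i $ emb l = s * Z y l" for l
        by (simp add: comm_top_rows S_zero Z_def algebra_simps)
      have e5: "?c $ emb i $ 2 = 0" by (simp add: comm_top_rows)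
      have "s * s * dot c2 y * (Y s k * Z y l - Y s l * Z y k) = 0"
        using m0 unfolding minor3_def e1 e2 e3 e4 e5 by (simp add: algebra_simps)
      then show ?thesis using s y by simp
    qed
    then have "Y 0 k * Z y l - Y 0 l * Z y k = 0"
      by (intro eq_zero_at_0_by_continuity[of "\<lambda>s. Y s k * Z y l - Y s l * Z y k"]) (auto simp: Y_def intro!: continuous_intros)
    then show ?thesis by (simp add: Y_def)
  qed
  have "c2 \<noteq> 0" using ci by (auto simp: c2_def vec_eq_iff)
  have y0: "dot c2 (axis i 1) \<noteq> 0" using ci by (simp add: dot_def c2_def axis_def if_distrib[of "\<lambda>x. _ * x"] cong: if_cong)
  have "g = 0"
  proof (rule not_all_parallel[OF _ \<open>c2 \<noteq> 0\<close>])
    fix w k l assume w: "dot c2 w = 0"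
    have "g$k * Z (axis i 1 + w) l = g$l * Z (axis i 1 + w) k"
      by (rule par) (use y0 w in \<open>simp add: dot_add\<close>)
    moreover have "g$k * Z (axis i 1) l = g$l * Z (axis i 1) k" by (rule par[OF y0])
    ultimately have "g$k * (Z (axis i 1 + w) l - Z (axis i 1) l) = g$l * (Z (axis i 1 + w) k - Z (axis i 1) k)"
      by (simp add: right_diff_distrib)
    then have "T $ emb i $ 2 * (g$k * w$l) = T $ emb i $ 2 * (g$l * w$k)"
      by (simp add: Z_def algebra_simps)
    then show "g$k * w$l = g$l * w$k" using ci by simp
  qed
  then have "x = 0" by (intro reg1) (simp add: g_def vec_eq_iff)
  then show False using x by simp
qed

text \<open>The same argument with rows 1 and 2 exchanged and \<open>reg2\<close> in place of
  \<open>reg1\<close>; the vanishing of the second column, already known, simplifies the row coming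
  from \<open>T\<close>.\<close>

lemma lower_left_zero1: assumes T: "T \<in> V" shows "T $ emb i $ 1 = 0"
proof (rule ccontr)
  assume ci: "T $ emb i $ 1 \<noteq> 0"
  define c1 where "c1 = (\<chi> k. T $ emb k $ 1)"
  have "card {c1} < CARD(4)" by simp
  then obtain x where x: "x \<noteq> 0" "dot x c1 = 0"
    using orthogonal_exists[of "{c1}"] by auto
  define g where "g = (\<chi> l. S$2$2 * x$l - (\<Sum>k\<in>UNIV. x$k * S $ emb k $ emb l))"
  define Z where "Z y l = T $ emb i $ 1 * y$l" for y :: "complex ^ 4" and l
  have par: "g$k * Z y l = g$l * Z y k" if y: "dot c1 y \<noteq> 0" for y k l
  proof -
    define Y where "Y s l = g$l + s * (T$2$1 * y$l + T$2$2 * x$l - (\<Sum>k\<in>UNIV. x$k * T $ emb k $ emb l))" for s l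
    have "Y s k * Z y l - Y s l * Z y k = 0" if s: "s \<noteq> 0" for s
    proof -
      let ?c = "comm (S + mat_scale s T) (top_rows y x)"
      have m0: "minor3 ?c 2 1 (emb i) 1 (emb k) (emb l) = 0"
        by (rule minor[OF S_add[OF T] top_rows_in])
      have e1: "?c $ 2 $ 1 = 0" using x(2) by (simp add: comm_top_rows S_zero dot_def c1_def sum_distrib_left[symmetric] mult.left_commute[of _ s])
      have e2: "?c $ 1 $ 1 = - s * dot c1 y"
        by (simp add: comm_top_rows S_zero dot_def c1_def sum_distrib_left sum_negf[symmetric] mult_ac)
      have e3: "?c $ 2 $ emb l = Y s l" for l
        by (simp add: comm_top_rows S_zero Y_def g_def sum.distrib sum_distrib_left algebra_simps)
      have e4: "?c $ emb i $ emb l = s * Z y l" for l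
        by (simp add: comm_top_rows S_zero Z_def lower_left_zero2[OF T] algebra_simps)
      have e5: "?c $ emb i $ 1 = 0" by (simp add: comm_top_rows)
      have "s * s * dot c1 y * (Y s k * Z y l - Y s l * Z y k) = 0"
        using m0 unfolding minor3_def e1 e2 e3 e4 e5 by (simp add: algebra_simps)
      then show ?thesis using s y by simp
    qed
    then have "Y 0 k * Z y l - Y 0 l * Z y k = 0"
      by (intro eq_zero_at_0_by_continuity[of "\<lambda>s. Y s k * Z y l - Y s l * Z y k"]) (auto simp: Y_def intro!: continuous_intros)
    then show ?thesis by (simp add: Y_def)
  qed
  have "c1 \<noteq> 0" using ci by (auto simp: c1_def vec_eq_iff)
  have y0: "dot c1 (axis i 1) \<noteq> 0" using ci by (simp add: dot_def c1_def axis_def if_distrib[of "\<lambda>x. _ * x"] cong: if_cong)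
  have "g = 0"
  proof (rule not_all_parallel[OF _ \<open>c1 \<noteq> 0\<close>])
    fix w k l assume w: "dot c1 w = 0"
    have "g$k * Z (axis i 1 + w) l = g$l * Z (axis i 1 + w) k"
      by (rule par) (use y0 w in \<open>simp add: dot_add\<close>)
    moreover have "g$k * Z (axis i 1) l = g$l * Z (axis i 1) k" by (rule par[OF y0])
    ultimately have "g$k * (Z (axis i 1 + w) l - Z (axis i 1) l) = g$l * (Z (axis i 1 + w) k - Z (axis i 1) k)"
      by (simp add: right_diff_distrib)
    then have "T $ emb i $ 1 * (g$k * w$l) = T $ emb i $ 1 * (g$l * w$k)"
      by (simp add: Z_def algebra_simps)
    then show "g$k * w$l = g$l * w$k" using ci by simp
  qed
  then have "x = 0" by (intro reg2) (simp add: g_def vec_eq_iff)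
  then show False using x by simp
qed

end

lemma vector_6 [simp]:
  "(vector [a, b, c, d, e, f] :: 'a::zero ^ 6) $ 1 = a"
  "(vector [a, b, c, d, e, f] :: 'a::zero ^ 6) $ 2 = b"
  "(vector [a, b, c, d, e, f] :: 'a::zero ^ 6) $ 3 = c"
  "(vector [a, b, c, d, e, f] :: 'a::zero ^ 6) $ 4 = d"
  "(vector [a, b, c, d, e, f] :: 'a::zero ^ 6) $ 5 = e"
  "(vector [a, b, c, d, e, f] :: 'a::zero ^ 6) $ 6 = f"
  by (simp_all add: vector_def)

lemma calA_I:
  assumes "\<And>i. M $ emb i $ 1 = 0" "\<And>i. M $ emb i $ 2 = 0"
    and "\<And>i j. i \<in> {3, 4} \<Longrightarrow> j \<in> {1, 2} \<Longrightarrow> M $ emb i $ emb j = 0"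
    and "M $ emb 1 $ emb 2 = 0" "M $ emb 2 $ emb 1 = 0" "M $ emb 3 $ emb 4 = 0" "M $ emb 4 $ emb 3 = 0"
    and "\<And>i. M $ emb i $ emb i = l"
  shows "M \<in> calA"
proof -
  let ?A = "(\<chi> i j. M $ (if i = 1 then 1 else 2) $ (if j = 1 then 1 else 2)) :: complex ^ 2 ^ 2"
  let ?B = "(\<chi> i j. M $ (if i = 1 then 1 else 2) $ (if j = 1 then 3 else 4)) :: complex ^ 2 ^ 2"
  let ?C = "(\<chi> i j. M $ (if i = 1 then 1 else 2) $ (if j = 1 then 5 else 6)) :: complex ^ 2 ^ 2"
  let ?D = "(\<chi> i j. M $ (if i = 1 then 3 else 4) $ (if j = 1 then 5 else 6)) :: complex ^ 2 ^ 2"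
  have z: "M $ 3 $ 1 = 0" "M $ 4 $ 1 = 0" "M $ 5 $ 1 = 0" "M $ 6 $ 1 = 0"
     "M $ 3 $ 2 = 0" "M $ 4 $ 2 = 0" "M $ 5 $ 2 = 0" "M $ 6 $ 2 = 0"
    using assms(1)[of 1] assms(1)[of 2] assms(1)[of 3] assms(1)[of 4]
      assms(2)[of 1] assms(2)[of 2] assms(2)[of 3] assms(2)[of 4] by simp_all
  have y: "M $ 5 $ 3 = 0" "M $ 5 $ 4 = 0" "M $ 6 $ 3 = 0" "M $ 6 $ 4 = 0"
    using assms(3)[of 3 1] assms(3)[of 3 2] assms(3)[of 4 1] assms(3)[of 4 2] by simp_all
  have d: "M $ 3 $ 3 = l" "M $ 4 $ 4 = l" "M $ 5 $ 5 = l" "M $ 6 $ 6 = l"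
    using assms(8)[of 1] assms(8)[of 2] assms(8)[of 3] assms(8)[of 4] by simp_all
  have "M = block3 ?A ?B ?C 0 (mat l) ?D 0 0 (mat l)"
    unfolding vec_eq_iff forall_6 block3_def using z y d assms(4-7)
    by (simp add: mat_def)
  then show ?thesis unfolding calA_def by blast
qed

text \<open>Finiteness comes from the matrix units, which span the whole space.\<close>

lemma finite_basis:
  assumes "cmat.subspace (U :: (complex ^ 6 ^ 6) set)"
  obtains B where "B \<subseteq> U" "U \<subseteq> cmat.span B" "finite B" "card B = cmat.dim U"
proof -
  obtain B where B: "B \<subseteq> U" "cmat.independent B" "U \<subseteq> cmat.span B" "card B = cmat.dim U"
    by (rule cmat.basis_exists)
  have "X \<in> cmat.span ((\<lambda>(i, j). unit_mat i j) ` UNIV)" for X :: "complex ^ 6 ^ 6"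
  proof -
    have "X = (\<Sum>z\<in>UNIV. mat_scale (X $ fst z $ snd z) (case z of (i, j) \<Rightarrow> unit_mat i j))"
    proof -
      have "(\<Sum>z\<in>UNIV. mat_scale (X $ fst z $ snd z) (case z of (i, j) \<Rightarrow> unit_mat i j)) $ p $ q = X $ p $ q" for p q
      proof -
        have "(\<Sum>z\<in>UNIV. mat_scale (X $ fst z $ snd z) (case z of (i, j) \<Rightarrow> unit_mat i j)) $ p $ q
          = (\<Sum>z\<in>UNIV. if z = (p, q) then X $ p $ q else 0)"
          unfolding sum_component by (rule sum.cong) (auto simp: unit_mat_nth split: if_splits)
        then show ?thesis by simp
      qed
      then show ?thesis unfolding vec_eq_iff by metis
    qed
    moreover have "(\<Sum>z\<in>UNIV. mat_scale (X $ fst z $ snd z) (case z of (i, j) \<Rightarrow> unit_mat i j)) \<in> cmat.span ((\<lambda>(i, j). unit_mat i j) ` UNIV)"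
      by (intro cmat.span_sum cmat.span_scale cmat.span_base) auto
    ultimately show ?thesis by simp
  qed
  then have "B \<subseteq> cmat.span ((\<lambda>(i, j). unit_mat i j) ` UNIV)" by blast
  moreover have "finite ((\<lambda>(i, j). unit_mat i j) ` (UNIV :: (6 \<times> 6) set))" by simp
  ultimately have "finite B" using cmat.independent_span_bound[OF _ B(2)] by (metis (no_types, lifting))
  then show ?thesis by (rule that[OF B(1,3) _ B(4)])
qed

text \<open>An injective endomorphism of a finite-dimensional space is onto; this solves the
  Sylvester equations for the top rows.\<close>

lemma eigen_shift_surjective:
  fixes N :: "'n::finite \<Rightarrow> 'n \<Rightarrow> complex"
  assumes "\<And>x. (\<And>l. (\<Sum>k\<in>UNIV. x$k * N k l) = a * x$l) \<Longrightarrow> x = 0"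
  shows "\<exists>x. \<forall>l. (\<Sum>k\<in>UNIV. x$k * N k l) - a * x$l = v$l"
proof -
  define A where "A = (\<chi> l k. N k l - (if l = k then a else 0))"
  have A: "(A *v x) $ l = (\<Sum>k\<in>UNIV. x$k * N k l) - a * x$l" for x l
  proof -
    have "(A *v x) $ l = (\<Sum>k\<in>UNIV. x$k * N k l - (if l = k then a * x$k else 0))"
      unfolding matrix_vector_mult_def vec_lambda_beta by (rule sum.cong) (simp_all add: A_def algebra_simps)
    then show ?thesis by (simp add: sum_subtractf)
  qed
  have "x = 0" if "A *v x = 0" for x
    by (rule assms) (use that A[of x] in simp)
  then obtain B where "B ** A = mat 1" using matrix_left_invertible_ker[of A] by blast
  then have "A ** B = mat 1" by (simp add: matrix_left_right_inverse)
  then have "A *v (B *v v) = v" by (simp add: matrix_vector_mul_assoc)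
  then show ?thesis using A by metis
qed

section \<open>Commutativity of the lower right blocks\<close>

context lift
begin

lemma sylvester1: "\<exists>x. \<forall>l. (\<Sum>k\<in>UNIV. x$k * S $ emb k $ emb l) - S$1$1 * x$l = v$l"
  using reg1 by (rule eigen_shift_surjective)

lemma sylvester2: "\<exists>x. \<forall>l. (\<Sum>k\<in>UNIV. x$k * S $ emb k $ emb l) - S$2$2 * x$l = v$l"
  using reg2 by (rule eigen_shift_surjective)

lemma comm_swap: "comm X Y = - comm Y X" by (simp add: comm_def)

text \<open>Adding top rows to \<open>T\<close> gives the bracket with \<open>S\<close> any
  prescribed right part in rows 1 and 2. The lower right part of its brackets does not change,
  because members of \<open>V\<close> have a zero lower left block.\<close>

lemma adjust_rows:
  assumes T: "T \<in> V"
  obtains X where "X \<in> V" "\<And>l. comm (T + X) S $ 1 $ emb l = u$l" "\<And>l. comm (T + X) S $ 2 $ emb l = v$l"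
    "\<And>Y i l. Y \<in> V \<Longrightarrow> comm (T + X) Y $ emb i $ emb l = comm T Y $ emb i $ emb l"
proof -
  obtain x where x: "\<And>l. (\<Sum>k\<in>UNIV. x$k * S $ emb k $ emb l) - S$1$1 * x$l = (\<chi> l. u$l - comm T S $ 1 $ emb l)$l"
    using sylvester1 by blast
  obtain y where y: "\<And>l. (\<Sum>k\<in>UNIV. y$k * S $ emb k $ emb l) - S$2$2 * y$l = (\<chi> l. v$l - comm T S $ 2 $ emb l)$l"
    using sylvester2 by blast
  have "comm (T + top_rows x y) S $ 1 $ emb l = u$l" for l
    using x[of l] by (simp add: comm_add comm_swap[of _ S] comm_top_rows S_zero algebra_simps)
  moreover have "comm (T + top_rows x y) S $ 2 $ emb l = v$l" for l
    using y[of l] by (simp add: comm_add comm_swap[of _ S] comm_top_rows S_zero algebra_simps)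
  moreover have "comm (T + top_rows x y) Y $ emb i $ emb l = comm T Y $ emb i $ emb l" if "Y \<in> V" for Y i l
    using that lower_left_zero1[of Y i] lower_left_zero2[of Y i]
    by (simp add: comm_add comm_swap[of _ Y] comm_top_rows)
  ultimately show ?thesis using that top_rows_in by blast
qed

text \<open>The first two rows of the bracket are made into the unit vectors at k and l; on the
  columns k, l, j the minor then reduces to the entry (i, j).\<close>

lemma commute_S: assumes T: "T \<in> V" shows "comm T S $ emb i $ emb j = 0"
proof -
  obtain k where k: "k \<noteq> j" "k \<noteq> j" by (rule avoid_two)
  obtain l where l: "l \<noteq> j" "l \<noteq> k" by (rule avoid_two)
  obtain X where X: "X \<in> V" "\<And>q. comm (T + X) S $ 1 $ emb q = axis k 1 $ q" "\<And>q. comm (T + X) S $ 2 $ emb q = axis l 1 $ q"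
    "\<And>Y i l. Y \<in> V \<Longrightarrow> comm (T + X) Y $ emb i $ emb l = comm T Y $ emb i $ emb l"
    by (rule adjust_rows[OF T]) blast
  have "T + X \<in> V" using T X(1) sub by (intro cmat.subspace_add)
  then have "minor3 (comm (T + X) S) 1 2 (emb i) (emb k) (emb l) (emb j) = 0" using S by (rule minor)
  then show ?thesis using k l by (simp add: minor3_def X S axis_def)
qed

text \<open>Bracketing with S + s T' keeps the two unit vectors up to terms of order s, while by
  \<open>commute_S\<close> the third row is s times that of the bracket with T'. Dividing the minor
  by s and letting s tend to 0 isolates the entry.\<close>

lemma commute: assumes T: "T \<in> V" and T': "T' \<in> V" shows "comm T T' $ emb i $ emb j = 0"
proof -
  obtain k where k: "k \<noteq> j" "k \<noteq> j" by (rule avoid_two)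
  obtain l where l: "l \<noteq> j" "l \<noteq> k" by (rule avoid_two)
  obtain X where X: "X \<in> V" "\<And>q. comm (T + X) S $ 1 $ emb q = axis k 1 $ q" "\<And>q. comm (T + X) S $ 2 $ emb q = axis l 1 $ q"
    "\<And>Y i l. Y \<in> V \<Longrightarrow> comm (T + X) Y $ emb i $ emb l = comm T Y $ emb i $ emb l"
    by (rule adjust_rows[OF T]) blast
  have TX: "T + X \<in> V" using T X(1) sub by (intro cmat.subspace_add)
  let ?B = "comm (T + X) T'"
  define r1 where "r1 s q = axis k 1 $ q + s * ?B $ 1 $ emb q" for s q
  define r2 where "r2 s q = axis l 1 $ q + s * ?B $ 2 $ emb q" for s q
  define r3 where "r3 q = ?B $ emb i $ emb q" for q
  define F where "F s = r1 s k * (r2 s l * r3 j - r2 s j * r3 l)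
     - r1 s l * (r2 s k * r3 j - r2 s j * r3 k) + r1 s j * (r2 s k * r3 l - r2 s l * r3 k)" for s
  have "F s = 0" if s: "s \<noteq> 0" for s
  proof -
    have "minor3 (comm (T + X) (S + mat_scale s T')) 1 2 (emb i) (emb k) (emb l) (emb j) = 0"
      by (rule minor[OF TX S_add[OF T']])
    moreover have "comm (T + X) (S + mat_scale s T') = comm (T + X) S + mat_scale s ?B"
      by (simp add: comm_add(2) comm_scale(2))
    moreover have "comm (T + X) S $ emb i $ emb q = 0" for q
      using X(4)[OF S] commute_S[OF T] by simp
    ultimately have "s * F s = 0"
      by (simp add: minor3_def X F_def r1_def r2_def r3_def algebra_simps)
    then show ?thesis using s by simp
  qed
  moreover have "isCont F 0"
    unfolding F_def[abs_def] r1_def r2_def by (intro continuous_intros)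
  ultimately have "F 0 = 0" by (intro eq_zero_at_0_by_continuity[of F])
  then have "r3 j = 0" using k l by (simp add: F_def r1_def r2_def axis_def)
  then show ?thesis using X(4)[OF T'] by (simp add: r3_def)
qed

lemma lower_block_mult: assumes "T \<in> V" shows "lower_block (T ** T') = lower_block T ** lower_block T'"
  by (simp add: vec_eq_iff lower_block_def matrix_matrix_mult_def sum_6_split lower_left_zero1[OF assms] lower_left_zero2[OF assms])

lemma lower_block_commute: assumes "T \<in> V" "T' \<in> V" shows "lower_block T ** lower_block T' = lower_block T' ** lower_block T"
proof -
  have "lower_block (T ** T') = lower_block (T' ** T)"
    using commute[OF assms] by (simp add: vec_eq_iff lower_block_def comm_def)
  then show ?thesis using assms by (simp add: lower_block_mult)
qed

lemma lower_block_add: "lower_block (X + Y) = lower_block X + lower_block Y" and lower_block_scale: "lower_block (mat_scale c X) *v v = c *s (lower_block X *v v)"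
  by (simp_all add: vec_eq_iff lower_block_def matrix_vector_mult_def sum_distrib_left mult_ac)

lemma lower_block_zero_span: "{T\<in>V. lower_block T = 0} \<subseteq> cmat.span ((\<lambda>j. unit_mat 1 j) ` UNIV \<union> (\<lambda>j. unit_mat 2 j) ` UNIV)"
proof
  fix T assume "T \<in> {T\<in>V. lower_block T = 0}"
  then have T: "T \<in> V" "\<And>i j. T $ emb i $ emb j = 0" by (auto simp: lower_block_def vec_eq_iff)
  have "T = (\<Sum>j\<in>UNIV. mat_scale (T$1$j) (unit_mat 1 j) + mat_scale (T$2$j) (unit_mat 2 j))"
  proof -
    have "T $ p $ q = (\<Sum>j\<in>UNIV. mat_scale (T$1$j) (unit_mat 1 j) + mat_scale (T$2$j) (unit_mat 2 j)) $ p $ q" for p q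
    proof (cases p rule: cases_6)
      case 1 then show ?thesis by (simp add: unit_mat_nth if_distrib[of "\<lambda>c. _ * c"] cong: if_cong)
    next
      case 2 then show ?thesis by (simp add: unit_mat_nth if_distrib[of "\<lambda>c. _ * c"] cong: if_cong)
    next
      case (3 k)
      then show ?thesis using T(2) lower_left_zero1[OF T(1)] lower_left_zero2[OF T(1)]
        by (cases q rule: cases_6) (simp_all add: unit_mat_nth)
    qed
    then show ?thesis unfolding vec_eq_iff by blast
  qed
  moreover have "(\<Sum>j\<in>UNIV. mat_scale (T$1$j) (unit_mat 1 j) + mat_scale (T$2$j) (unit_mat 2 j)) \<in> cmat.span ((\<lambda>j. unit_mat 1 j) ` UNIV \<union> (\<lambda>j. unit_mat 2 j) ` UNIV)"
    by (intro cmat.span_sum cmat.span_add cmat.span_scale cmat.span_base) auto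
  ultimately show "T \<in> cmat.span ((\<lambda>j. unit_mat 1 j) ` UNIV \<union> (\<lambda>j. unit_mat 2 j) ` UNIV)" by simp
qed

lemma card_top_units: "card ((\<lambda>j::6. unit_mat (1::6) j) ` UNIV \<union> (\<lambda>j. unit_mat 2 j) ` UNIV) \<le> 12"
proof -
  have "card ((\<lambda>j::6. unit_mat (i::6) j) ` UNIV) \<le> 6" for i using card_image_le[of "UNIV :: 6 set" "unit_mat i"] by simp
  from this[of 1] this[of 2] show ?thesis
    using card_Un_le[of "(\<lambda>j::6. unit_mat (1::6) j) ` UNIV" "(\<lambda>j. unit_mat 2 j) ` UNIV"] by linarith
qed

text \<open>Evaluate the commuting lower right blocks at \<open>v\<close>. The image
  \<open>W\<close> contains v, f1 and f2, so it has dimension at least 3 by \<open>nondeg\<close>. A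
  block that vanishes at \<open>v\<close> vanishes on \<open>W\<close> by commutativity; if
  \<open>W\<close> were everything, \<open>V\<close> would have dimension at most 4 + 12 = 16. So
  \<open>W\<close> is the kernel of a form \<open>f\<close>, the blocks vanishing at
  \<open>v\<close> have the shape x -> f(x) u, and at least 17 - 3 - 12 = 2 independent vectors u
  occur.\<close>

lemma evaluation_kernel:
  assumes v'f: "f1 \<in> (\<lambda>T. lower_block T *v v) ` V" "f2 \<in> (\<lambda>T. lower_block T *v v) ` V"
    and nondeg: "\<forall>f. dot f v = 0 \<longrightarrow> dot f v' = 0 \<longrightarrow> dot f f1 = 0 \<longrightarrow> dot f f2 = 0 \<longrightarrow> f = 0"
  obtains f z u1 u2 T1 T2 where "\<And>T. T \<in> V \<Longrightarrow> dot f (lower_block T *v v) = 0" "dot f z = 1"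
    "T1 \<in> V" "T2 \<in> V" "\<And>x. lower_block T1 *v x = dot f x *s u1" "\<And>x. lower_block T2 *v x = dot f x *s u2"
    "\<And>a b. a *s u1 + b *s u2 = 0 \<Longrightarrow> a = 0 \<and> b = 0"
proof -
  have dim4: "vec.dim (UNIV :: (complex ^ 4) set) = 4" by (simp add: card_cart_basis)
  note vec.dim_UNIV [simp del]
  define ev where "ev T = lower_block T *v v" for T
  define W where "W = ev ` V"
  have ev_add: "ev (X + Y) = ev X + ev Y" for X Y by (simp add: ev_def lower_block_add matrix_vector_mult_add_rdistrib)
  have ev_scale: "ev (mat_scale c X) = c *s ev X" for c X by (simp add: ev_def lower_block_scale)
  have vW: "v \<in> W"
  proof -
    have "lower_block (mat 1) = mat 1" by (simp add: lower_block_def vec_eq_iff mat_def)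
    then show ?thesis unfolding W_def using one by (auto simp: ev_def intro!: image_eqI[of _ _ "mat 1"])
  qed
  have sW: "vec.subspace W"
  proof (rule vec.subspaceI)
    have "mat_scale 0 (mat 1) = (0 :: complex ^ 6 ^ 6)" by (simp add: vec_eq_iff)
    then have "ev 0 = 0" using ev_scale[of 0 "mat 1"] by simp
    then show "0 \<in> W" unfolding W_def using cmat.subspace_0[OF sub] by (metis image_eqI)
    show "x + y \<in> W" if "x \<in> W" "y \<in> W" for x y
      using that ev_add cmat.subspace_add[OF sub] unfolding W_def by (auto intro!: image_eqI[of _ _ "_ + _"])
    show "c *s x \<in> W" if "x \<in> W" for c x
      using that ev_scale cmat.subspace_scale[OF sub] unfolding W_def by (auto intro!: image_eqI[of _ _ "mat_scale _ _"])
  qed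
  obtain B where B: "B \<subseteq> W" "vec.independent B" "W \<subseteq> vec.span B" "card B = vec.dim W" by (rule vec.basis_exists)
  have fB: "finite B" using B(2) by (rule vec.finiteI_independent)
  have kill: "dot f x = 0" if "\<forall>b\<in>B. dot f b = 0" "x \<in> W" for f x
  proof -
    have "vec.subspace {x. dot f x = 0}" by (rule vec.subspaceI) (auto simp: dot_add dot_scale dot_zero)
    then have "vec.span B \<subseteq> {x. dot f x = 0}" by (intro vec.span_minimal) (use that in auto)
    then show ?thesis using B(3) that(2) by blast
  qed
  have ge3: "vec.dim W \<ge> 3"
  proof (rule ccontr)
    assume "\<not> ?thesis"
    then have "card (insert v' B) < CARD(4)" using B(4) fB by (simp add: card_insert_if)
    then obtain f where f: "f \<noteq> 0" "\<forall>x\<in>insert v' B. dot f x = 0"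
      using orthogonal_exists[of "insert v' B"] fB by auto
    have "dot f v' = 0" "\<forall>b\<in>B. dot f b = 0" using f(2) by auto
    moreover have "f1 \<in> W" "f2 \<in> W" using v'f by (auto simp: W_def ev_def)
    ultimately have "f = 0" using kill[of f] vW by (intro nondeg[rule_format]) auto
    then show False using f(1) by simp
  qed
  define V0 where "V0 = {T\<in>V. ev T = 0}"
  have kerW: "lower_block T *v x = 0" if "T \<in> V0" "x \<in> W" for T x
  proof -
    obtain R where R: "R \<in> V" "x = lower_block R *v v" using \<open>x \<in> W\<close> by (auto simp: W_def ev_def)
    have T: "T \<in> V" "lower_block T *v v = 0" using that(1) by (auto simp: V0_def ev_def)
    have "lower_block T *v x = lower_block R *v (lower_block T *v v)"
      unfolding R(2) matrix_vector_mul_assoc lower_block_commute[OF T(1) R(1)] ..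
    then show ?thesis using T(2) by simp
  qed
  have sV0: "cmat.subspace V0"
    unfolding V0_def
  proof (rule cmat.subspaceI)
    have "mat_scale 0 (mat 1) = (0 :: complex ^ 6 ^ 6)" by (simp add: vec_eq_iff)
    then have "ev 0 = 0" using ev_scale[of 0 "mat 1"] by simp
    then show "0 \<in> {T\<in>V. ev T = 0}" using cmat.subspace_0[OF sub] by simp
  qed (use sub in \<open>auto simp: ev_add ev_scale intro: cmat.subspace_add cmat.subspace_scale\<close>)
  let ?unit_mat = "(\<lambda>j. unit_mat 1 j) ` UNIV \<union> (\<lambda>j. unit_mat 2 j) ` UNIV :: (complex ^ 6 ^ 6) set"
  have le3: "vec.dim W \<le> 3"
  proof (rule ccontr)
    assume "\<not> ?thesis"
    then have "vec.dim W = vec.dim (UNIV :: (complex ^ 4) set)"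
      using vec.dim_subset[of W UNIV] dim4 by simp
    then have WU: "W = UNIV" using sW vec.subspace_dim_equal[of W UNIV] by simp
    have "V0 \<subseteq> {T\<in>V. lower_block T = 0}"
    proof
      fix T assume T: "T \<in> V0"
      then have "lower_block T *v x = 0" for x using kerW WU by blast
      then have "lower_block T = 0" by (metis matrix_eq matrix_vector_mult_0)
      then show "T \<in> {T\<in>V. lower_block T = 0}" using T by (simp add: V0_def)
    qed
    then have "{T\<in>V. ev T = 0} \<subseteq> cmat.span ?unit_mat" using lower_block_zero_span unfolding V0_def by blast
    then have "cmat.dim V \<le> vec.dim (ev ` V) + card ?unit_mat"
      by (intro dim_kernel_image sub ev_add ev_scale) auto
    moreover have "vec.dim (ev ` V) \<le> 4" using vec.dim_subset[of "ev ` V" UNIV] dim4 by simp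
    ultimately show False using dim card_top_units by linarith
  qed
  then have "card B < CARD(4)" using B(4) by simp
  then obtain f where f: "f \<noteq> 0" "\<forall>x\<in>B. dot f x = 0" using orthogonal_exists[of B] fB by auto
  have fW: "dot f x = 0" if "x \<in> W" for x using kill[OF f(2) that] .
  obtain z where z: "dot f z = 1"
  proof -
    obtain i where i: "f$i \<noteq> 0" using f(1) by (auto simp: vec_eq_iff)
    have "dot f (axis i (1 / f$i)) = 1" using i by (simp add: dot_def axis_def if_distrib[of "\<lambda>x. _ * x"] cong: if_cong)
    then show ?thesis using that by blast
  qed
  have Wker: "x \<in> W" if "dot f x = 0" for x
  proof (rule ccontr)
    assume x: "x \<notin> W"
    have "x \<notin> vec.span W" using x sW vec.span_minimal[OF subset_refl sW] by blast
    then have "vec.dim (insert x W) = 4" using ge3 le3 by (simp add: vec.dim_insert)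
    then have "vec.dim (vec.span (insert x W)) = vec.dim (UNIV :: (complex ^ 4) set)" using dim4 by simp
    then have "vec.span (insert x W) = UNIV"
      by (intro vec.subspace_dim_equal) auto
    moreover have "vec.span (insert x W) \<subseteq> {y. dot f y = 0}"
    proof (rule vec.span_minimal)
      show "vec.subspace {y. dot f y = 0}" by (rule vec.subspaceI) (auto simp: dot_add dot_scale dot_zero)
      show "insert x W \<subseteq> {y. dot f y = 0}" using that fW by auto
    qed
    ultimately have "z \<in> {y. dot f y = 0}" by blast
    then show False using z by simp
  qed
  have rank1: "lower_block T *v x = dot f x *s (lower_block T *v z)" if "T \<in> V0" for T x
  proof -
    have "x - dot f x *s z \<in> W" by (rule Wker) (simp add: dot_diff dot_scale z)
    then have "lower_block T *v (x - dot f x *s z) = 0" using kerW that by blast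
    then show ?thesis by (simp add: matrix_vector_mult_diff_distrib vector_scalar_commute)
  qed
  define ez where "ez T = lower_block T *v z" for T
  have ez_add: "ez (X + Y) = ez X + ez Y" for X Y by (simp add: ez_def lower_block_add matrix_vector_mult_add_rdistrib)
  have ez_scale: "ez (mat_scale c X) = c *s ez X" for c X by (simp add: ez_def lower_block_scale)
  obtain B0 where B0: "B0 \<subseteq> V0" "V0 \<subseteq> cmat.span B0" "finite B0" "card B0 = cmat.dim V0"
    by (rule finite_basis[OF sV0])
  have "cmat.dim V \<le> vec.dim (ev ` V) + card B0"
    using B0 unfolding V0_def by (intro dim_kernel_image sub ev_add ev_scale) auto
  then have d14: "cmat.dim V0 \<ge> 14" using dim le3 B0(4) unfolding W_def by linarith
  have "{T\<in>V0. ez T = 0} \<subseteq> {T\<in>V. lower_block T = 0}"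
  proof
    fix T assume T: "T \<in> {T\<in>V0. ez T = 0}"
    then have "T \<in> V0" "lower_block T *v z = 0" by (auto simp: ez_def)
    then have "lower_block T *v x = 0" for x using rank1[of T x] by (metis vec.scale_zero_right)
    then have "lower_block T = 0" by (metis matrix_eq matrix_vector_mult_0)
    then show "T \<in> {T\<in>V. lower_block T = 0}" using T by (simp add: V0_def)
  qed
  then have "{T\<in>V0. ez T = 0} \<subseteq> cmat.span ?unit_mat" using lower_block_zero_span by blast
  then have "cmat.dim V0 \<le> vec.dim (ez ` V0) + card ?unit_mat"
    by (intro dim_kernel_image sV0 ez_add ez_scale) auto
  then have d2: "vec.dim (ez ` V0) \<ge> 2" using d14 card_top_units by linarith
  obtain C where C: "C \<subseteq> ez ` V0" "vec.independent C" "card C = vec.dim (ez ` V0)" by (rule vec.basis_exists) blast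
  have fC: "finite C" using C(2) by (rule vec.finiteI_independent)
  have C2: "card C \<ge> 2" using C(3) d2 by simp
  then have "C \<noteq> {}" by auto
  then obtain u1 where u1: "u1 \<in> C" by blast
  have "card (C - {u1}) \<ge> 1" using C2 u1 fC by simp
  then have "C - {u1} \<noteq> {}" by (metis card.empty not_one_le_zero)
  then obtain u2 where u2: "u2 \<in> C" "u2 \<noteq> u1" by blast
  have ind: "vec.independent {u1, u2}" using C(2) by (rule vec.independent_mono) (use u1 u2 in auto)
  have lin: "a = 0 \<and> b = 0" if ab: "a *s u1 + b *s u2 = 0" for a b
  proof -
    define r where "r x = (if x = u1 then a else b)" for x
    have s: "(\<Sum>x\<in>{u1, u2}. r x *s x) = 0" using ab u2(2) by (simp add: r_def)
    have "r x = 0" if "x \<in> {u1, u2}" for x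
      using vec.independentD[OF ind _ _ s that] by simp
    from this[of u1] this[of u2] show ?thesis using u2(2) by (simp add: r_def)
  qed
  obtain T1 where T1: "T1 \<in> V0" "u1 = ez T1" using C(1) u1 by blast
  obtain T2 where T2: "T2 \<in> V0" "u2 = ez T2" using C(1) u2 by blast
  show ?thesis
  proof (rule that[of f z T1 T2 u1 u2])
    show "dot f (lower_block T *v v) = 0" if "T \<in> V" for T using fW that by (auto simp: W_def ev_def)
    show "lower_block T1 *v x = dot f x *s u1" for x unfolding T1(2) ez_def by (rule rank1[OF T1(1)])
    show "lower_block T2 *v x = dot f x *s u2" for x unfolding T2(2) ez_def by (rule rank1[OF T2(1)])
    show "T1 \<in> V" "T2 \<in> V" using T1 T2 by (auto simp: V0_def)
  qed (use z lin in auto)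
qed

end

text \<open>The values at 1 and 2 are defaults; definitions that use \<open>emb_inv\<close> treat
  these indices separately.\<close>

definition emb_inv :: "6 \<Rightarrow> 4" where
  "emb_inv i = (if i = 3 then 1 else if i = 4 then 2 else if i = 5 then 3 else 4)"

lemma emb_inv_emb [simp]: "emb_inv (emb k) = k"
  using exhaust_4[of k] by (auto simp: emb_inv_def)

definition extend_block :: "complex ^ 4 ^ 4 \<Rightarrow> complex ^ 6 ^ 6" where
  "extend_block R = (\<chi> i j. if i \<in> {1, 2} \<or> j \<in> {1, 2} then (if i = j then 1 else 0) else R $ emb_inv i $ emb_inv j)"

lemma extend_block_nth [simp]: "extend_block R $ emb i $ emb j = R $ i $ j" "extend_block R $ emb i $ 1 = 0" "extend_block R $ emb i $ 2 = 0"
  "extend_block R $ 1 $ q = (if q = 1 then 1 else 0)" "extend_block R $ 2 $ q = (if q = 2 then 1 else 0)"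
  by (auto simp: extend_block_def)

lemma extend_block_mult: "extend_block R ** extend_block R' = extend_block (R ** R')"
proof -
  have "(extend_block R ** extend_block R') $ i $ j = extend_block (R ** R') $ i $ j" for i j
    by (cases i rule: cases_6; cases j rule: cases_6) (simp_all add: matrix_matrix_mult_def sum_6_split)
  then show ?thesis by (simp add: vec_eq_iff)
qed

lemma extend_block_one: "extend_block (mat 1) = mat 1"
proof -
  have "extend_block (mat 1) $ i $ j = (mat 1 :: complex ^ 6 ^ 6) $ i $ j" for i j
    by (cases i rule: cases_6; cases j rule: cases_6) (simp_all add: mat_def)
  then show ?thesis by (simp add: vec_eq_iff)
qed

lemma lower_block_mat1: "lower_block (mat 1) = mat 1" by (simp add: lower_block_def vec_eq_iff mat_def)

context lift
begin

text \<open>Evaluation at \<open>v\<close> and \<open>v'\<close> gives forms f and g and blocks of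
  the shapes x -> f(x) u and x -> g(x) w. Commutation puts u1 and u2 into the common kernel of f and
  g, of which they form a basis. Every block X acts on this plane by a scalar and multiplies f and g
  by scalars; all agree because w1 lies in the plane too. Hence X minus a scalar maps everything
  into the plane and kills the plane.\<close>

lemma to_calA:
  assumes f12: "f1 \<in> (\<lambda>T. lower_block T *v v) ` V" "f2 \<in> (\<lambda>T. lower_block T *v v) ` V"
    and nd: "\<forall>f. dot f v = 0 \<longrightarrow> dot f v' = 0 \<longrightarrow> dot f f1 = 0 \<longrightarrow> dot f f2 = 0 \<longrightarrow> f = 0"
    and g12: "g1 \<in> (\<lambda>T. lower_block T *v v') ` V" "g2 \<in> (\<lambda>T. lower_block T *v v') ` V"
    and nd': "\<forall>f. dot f v' = 0 \<longrightarrow> dot f v = 0 \<longrightarrow> dot f g1 = 0 \<longrightarrow> dot f g2 = 0 \<longrightarrow> f = 0"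
  shows "\<exists>P Q. P ** Q = mat 1 \<and> Q ** P = mat 1 \<and> (\<forall>T\<in>V. Q ** T ** P \<in> calA)"
proof -
  obtain f z u1 u2 T1 T2 where f: "\<And>T. T \<in> V \<Longrightarrow> dot f (lower_block T *v v) = 0" "dot f z = 1"
    and T: "T1 \<in> V" "T2 \<in> V" "\<And>x. lower_block T1 *v x = dot f x *s u1" "\<And>x. lower_block T2 *v x = dot f x *s u2"
    and u: "\<And>a b. a *s u1 + b *s u2 = 0 \<Longrightarrow> a = 0 \<and> b = 0"
    by (rule evaluation_kernel[OF f12 nd]) blast+
  obtain g y w1 w2 R1 R2 where g: "\<And>T. T \<in> V \<Longrightarrow> dot g (lower_block T *v v') = 0" "dot g y = 1"
    and R: "R1 \<in> V" "R2 \<in> V" "\<And>x. lower_block R1 *v x = dot g x *s w1" "\<And>x. lower_block R2 *v x = dot g x *s w2"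
    and w: "\<And>a b. a *s w1 + b *s w2 = 0 \<Longrightarrow> a = 0 \<and> b = 0"
    by (rule evaluation_kernel[OF g12 nd']) blast+
  have fv: "dot f v = 0" and gv: "dot g v' = 0" using f(1)[OF one] g(1)[OF one] by (simp_all add: lower_block_mat1)
  have ff: "dot f f1 = 0" "dot f f2 = 0" using f12 f(1) by auto
  have gg: "dot g g1 = 0" "dot g g2 = 0" using g12 g(1) by auto
  have "\<exists>x. dot f x = 0 \<and> dot g x \<noteq> 0"
  proof (rule ccontr)
    assume "\<not> ?thesis"
    then have "g = 0" using fv ff gv by (intro nd[rule_format]) auto
    then show False using g(2) by (simp add: dot_def)
  qed
  then obtain x2 where x2: "dot f x2 = 0" "dot g x2 \<noteq> 0" by blast
  have "\<exists>x. dot g x = 0 \<and> dot f x \<noteq> 0"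
  proof (rule ccontr)
    assume "\<not> ?thesis"
    then have "f = 0" using gv gg fv by (intro nd'[rule_format]) auto
    then show False using f(2) by (simp add: dot_def)
  qed
  then obtain x1 where x1: "dot g x1 = 0" "dot f x1 \<noteq> 0" by blast
  define z1 where "z1 = (1 / dot f x1) *s x1"
  define z2 where "z2 = (1 / dot g x2) *s x2"
  have fz: "dot f z1 = 1" "dot f z2 = 0" and gz: "dot g z1 = 0" "dot g z2 = 1"
    using x1 x2 by (simp_all add: z1_def z2_def dot_scale)
  have u_ne: "u1 \<noteq> 0" "u2 \<noteq> 0" using u[of 1 0] u[of 0 1] by auto
  have w_ne: "w1 \<noteq> 0" "w2 \<noteq> 0" using w[of 1 0] w[of 0 1] by auto
  have cm: "lower_block X *v (lower_block Y *v x) = lower_block Y *v (lower_block X *v x)" if "X \<in> V" "Y \<in> V" for X Y x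
    by (simp only: matrix_vector_mul_assoc lower_block_commute[OF that])
  \<comment> \<open>The two products of T1 and T2, evaluated at z, give f(u2) u1 = f(u1) u2;
    independence makes both coefficients vanish.\<close>
  have fu: "dot f u1 = 0 \<and> dot f u2 = 0"
  proof -
    have "dot f u2 *s u1 = dot f u1 *s u2"
      using cm[OF T(1,2), of z] by (simp add: T(3,4) f(2) dot_scale)
    then have "dot f u2 *s u1 + (- dot f u1) *s u2 = 0" by simp
    then show ?thesis using u by fastforce
  qed
  have gw: "dot g w1 = 0 \<and> dot g w2 = 0"
  proof -
    have "dot g w2 *s w1 = dot g w1 *s w2"
      using cm[OF R(1,2), of y] by (simp add: R(3,4) g(2) dot_scale)
    then have "dot g w2 *s w1 + (- dot g w1) *s w2 = 0" by simp
    then show ?thesis using w by fastforce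
  qed
  have fw: "dot f w1 = 0"
    using cm[OF T(1) R(1), of z2] by (simp add: T(3) R(3) fz gz dot_scale u_ne)
  have gu: "dot g u1 = 0" "dot g u2 = 0"
    using cm[OF T(1) R(1), of z1] cm[OF T(2) R(1), of z1] by (simp_all add: T(3,4) R(3) fz gz dot_scale w_ne)
  \<comment> \<open>In the basis u1, u2, z1, z2 the third and fourth coordinates are the values of f
    and g, because z1 and z2 are dual to these forms.\<close>
  define B :: "complex ^ 4 ^ 4" where "B = (\<chi> i j. if j = 1 then u1$i else if j = 2 then u2$i else if j = 3 then z1$i else z2$i)"
  have B_mv: "B *v c = c$1 *s u1 + c$2 *s u2 + c$3 *s z1 + c$4 *s z2" for c
    by (simp add: vec_eq_iff matrix_vector_mult_def sum_4 B_def mult.commute)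
  have fB: "dot f (B *v c) = c$3" and gB: "dot g (B *v c) = c$4" for c
    by (simp_all add: B_mv dot_add dot_scale fu gu fz gz)
  have "c = 0" if "B *v c = 0" for c
  proof -
    have "c$3 = 0" "c$4 = 0" using fB[of c] gB[of c] that by (simp_all add: dot_zero)
    moreover from this have "c$1 *s u1 + c$2 *s u2 = 0" using that by (simp add: B_mv)
    then have "c$1 = 0 \<and> c$2 = 0" by (rule u)
    ultimately show ?thesis by (simp add: vec_eq_iff forall_4)
  qed
  then obtain B' where B'B: "B' ** B = mat 1" using matrix_left_invertible_ker[of B] by blast
  then have BB': "B ** B' = mat 1" by (simp add: matrix_left_right_inverse)
  have coord: "\<exists>c. x = B *v c" for x
    using BB' by (metis matrix_vector_mul_assoc matrix_vector_mul_lid)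
  have in_span: "\<exists>a b. x = a *s u1 + b *s u2" if "dot f x = 0" "dot g x = 0" for x
  proof -
    obtain c where c: "x = B *v c" using coord by blast
    then have "c$3 = 0" "c$4 = 0" using that fB gB by auto
    then show ?thesis using c by (auto simp: B_mv)
  qed
  have scal: "\<exists>\<mu>. lower_block X *v u1 = \<mu> *s u1 \<and> lower_block X *v u2 = \<mu> *s u2 \<and>
      (\<exists>a b. lower_block X *v z1 = \<mu> *s z1 + (a *s u1 + b *s u2)) \<and> (\<exists>a b. lower_block X *v z2 = \<mu> *s z2 + (a *s u1 + b *s u2))"
    if X: "X \<in> V" for X
  proof -
    define \<mu> where "\<mu> = dot f (lower_block X *v z)"
    define \<nu> where "\<nu> = dot g (lower_block X *v y)"
    have Xu: "lower_block X *v u1 = \<mu> *s u1" "lower_block X *v u2 = \<mu> *s u2"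
      using cm[OF X T(1), of z] cm[OF X T(2), of z] by (simp_all add: T(3,4) f(2) vector_scalar_commute \<mu>_def)
    have Xw: "lower_block X *v w1 = \<nu> *s w1"
      using cm[OF X R(1), of y] by (simp add: R(3) g(2) vector_scalar_commute \<nu>_def)
    have fX: "dot f (lower_block X *v x) = \<mu> * dot f x" for x
    proof -
      have "dot f x *s (\<mu> *s u1) = dot f (lower_block X *v x) *s u1"
        using cm[OF X T(1), of x] by (simp add: T(3) vector_scalar_commute Xu)
      then have "(dot f x * \<mu>) *s u1 = dot f (lower_block X *v x) *s u1" by simp
      then have "(dot f x * \<mu> - dot f (lower_block X *v x)) *s u1 = 0" by (simp add: vec.scale_left_diff_distrib)
      then show ?thesis using u_ne by (simp add: mult.commute)
    qed
    have gX: "dot g (lower_block X *v x) = \<nu> * dot g x" for x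
    proof -
      have "dot g x *s (\<nu> *s w1) = dot g (lower_block X *v x) *s w1"
        using cm[OF X R(1), of x] by (simp add: R(3) vector_scalar_commute Xw)
      then have "(dot g x * \<nu>) *s w1 = dot g (lower_block X *v x) *s w1" by simp
      then have "(dot g x * \<nu> - dot g (lower_block X *v x)) *s w1 = 0" by (simp add: vec.scale_left_diff_distrib)
      then show ?thesis using w_ne by (simp add: mult.commute)
    qed
    obtain a b where ab: "w1 = a *s u1 + b *s u2" using in_span fw gw by blast
    then have "lower_block X *v w1 = \<mu> *s w1" by (simp add: matrix_vector_right_distrib vector_scalar_commute Xu mult.commute)
    then have "\<nu> = \<mu> \<or> w1 = 0" using Xw by simp
    then have \<mu>\<nu>: "\<mu> = \<nu>" using w_ne by simp
    have "\<exists>a b. lower_block X *v x - \<mu> *s x = a *s u1 + b *s u2" for x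
      by (rule in_span) (simp_all add: dot_diff dot_scale fX gX \<mu>\<nu>)
    then have "\<exists>a b. lower_block X *v x = \<mu> *s x + (a *s u1 + b *s u2)" for x
      by (metis add.commute diff_add_cancel)
    then show ?thesis using Xu by blast
  qed
  have PQ: "extend_block B ** extend_block B' = mat 1" "extend_block B' ** extend_block B = mat 1"
    by (simp_all add: extend_block_mult BB' B'B extend_block_one)
  have "extend_block B' ** X ** extend_block B \<in> calA" if X: "X \<in> V" for X
  proof -
    let ?M = "extend_block B' ** X ** extend_block B"
    obtain \<mu> a b c d where s: "lower_block X *v u1 = \<mu> *s u1" "lower_block X *v u2 = \<mu> *s u2"
      "lower_block X *v z1 = \<mu> *s z1 + (a *s u1 + b *s u2)" "lower_block X *v z2 = \<mu> *s z2 + (c *s u1 + d *s u2)"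
      using scal[OF X] by blast
    note low = lower_left_zero1[OF X] lower_left_zero2[OF X]
    have z: "?M $ emb i $ 1 = 0" "?M $ emb i $ 2 = 0" for i
      by (simp_all add: matrix_matrix_mult_def sum_6_split low)
    have M: "?M $ emb i $ emb j = (B' *v (lower_block X *v column j B)) $ i" for i j
    proof -
      have "(extend_block B' ** X) $ emb i $ emb k = (B' ** lower_block X) $ i $ k" for k
        by (simp add: matrix_matrix_mult_def sum_6_split lower_block_def low)
      moreover have "(extend_block B' ** X) $ emb i $ 1 = 0" "(extend_block B' ** X) $ emb i $ 2 = 0"
        by (simp_all add: matrix_matrix_mult_def sum_6_split low)
      ultimately have "?M $ emb i $ emb j = (B' ** lower_block X ** B) $ i $ j"
        by (simp add: matrix_matrix_mult_def[of "extend_block B' ** X"] matrix_matrix_mult_def[of "B' ** lower_block X"] sum_6_split)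
      also have "\<dots> = ((B' ** lower_block X) *v column j B) $ i"
        by (simp add: matrix_matrix_mult_def[of "B' ** lower_block X"] matrix_vector_mult_def column_def)
      finally show ?thesis by (simp add: matrix_vector_mul_assoc)
    qed
    have col: "column 1 B = u1" "column 2 B = u2" "column 3 B = z1" "column 4 B = z2"
      by (simp_all add: column_def B_def vec_eq_iff)
    have e: "B' *v u1 = axis 1 1" "B' *v u2 = axis 2 1" "B' *v z1 = axis 3 1" "B' *v z2 = axis 4 1"
    proof -
      have "B' *v (B *v axis j 1) = axis j 1" for j by (simp add: matrix_vector_mul_assoc B'B)
      moreover have "B *v axis j 1 = column j B" for j 
        by (simp add: vec_eq_iff matrix_vector_mult_def column_def axis_def if_distrib[of "\<lambda>c. _ * c"] cong: if_cong)
      ultimately have "B' *v column j B = axis j 1" for j by metis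
      from this[of 1] this[of 2] this[of 3] this[of 4] show "B' *v u1 = axis 1 1" "B' *v u2 = axis 2 1" "B' *v z1 = axis 3 1" "B' *v z2 = axis 4 1"
        by (simp_all add: col)
    qed
    have M1: "?M $ emb i $ emb 1 = \<mu> * axis 1 1 $ i" and M2: "?M $ emb i $ emb 2 = \<mu> * axis 2 1 $ i"
      and M3: "?M $ emb i $ emb 3 = \<mu> * axis 3 1 $ i + (a * axis 1 1 $ i + b * axis 2 1 $ i)"
      and M4: "?M $ emb i $ emb 4 = \<mu> * axis 4 1 $ i + (c * axis 1 1 $ i + d * axis 2 1 $ i)" for i
      unfolding M col s by (simp_all add: matrix_vector_right_distrib vector_scalar_commute e)
    show ?thesis
    proof (rule calA_I[where l = \<mu>])
      show "?M $ emb i $ emb j = 0" if "i \<in> {3, 4}" "j \<in> {1, 2}" for i j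
        using that M1[of i] M2[of i] by (auto simp: axis_def)
      show "?M $ emb 1 $ emb 2 = 0" "?M $ emb 2 $ emb 1 = 0" "?M $ emb 3 $ emb 4 = 0" "?M $ emb 4 $ emb 3 = 0"
        using M1[of 2] M2[of 1] M3[of 4] M4[of 3] by (simp_all add: axis_def)
      show "?M $ emb i $ emb i = \<mu>" for i
        using exhaust_4[of i] M1[of 1] M2[of 2] M3[of 3] M4[of 4] by (auto simp: axis_def)
    qed (rule z)+
  qed
  then show ?thesis using PQ by blast
qed

end

text \<open>Back substitution: a family that is triangular on the positions \<open>K\<close> becomes
  diagonal on them by subtracting the matrices already found for smaller \<kappa>. Entries outside
  \<open>K\<close> remain uncontrolled.\<close>

lemma dual_basis:
  fixes \<kappa> :: "'n::finite \<Rightarrow> 'm::finite \<Rightarrow> real" and L :: "(complex ^ 'm ^ 'n) set"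
  assumes sub: "cmat.subspace L" and inj: "\<And>i j p q. \<kappa> i j = \<kappa> p q \<Longrightarrow> i = p \<and> j = q"
    and tri: "\<forall>(p, q)\<in>K. \<exists>Z\<in>L. Z$p$q \<noteq> 0 \<and> (\<forall>(a, b)\<in>K. \<kappa> a b > \<kappa> p q \<longrightarrow> Z$a$b = 0)"
    and pq: "(p, q) \<in> K"
  shows "\<exists>Z\<in>L. Z$p$q = 1 \<and> (\<forall>(a, b)\<in>K. (a, b) \<noteq> (p, q) \<longrightarrow> Z$a$b = 0)"
  using pq
proof (induction "card {(a, b). \<kappa> a b < \<kappa> p q}" arbitrary: p q rule: less_induct)
  case less
  obtain Z where Z: "Z \<in> L" "Z$p$q \<noteq> 0" "\<And>a b. (a, b) \<in> K \<Longrightarrow> \<kappa> a b > \<kappa> p q \<Longrightarrow> Z$a$b = 0"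
    using tri less.prems by blast
  let ?K = "{(a, b). (a, b) \<in> K \<and> \<kappa> a b < \<kappa> p q}"
  have "\<forall>z\<in>?K. \<exists>Y. Y \<in> L \<and> Y $ fst z $ snd z = 1 \<and> (\<forall>(a, b)\<in>K. (a, b) \<noteq> z \<longrightarrow> Y$a$b = 0)"
  proof
    fix z assume "z \<in> ?K"
    then obtain a b where z: "z = (a, b)" "(a, b) \<in> K" "\<kappa> a b < \<kappa> p q" by blast
    have "card {(c, d). \<kappa> c d < \<kappa> a b} < card {(c, d). \<kappa> c d < \<kappa> p q}"
    proof (rule psubset_card_mono)
      have "(a, b) \<in> {(c, d). \<kappa> c d < \<kappa> p q}" "(a, b) \<notin> {(c, d). \<kappa> c d < \<kappa> a b}" using z by auto
      then show "{(c, d). \<kappa> c d < \<kappa> a b} \<subset> {(c, d). \<kappa> c d < \<kappa> p q}" using z(3) by force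
    qed simp
    from less.hyps[OF this z(2)] show "\<exists>Y. Y \<in> L \<and> Y $ fst z $ snd z = 1 \<and> (\<forall>(a, b)\<in>K. (a, b) \<noteq> z \<longrightarrow> Y$a$b = 0)"
      unfolding z(1) by auto
  qed
  from bchoice[OF this] obtain D where
    D': "\<forall>z\<in>?K. D z \<in> L \<and> D z $ fst z $ snd z = 1 \<and> (\<forall>(a, b)\<in>K. (a, b) \<noteq> z \<longrightarrow> D z $a$b = 0)" ..
  note D = D'[rule_format]
  define Y where "Y = Z - (\<Sum>z\<in>?K. mat_scale (Z $ fst z $ snd z) (D z))"
  have YL: "Y \<in> L" unfolding Y_def using D Z(1) sub
    by (intro cmat.subspace_diff cmat.subspace_sum cmat.subspace_scale) auto
  have Ynth: "Y$a$b = (if \<kappa> a b < \<kappa> p q then 0 else Z$a$b)" if ab: "(a, b) \<in> K" for a b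
  proof -
    have "(\<Sum>z\<in>?K. mat_scale (Z $ fst z $ snd z) (D z)) $ a $ b = (\<Sum>z\<in>?K. if z = (a, b) then Z$a$b else 0)"
      unfolding sum_component
    proof (rule sum.cong[OF refl])
      fix z assume z: "z \<in> ?K"
      show "mat_scale (Z $ fst z $ snd z) (D z) $ a $ b = (if z = (a, b) then Z$a$b else 0)"
      proof (cases "z = (a, b)")
        case True then show ?thesis using D[OF z] by simp
      next
        case False
        then have "D z $ a $ b = 0" using D[OF z] ab by force
        then show ?thesis using False by simp
      qed
    qed
    also have "\<dots> = (if (a, b) \<in> ?K then Z$a$b else 0)" by (rule sum.delta) simp
    finally show ?thesis using ab by (simp add: Y_def)
  qed
  have "mat_scale (1 / Z$p$q) Y \<in> L" using YL sub by (intro cmat.subspace_scale)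
  moreover have "mat_scale (1 / Z$p$q) Y $ p $ q = 1" using Ynth[OF less.prems] Z(2) by simp
  moreover have "mat_scale (1 / Z$p$q) Y $ a $ b = 0" if "(a, b) \<in> K" "(a, b) \<noteq> (p, q)" for a b
  proof -
    have "\<kappa> a b < \<kappa> p q \<or> \<kappa> a b > \<kappa> p q" using inj[of a b p q] that by force
    then show ?thesis using Ynth[OF that(1)] Z(3)[OF that(1)] by auto
  qed
  ultimately show ?case by blast
qed

text \<open>If the pivots \<open>K\<close> form an initial segment of the order, a pivot matrix for
  a position in \<open>K\<close> is supported in \<open>K\<close>, since entries above the position
  vanish and those below belong to \<open>K\<close>. Back substitution then produces the matrix
  units in \<open>V\<close> itself, without a limit.\<close>

lemma pivot_fill:
  fixes \<kappa> :: "'n::finite \<Rightarrow> 'n \<Rightarrow> real"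
  assumes sub: "cmat.subspace V" and inj: "\<And>i j p q. \<kappa> i j = \<kappa> p q \<Longrightarrow> i = p \<and> j = q"
    and down: "\<And>p q a b. (p, q) \<in> K \<Longrightarrow> \<kappa> a b \<le> \<kappa> p q \<Longrightarrow> (a, b) \<in> K"
    and pivot: "\<And>p q. (p, q) \<in> K \<Longrightarrow> pivot V \<kappa> p q" and pq: "(p, q) \<in> K"
  shows "unit_mat p q \<in> V"
proof -
  let ?L = "{X\<in>V. \<forall>a b. (a, b) \<notin> K \<longrightarrow> X$a$b = 0}"
  have sL: "cmat.subspace ?L"
    by (rule cmat.subspaceI) (use sub in \<open>auto intro: cmat.subspace_0 cmat.subspace_add cmat.subspace_scale\<close>)
  have "\<forall>(p, q)\<in>K. \<exists>Z\<in>?L. Z$p$q \<noteq> 0 \<and> (\<forall>(a, b)\<in>K. \<kappa> a b > \<kappa> p q \<longrightarrow> Z$a$b = 0)"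
  proof clarify
    fix p q assume k: "(p, q) \<in> K"
    then obtain X where X: "X \<in> V" "X$p$q = 1" "\<And>a b. \<kappa> a b > \<kappa> p q \<Longrightarrow> X$a$b = 0"
      using pivot[OF k] unfolding pivot_def by blast
    have "X$a$b = 0" if "(a, b) \<notin> K" for a b
      using X(3)[of a b] down[OF k, of a b] that by force
    then show "\<exists>Z\<in>?L. Z$p$q \<noteq> 0 \<and> (\<forall>(a, b)\<in>K. \<kappa> a b > \<kappa> p q \<longrightarrow> Z$a$b = 0)"
      using X by (intro bexI[of _ X]) auto
  qed
  from dual_basis[OF sL inj this pq] obtain Z where Z1: "Z \<in> ?L"
    and Z2: "Z$p$q = 1 \<and> (\<forall>(a, b)\<in>K. (a, b) \<noteq> (p, q) \<longrightarrow> Z$a$b = 0)" ..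
  have Z: "Z \<in> ?L" "Z$p$q = 1" "\<And>a b. (a, b) \<in> K \<Longrightarrow> (a, b) \<noteq> (p, q) \<Longrightarrow> Z$a$b = 0"
    using Z1 Z2 by auto
  have "Z$a$b = unit_mat p q $a$b" for a b
  proof (cases "(a, b) \<in> K")
    case True then show ?thesis using Z(2) Z(3)[OF True] by (auto simp: unit_mat_nth)
  next
    case False then show ?thesis using Z(1) pq by (auto simp: unit_mat_nth)
  qed
  then have "Z = unit_mat p q" by (simp add: vec_eq_iff)
  then show ?thesis using Z(1) by simp
qed

text \<open>Rows 1 and 2 contribute 12 generators, the block \<open>D\<close> 4, and the scalar one
  more, which bounds the dimension of \<open>calA\<close> by 17.\<close>

lemma calA_span: "calA \<subseteq> cmat.span (unit_mat 1 ` UNIV \<union> unit_mat 2 ` UNIV \<union> {unit_mat 3 5, unit_mat 3 6, unit_mat 4 5, unit_mat 4 6, unit_mat 3 3 + unit_mat 4 4 + unit_mat 5 5 + unit_mat 6 6})"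
    (is "_ \<subseteq> cmat.span ?G")
proof
  fix X assume "X \<in> calA"
  then obtain A B C D l where X: "X = block3 A B C 0 (mat l) D 0 0 (mat l)" unfolding calA_def by blast
  define W :: "complex ^ 6 ^ 6" where "W = unit_mat 3 3 + unit_mat 4 4 + unit_mat 5 5 + unit_mat 6 6"
  let ?Y = "(\<Sum>j\<in>UNIV. mat_scale (X$1$j) (unit_mat 1 j)) + (\<Sum>j\<in>UNIV. mat_scale (X$2$j) (unit_mat 2 j))
     + mat_scale (X$3$5) (unit_mat 3 5) + mat_scale (X$3$6) (unit_mat 3 6) + mat_scale (X$4$5) (unit_mat 4 5) + mat_scale (X$4$6) (unit_mat 4 6)
     + mat_scale l W"
  have "X = ?Y"
    unfolding vec_eq_iff forall_6 X block3_def by (simp add: unit_mat_nth sum_6 mat_def W_def)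
  moreover have "?Y \<in> cmat.span ?G"
    unfolding W_def[symmetric] by (intro cmat.span_add cmat.span_sum cmat.span_scale) (auto intro: cmat.span_base)
  ultimately show "X \<in> cmat.span ?G" by simp
qed

lemma card_calA_span:
  "card (unit_mat 1 ` UNIV \<union> unit_mat 2 ` UNIV \<union> {unit_mat 3 5, unit_mat 3 6, unit_mat 4 5, unit_mat 4 6, unit_mat 3 3 + unit_mat 4 4 + unit_mat 5 5 + unit_mat 6 6} :: (complex ^ 6 ^ 6) set) \<le> 17"
proof -
  have "card (unit_mat i ` UNIV :: (complex ^ 6 ^ 6) set) \<le> 6" for i using card_image_le[of "UNIV :: 6 set" "unit_mat i"] by simp
  from this[of 1] this[of 2]
  have "card (unit_mat 1 ` UNIV \<union> unit_mat 2 ` UNIV :: (complex ^ 6 ^ 6) set) \<le> 12"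
    using card_Un_le[of "unit_mat (1::6) ` UNIV" "unit_mat 2 ` UNIV"] by linarith
  moreover have "card {unit_mat 3 5, unit_mat 3 6, unit_mat 4 5, unit_mat 4 6, unit_mat 3 3 + unit_mat 4 4 + unit_mat 5 5 + unit_mat 6 6 :: complex ^ 6 ^ 6} \<le> 5"
    by (simp add: card_insert_if)
  ultimately show ?thesis
    using card_Un_le[of "unit_mat 1 ` UNIV \<union> unit_mat 2 ` UNIV" "{unit_mat 3 5, unit_mat 3 6, unit_mat 4 5, unit_mat 4 6, unit_mat 3 3 + unit_mat 4 4 + unit_mat 5 5 + unit_mat 6 6 :: complex ^ 6 ^ 6}"]
    by linarith
qed

section \<open>Linear bijections of the matrix space and equality with \<open>calA\<close>\<close>

lemma conj_add: "Q ** (X + Y) ** P = Q ** X ** P + Q ** Y ** P" for P Q X Y :: "complex ^ 'n ^ 'n"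
  by (simp add: vec_eq_iff matrix_matrix_mult_def sum.distrib algebra_simps)

lemma conj_scale: "Q ** mat_scale c X ** P = mat_scale c (Q ** X ** P)" for P Q X :: "complex ^ 'n ^ 'n"
  by (simp add: vec_eq_iff matrix_matrix_mult_def sum_distrib_left sum_distrib_right mult_ac)

lemma span_map:
  fixes f :: "complex ^ 'n ^ 'n \<Rightarrow> complex ^ 'n ^ 'n"
  assumes "\<And>X Y. f (X + Y) = f X + f Y" "\<And>c X. f (mat_scale c X) = mat_scale c (f X)"
    and "X \<in> cmat.span A"
  shows "f X \<in> cmat.span (f ` A)"
proof -
  have "mat_scale 0 0 = (0 :: complex ^ 'n ^ 'n)" by (simp add: vec_eq_iff)
  moreover have "mat_scale 0 (f 0) = 0" by (simp add: vec_eq_iff)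
  ultimately have f0: "f 0 = 0" using assms(2)[of 0 0] by simp
  have "cmat.subspace {X. f X \<in> cmat.span (f ` A)}"
    by (rule cmat.subspaceI) (auto simp: f0 assms(1,2) cmat.span_zero cmat.span_add cmat.span_scale)
  then have "cmat.span A \<subseteq> {X. f X \<in> cmat.span (f ` A)}"
    by (intro cmat.span_minimal) (auto intro: cmat.span_base)
  then show ?thesis using assms(3) by blast
qed

lemma subspace_map:
  fixes f :: "complex ^ 'n ^ 'n \<Rightarrow> complex ^ 'n ^ 'n"
  assumes add: "\<And>X Y. f (X + Y) = f X + f Y" and scale: "\<And>c X. f (mat_scale c X) = mat_scale c (f X)"
    and sub: "cmat.subspace V"
  shows "cmat.subspace (f ` V)"
proof (rule cmat.subspaceI)
  have "mat_scale 0 0 = (0 :: complex ^ 'n ^ 'n)" by (simp add: vec_eq_iff)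
  moreover have "mat_scale 0 (f 0) = 0" by (simp add: vec_eq_iff)
  ultimately have f0: "f 0 = 0" using scale[of 0 0] by simp
  then show "0 \<in> f ` V" using cmat.subspace_0[OF sub] by (metis image_eqI)
  show "x + y \<in> f ` V" if "x \<in> f ` V" "y \<in> f ` V" for x y
    using that cmat.subspace_add[OF sub] by (auto simp flip: add)
  show "mat_scale c x \<in> f ` V" if "x \<in> f ` V" for c x
    using that cmat.subspace_scale[OF sub] by (auto simp flip: scale)
qed

lemma dim_map_ge:
  fixes f g :: "complex ^ 6 ^ 6 \<Rightarrow> complex ^ 6 ^ 6"
  assumes fadd: "\<And>X Y. f (X + Y) = f X + f Y" and fscale: "\<And>c X. f (mat_scale c X) = mat_scale c (f X)"
    and add: "\<And>X Y. g (X + Y) = g X + g Y" and scale: "\<And>c X. g (mat_scale c X) = mat_scale c (g X)"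
    and gf: "\<And>X. g (f X) = X" and sub: "cmat.subspace V"
  shows "cmat.dim (f ` V) \<ge> cmat.dim V"
proof -
  obtain B where B: "f ` V \<subseteq> cmat.span B" "finite B" "card B = cmat.dim (f ` V)"
    by (rule finite_basis[OF subspace_map[OF fadd fscale sub]])
  have "V \<subseteq> cmat.span (g ` B)"
  proof
    fix X assume "X \<in> V"
    then have "f X \<in> cmat.span B" using B(1) by blast
    then have "g (f X) \<in> cmat.span (g ` B)" by (rule span_map[OF add scale])
    then show "X \<in> cmat.span (g ` B)" by (simp add: gf)
  qed
  then have "cmat.dim V \<le> card (g ` B)" using B(2) by (intro cmat.dim_le_card) auto
  then show ?thesis using card_image_le[OF B(2), of g] B(3) by simp
qed

lemma conj_inverse:
  fixes P Q X :: "complex ^ 'n ^ 'n"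
  assumes "P ** Q = mat 1"
  shows "P ** (Q ** X ** P) ** Q = X"
proof -
  have "P ** (Q ** X ** P) ** Q = (P ** Q) ** X ** (P ** Q)" by (simp add: matrix_mul_assoc)
  then show ?thesis using assms by simp
qed

text \<open>One inclusion suffices by dimension: an element of the conjugate of \<open>calA\<close>
  outside \<open>V\<close> would extend a basis of \<open>V\<close> to 18 independent matrices in
  the span of at most 17.\<close>

lemma conj_eq_calA:
  fixes P Q :: "complex ^ 6 ^ 6"
  assumes sub: "cmat.subspace V" and dim: "cmat.dim V = 17"
    and PQ: "P ** Q = mat 1" "Q ** P = mat 1" and inA: "\<And>T. T \<in> V \<Longrightarrow> Q ** T ** P \<in> calA"
  shows "(\<lambda>T. Q ** T ** P) ` V = calA"
proof
  show "(\<lambda>T. Q ** T ** P) ` V \<subseteq> calA" using inA by blast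
  let ?G = "unit_mat 1 ` UNIV \<union> unit_mat 2 ` UNIV \<union> {unit_mat 3 5, unit_mat 3 6, unit_mat 4 5, unit_mat 4 6, unit_mat 3 3 + unit_mat 4 4 + unit_mat 5 5 + unit_mat 6 6} :: (complex ^ 6 ^ 6) set"
  let ?h = "\<lambda>Y. P ** Y ** Q"
  have hspan: "?h Y \<in> cmat.span (?h ` ?G)" if "Y \<in> calA" for Y
    by (rule span_map[where f = ?h]) (use that calA_span in \<open>auto simp: conj_add conj_scale\<close>)
  show "calA \<subseteq> (\<lambda>T. Q ** T ** P) ` V"
  proof
    fix Y assume Y: "Y \<in> calA"
    have "?h Y \<in> V"
    proof (rule ccontr)
      assume no: "?h Y \<notin> V"
      obtain C where C: "C \<subseteq> V" "cmat.independent C" "V \<subseteq> cmat.span C" "card C = cmat.dim V"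
        by (rule cmat.basis_exists)
      have "cmat.span C = V" using C(1,3) sub by (simp add: cmat.span_minimal subset_antisym)
      then have ind: "cmat.independent (insert (?h Y) C)" using no C(2) by (simp add: cmat.independent_insert)
      have "insert (?h Y) C \<subseteq> cmat.span (?h ` ?G)"
      proof
        fix X assume "X \<in> insert (?h Y) C"
        then consider "X = ?h Y" | "X \<in> V" using C(1) by blast
        then show "X \<in> cmat.span (?h ` ?G)"
        proof cases
          case 1 then show ?thesis using hspan[OF Y] by simp
        next
          case 2
          then have "?h (Q ** X ** P) \<in> cmat.span (?h ` ?G)" by (intro hspan inA)
          then show ?thesis by (simp add: conj_inverse[OF PQ(1)])
        qed
      qed
      moreover have "finite (?h ` ?G)" by simp
      ultimately have le: "card (insert (?h Y) C) \<le> card (?h ` ?G)" "finite (insert (?h Y) C)"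
        using cmat.independent_span_bound[OF _ ind] by (metis (no_types, lifting))+
      have "card (?h ` ?G) \<le> 17" using card_image_le[of ?G ?h] card_calA_span by (simp add: order_trans)
      moreover have "?h Y \<notin> C" using no C(1) by blast
      ultimately show False using le C(4) dim by simp
    qed
    then show "Y \<in> (\<lambda>T. Q ** T ** P) ` V"
      by (intro image_eqI[of _ _ "?h Y"]) (simp_all add: conj_inverse[OF PQ(2)])
  qed
qed

lemma comm_mat: "comm (X + mat c) Y = comm X Y" "comm Y (X + mat c) = comm Y X"
proof -
  have "comm (mat c) Y = 0" "comm Y (mat c) = 0" for Y :: "complex ^ 'a ^ 'a"
    by (simp_all add: comm_def mat_mult_commute)
  then show "comm (X + mat c) Y = comm X Y" "comm Y (X + mat c) = comm Y X" by (simp_all add: comm_add)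
qed

lemma eigenvals_triangular:
  fixes M :: "((complex, 'n::{finite,wellorder}) vec, 'n) vec"
  assumes "\<And>i j. M $ i $ j \<noteq> 0 \<Longrightarrow> i \<noteq> j \<Longrightarrow> i < j"
  shows "eigenvals M = range (\<lambda>i. M $ i $ i)"
proof -
  have "det (M - mat \<mu>) = (\<Prod>i\<in>UNIV. M $ i $ i - \<mu>)" for \<mu>
  proof -
    have "det (M - mat \<mu>) = (\<Prod>i\<in>UNIV. (M - mat \<mu>) $ i $ i)"
    proof (rule det_upperdiagonal)
      fix i j :: 'n assume "j < i"
      then have "i \<noteq> j" "\<not> i < j" by auto
      then show "(M - mat \<mu>) $ i $ j = 0" using assms[of i j] by (simp add: mat_def) blast
    qed
    then show ?thesis by (simp add: mat_def)
  qed
  then show ?thesis unfolding eigenvals_def by (auto simp: prod_zero_iff)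
qed

text \<open>Comparison of parities, then halving. Powers of two are the weights of the preliminary
  degeneration.\<close>

lemma pow2_sidon: "(2::nat) ^ a + 2 ^ b = 2 ^ c + 2 ^ d \<Longrightarrow> a = c \<and> b = d \<or> a = d \<and> b = c"
proof (induction "a + b + c + d" arbitrary: a b c d rule: less_induct)
  case less
  consider "a = 0" "b = 0" | "a > 0" "b = 0" | "a = 0" "b > 0" | "a > 0" "b > 0" by auto
  note ab = this
  consider "c = 0" "d = 0" | "c > 0" "d = 0" | "c = 0" "d > 0" | "c > 0" "d > 0" by auto
  note cd = this
  have ev: "even ((2::nat) ^ k) \<longleftrightarrow> k > 0" for k by (cases k) auto
  have par: "(a > 0 \<longleftrightarrow> b > 0) \<longleftrightarrow> (c > 0 \<longleftrightarrow> d > 0)"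
    using arg_cong[OF less.prems, of even] unfolding even_add ev .
  have big: "(2::nat) ^ k \<ge> 2" if "k > 0" for k using that by (cases k) auto
  show ?case
  proof (cases rule: ab; cases rule: cd)
    assume p: "a > 0" "b > 0" "c > 0" "d > 0"
    then obtain a' b' c' d' where s: "a = Suc a'" "b = Suc b'" "c = Suc c'" "d = Suc d'"
      by (metis gr0_implies_Suc)
    then have "(2::nat) ^ a' + 2 ^ b' = 2 ^ c' + 2 ^ d'" using less.prems by simp
    from less.hyps[OF _ this] show ?thesis using s by simp
  next
    assume "a = 0" "b = 0" "c > 0" "d > 0"
    then show ?thesis using less.prems big[of c] big[of d] by simp
  next
    assume "a > 0" "b > 0" "c = 0" "d = 0"
    then show ?thesis using less.prems big[of a] big[of b] by simp
  qed (use less.prems par in \<open>simp_all add: ev\<close>)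
qed

text \<open>Forward substitution, dividing by l - a in each step: \<open>a\<close> is not an
  eigenvalue of a triangular matrix with constant diagonal \<open>l\<close>.\<close>

lemma upper_triangular_reg:
  fixes N :: "4 \<Rightarrow> 4 \<Rightarrow> complex" and x :: "complex ^ 4"
  assumes "\<And>k. N k k = l" "N 2 1 = 0" "N 3 1 = 0" "N 4 1 = 0" "N 3 2 = 0" "N 4 2 = 0" "N 4 3 = 0" "a \<noteq> l"
    and eq: "\<And>j. (\<Sum>k\<in>UNIV. x$k * N k j) = a * x$j"
  shows "x = 0"
proof -
  have 1: "x$1 = 0" using eq[of 1] assms(1-8) by (simp add: sum_4)
  have 2: "x$2 = 0" using eq[of 2] assms(1-8) 1 by (simp add: sum_4)
  have 3: "x$3 = 0" using eq[of 3] assms(1-8) 1 2 by (simp add: sum_4)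
  have 4: "x$4 = 0" using eq[of 4] assms(1-8) 1 2 3 by (simp add: sum_4)
  show ?thesis using 1 2 3 4 by (simp add: vec_eq_iff forall_4)
qed

lemma lower_triangular_reg:
  fixes N :: "4 \<Rightarrow> 4 \<Rightarrow> complex" and x :: "complex ^ 4"
  assumes "\<And>k. N k k = l" "N 1 2 = 0" "N 1 3 = 0" "N 1 4 = 0" "N 2 3 = 0" "N 2 4 = 0" "N 3 4 = 0" "a \<noteq> l"
    and eq: "\<And>j. (\<Sum>k\<in>UNIV. x$k * N k j) = a * x$j"
  shows "x = 0"
proof -
  have 4: "x$4 = 0" using eq[of 4] assms(1-8) by (simp add: sum_4)
  have 3: "x$3 = 0" using eq[of 3] assms(1-8) 4 by (simp add: sum_4)
  have 2: "x$2 = 0" using eq[of 2] assms(1-8) 4 3 by (simp add: sum_4)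
  have 1: "x$1 = 0" using eq[of 1] assms(1-8) 4 3 2 by (simp add: sum_4)
  show ?thesis using 1 2 3 4 by (simp add: vec_eq_iff forall_4)
qed

text \<open>Adding the scalar matrices to \<open>V\<close> changes no commutator and supplies the
  identity required by \<open>lift\<close>. The unit vectors at t1 and t2 then serve as evaluation
  vectors: by \<open>ord\<close> the two given matrices, read in column t and rows s1 and s2, form a
  triangular 2 by 2 system, which is the nondegeneracy demanded by \<open>to_calA\<close>.\<close>

lemma lift_final:
  fixes V :: "(complex ^ 6 ^ 6) set" and X :: "4 \<Rightarrow> 4 \<Rightarrow> complex ^ 6 ^ 6"
  assumes sub: "cmat.subspace V"
    and rank2: "\<And>S T. S \<in> V \<Longrightarrow> T \<in> V \<Longrightarrow> rank_le2 (comm S T)"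
    and dim: "cmat.dim V \<ge> 17"
    and K1: "\<And>k. unit_mat 1 (emb k) \<in> V" and K2: "\<And>k. unit_mat 2 (emb k) \<in> V"
    and S: "S \<in> V"
    and S_zero: "S$1$2 = 0" "S$2$1 = 0" "\<And>k. S $ 1 $ emb k = 0" "\<And>k. S $ 2 $ emb k = 0"
      "\<And>k. S $ emb k $ 1 = 0" "\<And>k. S $ emb k $ 2 = 0"
    and reg1: "\<And>x. (\<And>l. (\<Sum>k\<in>UNIV. x$k * S $ emb k $ emb l) = S$1$1 * x$l) \<Longrightarrow> x = 0"
    and reg2: "\<And>x. (\<And>l. (\<Sum>k\<in>UNIV. x$k * S $ emb k $ emb l) = S$2$2 * x$l) \<Longrightarrow> x = 0"
    and X: "\<And>s t. s \<in> {s1, s2} \<Longrightarrow> t \<in> {t1, t2} \<Longrightarrow> X s t \<in> V \<and> X s t $ emb s $ emb t = 1"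
    and ord: "\<And>t. t \<in> {t1, t2} \<Longrightarrow> X s1 t $ emb s2 $ emb t = 0 \<or> X s2 t $ emb s1 $ emb t = 0"
    and dist: "distinct [s1, s2, t1, t2]"
  shows "\<exists>P Q. P ** Q = mat 1 \<and> Q ** P = mat 1 \<and> (\<forall>T\<in>V. Q ** T ** P \<in> calA)"
proof -
  define V' where "V' = {T + mat c | T c. T \<in> V}"
  have m0: "mat 0 = (0 :: complex ^ 6 ^ 6)" by (simp add: vec_eq_iff mat_def)
  have VV': "V \<subseteq> V'"
  proof
    fix T assume "T \<in> V"
    then have "T + mat 0 \<in> V'" unfolding V'_def by blast
    then show "T \<in> V'" by (simp add: m0)
  qed
  have sub': "cmat.subspace V'"
  proof (rule cmat.subspaceI)
    show "0 \<in> V'" using VV' cmat.subspace_0[OF sub] by blast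
    show "x + y \<in> V'" if xy: "x \<in> V'" "y \<in> V'" for x y
    proof -
      obtain T c R d where "x = T + mat c" "T \<in> V" "y = R + mat d" "R \<in> V" using xy unfolding V'_def by blast
      moreover have "T + mat c + (R + mat d) = (T + R) + mat (c + d)" by (simp add: vec_eq_iff mat_def)
      ultimately show ?thesis unfolding V'_def using cmat.subspace_add[OF sub] by blast
    qed
    show "mat_scale a x \<in> V'" if xV: "x \<in> V'" for a x
    proof -
      obtain T c where "x = T + mat c" "T \<in> V" using xV unfolding V'_def by blast
      moreover have "mat_scale a (T + mat c) = mat_scale a T + mat (a * c)" by (simp add: vec_eq_iff mat_def algebra_simps)
      ultimately show ?thesis unfolding V'_def using cmat.subspace_scale[OF sub] by blast
    qed
  qed
  have dim': "cmat.dim V' \<ge> 17"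
  proof -
    obtain B where B: "V' \<subseteq> cmat.span B" "finite B" "card B = cmat.dim V'" by (rule finite_basis[OF sub'])
    have "V \<subseteq> cmat.span B" using VV' B(1) by blast
    then have "cmat.dim V \<le> card B" using B(2) by (rule cmat.dim_le_card)
    then show ?thesis using dim B(3) by simp
  qed
  have rank2': "rank_le2 (comm x y)" if "x \<in> V'" "y \<in> V'" for x y
    using that rank2 unfolding V'_def by (auto simp: comm_mat)
  interpret lift V' S
  proof
    show "cmat.subspace V'" by (rule sub')
    show "17 \<le> cmat.dim V'" by (rule dim')
    have "0 + mat 1 \<in> V'" unfolding V'_def using cmat.subspace_0[OF sub] by blast
    then show "mat 1 \<in> V'" by simp
    show "unit_mat 1 (emb k) \<in> V'" "unit_mat 2 (emb k) \<in> V'" for k using K1 K2 VV' by auto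
    show "S \<in> V'" using S VV' by auto
  qed (fact rank2' S_zero reg1 reg2)+
  have nd: "\<forall>f. dot f (axis t 1) = 0 \<longrightarrow> dot f (axis t' 1) = 0 \<longrightarrow> dot f (lower_block (X s1 t) *v axis t 1) = 0 \<longrightarrow>
      dot f (lower_block (X s2 t) *v axis t 1) = 0 \<longrightarrow> f = 0" if t: "(t, t') = (t1, t2) \<or> (t, t') = (t2, t1)" for t t'
  proof (intro allI impI)
    fix f :: "complex ^ 4"
    assume f: "dot f (axis t 1) = 0" "dot f (axis t' 1) = 0" "dot f (lower_block (X s1 t) *v axis t 1) = 0"
      "dot f (lower_block (X s2 t) *v axis t 1) = 0"
    have tt: "t \<in> {t1, t2}" "distinct [s1, s2, t, t']" using t dist by auto
    have U: "UNIV = {s1, s2, t, t'}"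
    proof -
      have "card {s1, s2, t, t'} = CARD(4)" using tt(2) by simp
      then show ?thesis using card_eq_UNIV_imp_eq_UNIV[of "{s1, s2, t, t'}"] by simp
    qed
    have ft: "f$t = 0" "f$t' = 0"
      using f(1,2) by (simp_all add: dot_def axis_def if_distrib[of "\<lambda>x. _ * x"] cong: if_cong)
    have col: "(lower_block R *v axis t 1) $ k = R $ emb k $ emb t" for R k
      by (simp add: lower_block_def matrix_vector_mult_def axis_def if_distrib[of "\<lambda>x. _ * x"] cong: if_cong)
    have eq: "f$s1 * R $ emb s1 $ emb t + f$s2 * R $ emb s2 $ emb t = 0" if "dot f (lower_block R *v axis t 1) = 0" for R
    proof -
      have "dot f (lower_block R *v axis t 1) = (\<Sum>k\<in>{s1, s2, t, t'}. f$k * R $ emb k $ emb t)"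
        unfolding dot_def col U ..
      also have "\<dots> = f$s1 * R $ emb s1 $ emb t + f$s2 * R $ emb s2 $ emb t" using tt(2) ft by simp
      finally show ?thesis using that by simp
    qed
    have x: "X s1 t $ emb s1 $ emb t = 1" "X s2 t $ emb s2 $ emb t = 1" using X[of s1 t] X[of s2 t] tt(1) by auto
    have "f$s1 = 0 \<and> f$s2 = 0" using eq[OF f(3)] eq[OF f(4)] x ord[OF tt(1)] by auto
    then have "f $ k = 0" for k using ft U by (metis UNIV_I empty_iff insert_iff)
    then show "f = 0" by (simp add: vec_eq_iff)
  qed
  have in_img: "lower_block (X s t) *v axis t 1 \<in> (\<lambda>T. lower_block T *v axis t 1) ` V'" if "s \<in> {s1, s2}" "t \<in> {t1, t2}" for s t
    using X[OF that] VV' by blast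
  have "\<exists>P Q. P ** Q = mat 1 \<and> Q ** P = mat 1 \<and> (\<forall>T\<in>V'. Q ** T ** P \<in> calA)"
    by (rule to_calA[OF in_img[of s1 t1] in_img[of s2 t1] nd[OF disjI1[OF refl]]
        in_img[of s1 t2] in_img[of s2 t2] nd[OF disjI2[OF refl]]]) simp_all
  then show ?thesis using VV' by blast
qed

text \<open>\<open>L\<close> stands for the brackets with \<open>S\<close>. It realises every lower
  left 4 by 2 block and every right part of row 1. Choose Z with independent lower left columns x
  and y, and Y with nonzero right part z of row 1, both with zero entries at (1, 2) and (2, 1); each
  choice meets at most three linear conditions in four unknowns. In Z + s Y the first row starts
  with two zeros, so a minor is (Z_1l + s z_l) F(s) with a 2 by 2 determinant F and F(0) nonzero.
  This forces z = 0.\<close>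

lemma mixed_contradiction:
  fixes L :: "(complex ^ 6 ^ 6) set"
  assumes sub: "cmat.subspace L"
    and minor: "\<And>Z i1 i2 i3 j1 j2 j3. Z \<in> L \<Longrightarrow> minor3 Z i1 i2 i3 j1 j2 j3 = 0"
    and diag: "\<And>Z. Z \<in> L \<Longrightarrow> Z$1$1 = 0 \<and> Z$2$2 = 0"
    and C1: "\<And>k. C1 k \<in> L" "\<And>k l. C1 k $ emb l $ 1 = (if l = k then 1 else 0)" "\<And>k l. C1 k $ emb l $ 2 = 0"
    and C2: "\<And>k. C2 k \<in> L" "\<And>k l. C2 k $ emb l $ 2 = (if l = k then 1 else 0)" "\<And>k l. C2 k $ emb l $ 1 = 0"
    and B: "\<And>k. B k \<in> L" "\<And>k l. B k $ 1 $ emb l = (if l = k then 1 else 0)"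
  shows False
proof -
  have comb: "(\<Sum>k\<in>UNIV. mat_scale (x$k) (F k)) $ i $ j = dot x (\<chi> k. F k $ i $ j)" for x and F :: "4 \<Rightarrow> complex ^ 6 ^ 6" and i j
    by (simp add: dot_def)
  have combL: "(\<Sum>k\<in>UNIV. mat_scale (x$k) (F k)) \<in> L" if "\<And>k. F k \<in> L" for x and F :: "4 \<Rightarrow> complex ^ 6 ^ 6"
    using that sub by (intro cmat.subspace_sum cmat.subspace_scale)
  have sel: "dot x (\<chi> k. if l = k then 1 else 0) = x$l" for x :: "complex ^ 4" and l
    by (simp add: dot_def if_distrib[of "\<lambda>c. _ * c"] cong: if_cong)
  have sel0: "dot x (\<chi> k. 0) = 0" for x :: "complex ^ 4" by (simp add: dot_def)
  let ?u = "\<lambda>F i j. (\<chi> k. F k $ i $ j) :: complex ^ 4"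
  have "card {?u C1 1 2, ?u C1 2 1} < CARD(4)" by (simp add: card_insert_if)
  from orthogonal_exists[OF _ this] obtain x where x0: "x \<noteq> 0" "\<forall>u\<in>{?u C1 1 2, ?u C1 2 1}. dot x u = 0" by auto
  have x: "x \<noteq> 0" "dot x (?u C1 1 2) = 0" "dot x (?u C1 2 1) = 0" using x0 by blast+
  obtain k0 where k0: "x$k0 \<noteq> 0" using x(1) by (auto simp: vec_eq_iff)
  \<comment> \<open>The third condition makes \<open>y\<close> vanish at k0, where \<open>x\<close>
    does not. This gives independence, and F(0) becomes the product of the entries of x at k0 and of
    y at k1.\<close>
  have "card {?u C2 1 2, ?u C2 2 1, axis k0 1} < CARD(4)" by (simp add: card_insert_if)
  from orthogonal_exists[OF _ this] obtain y where y0: "y \<noteq> 0" "\<forall>u\<in>{?u C2 1 2, ?u C2 2 1, axis k0 1}. dot y u = 0" by auto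
  have y: "y \<noteq> 0" "dot y (?u C2 1 2) = 0" "dot y (?u C2 2 1) = 0" "dot y (axis k0 1) = 0" using y0 by blast+
  have yk0: "y$k0 = 0" using y(4) by (simp add: dot_def axis_def if_distrib[of "\<lambda>x. _ * x"] cong: if_cong)
  obtain k1 where k1: "y$k1 \<noteq> 0" using y(1) by (auto simp: vec_eq_iff)
  have "card {?u B 1 2, ?u B 2 1} < CARD(4)" by (simp add: card_insert_if)
  from orthogonal_exists[OF _ this] obtain z where z0: "z \<noteq> 0" "\<forall>u\<in>{?u B 1 2, ?u B 2 1}. dot z u = 0" by auto
  have z: "z \<noteq> 0" "dot z (?u B 1 2) = 0" "dot z (?u B 2 1) = 0" using z0 by blast+
  define Z where "Z = (\<Sum>k\<in>UNIV. mat_scale (x$k) (C1 k)) + (\<Sum>k\<in>UNIV. mat_scale (y$k) (C2 k))"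
  define Y where "Y = (\<Sum>k\<in>UNIV. mat_scale (z$k) (B k))"
  have ZL: "Z \<in> L" unfolding Z_def by (intro cmat.subspace_add[OF sub] combL C1 C2)
  have YL: "Y \<in> L" unfolding Y_def by (intro combL B)
  have Z: "Z$1$2 = 0" "Z$2$1 = 0" "Z $ emb l $ 1 = x$l" "Z $ emb l $ 2 = y$l" for l
    unfolding Z_def vector_add_component comb by (simp_all add: x y C1 C2 sel sel0)
  have Y: "Y$1$2 = 0" "Y$2$1 = 0" "Y $ 1 $ emb l = z$l" for l
    unfolding Y_def comb by (simp_all add: z B sel)
  have d: "Z$1$1 = 0" "Y$1$1 = 0" using diag ZL YL by auto
  have zl: "z$l = 0" for l
  proof -
    define F where "F s = (x$k0 + s * Y $ emb k0 $ 1) * (y$k1 + s * Y $ emb k1 $ 2)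
        - (y$k0 + s * Y $ emb k0 $ 2) * (x$k1 + s * Y $ emb k1 $ 1)" for s
    have mn: "(Z $ 1 $ emb l + s * z$l) * F s = 0" for s
    proof -
      have "Z + mat_scale s Y \<in> L" by (intro cmat.subspace_add cmat.subspace_scale sub ZL YL)
      then have "minor3 (Z + mat_scale s Y) 1 (emb k0) (emb k1) 1 2 (emb l) = 0" by (rule minor)
      then show ?thesis by (simp add: minor3_def Z Y d F_def algebra_simps)
    qed
    have F0: "F 0 \<noteq> 0" using k0 k1 yk0 by (simp add: F_def)
    have b0: "Z $ 1 $ emb l = 0" using mn[of 0] F0 by simp
    have "z$l * F s = 0" if "s \<noteq> 0" for s using mn[of s] b0 that by simp
    moreover have "isCont (\<lambda>s. z$l * F s) 0" unfolding F_def by (intro continuous_intros)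
    ultimately have "z$l * F 0 = 0" by (intro eq_zero_at_0_by_continuity[of "\<lambda>s. z$l * F s"])
    then show ?thesis using F0 by simp
  qed
  then show False using z(1) by (simp add: vec_eq_iff)
qed

subsection \<open>Choice of weights\<close>

text \<open>The numbers are chosen so that the differences of the weights are pairwise distinct, and that the
  indices 1 and 2 lie far below (\<open>wlow\<close>) or far above (\<open>whigh\<close>) the other four.\<close>

definition wM :: "4 \<Rightarrow> nat" where
  "wM k = (if k = 1 then 8 else if k = 2 then 16 else if k = 3 then 32 else 64)"

definition wlow :: "6 \<Rightarrow> nat" where
  "wlow i = (if i = 1 then 1 else if i = 2 then 2 else 1000 + wM (emb_inv i))"

definition whigh :: "6 \<Rightarrow> nat" where
  "whigh i = (if i = 1 then 2000 else if i = 2 then 2001 else wM (emb_inv i))"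

lemma wM_bounds: "8 \<le> wM k" "wM k \<le> 64"
  by (simp_all add: wM_def)

lemma w_nth [simp]: "wlow 1 = 1" "wlow 2 = 2" "wlow (emb k) = 1000 + wM k"
  "whigh 1 = 2000" "whigh 2 = 2001" "whigh (emb k) = wM k"
  by (simp_all add: wlow_def whigh_def)

lemma wlow_range: "wlow x \<le> 1064" "x = 1 \<or> x = 2 \<or> wlow x \<ge> 1008" "x \<noteq> 1 \<and> x \<noteq> 2 \<or> wlow x \<le> 2"
  by (auto simp: wlow_def wM_def)

lemma whigh_range: "whigh x \<le> 2001" "x = 1 \<or> x = 2 \<or> whigh x \<le> 64" "x \<noteq> 1 \<and> x \<noteq> 2 \<or> whigh x \<ge> 2000"
  by (auto simp: whigh_def wM_def)

lemma emb_inv_simps [simp]: "emb_inv 3 = 1" "emb_inv 4 = 2" "emb_inv 5 = 3" "emb_inv 6 = 4" by (simp_all add: emb_inv_def)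

lemma sidon_low: "wlow i + wlow q = wlow p + wlow j \<Longrightarrow> i \<noteq> j \<Longrightarrow> p \<noteq> q \<Longrightarrow> i = p \<and> j = q"
proof -
  have "\<forall>i j p q. i \<noteq> j \<longrightarrow> p \<noteq> q \<longrightarrow> wlow i + wlow q = wlow p + wlow j \<longrightarrow> i = p \<and> j = q"
    unfolding forall_6 by (simp add: wlow_def wM_def)
  then show "wlow i + wlow q = wlow p + wlow j \<Longrightarrow> i \<noteq> j \<Longrightarrow> p \<noteq> q \<Longrightarrow> i = p \<and> j = q" by blast
qed

lemma sidon_high: "whigh i + whigh q = whigh p + whigh j \<Longrightarrow> i \<noteq> j \<Longrightarrow> p \<noteq> q \<Longrightarrow> i = p \<and> j = q"
proof -
  have "\<forall>i j p q. i \<noteq> j \<longrightarrow> p \<noteq> q \<longrightarrow> whigh i + whigh q = whigh p + whigh j \<longrightarrow> i = p \<and> j = q"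
    unfolding forall_6 by (simp add: whigh_def wM_def)
  then show "whigh i + whigh q = whigh p + whigh j \<Longrightarrow> i \<noteq> j \<Longrightarrow> p \<noteq> q \<Longrightarrow> i = p \<and> j = q" by blast
qed

text \<open>A colour other than \<open>l\<close> occurs at most at 1 and 2, so the four vertices of
  equal colour lie among the last four indices, and the full rows are 1 and 2. Applied to the
  reversed relation this locates full columns.\<close>

lemma locate_rows:
  fixes h :: "6 \<Rightarrow> complex"
  assumes fr: "full_rows h G i j a b c d" and h: "\<And>k. h (emb k) = l" "h 1 \<noteq> l" "h 2 \<noteq> l"
  obtains s1 s2 t1 t2 where "\<And>q. q \<noteq> 1 \<Longrightarrow> G 1 q" "\<And>q. q \<noteq> 2 \<Longrightarrow> G 2 q" "distinct [s1, s2, t1, t2]"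
    "\<And>s t. s \<in> {s1, s2} \<Longrightarrow> t \<in> {t1, t2} \<Longrightarrow> G (emb s) (emb t)"
proof -
  note f = fr[unfolded full_rows_def]
  have M: "x \<noteq> 1 \<and> x \<noteq> 2" if "x \<in> {a, b, c, d}" for x
  proof (rule ccontr)
    assume "\<not> ?thesis"
    then have ne: "h x \<noteq> l" using h by auto
    have hx: "h y = h x" if "y \<in> {a, b, c, d}" for y using f that \<open>x \<in> {a, b, c, d}\<close> by auto
    have "y = 1 \<or> y = 2" if "y \<in> {a, b, c, d}" for y
      using hx[OF that] ne h(1) by (cases y rule: cases_6) auto
    then have "{a, b, c, d} \<subseteq> {1, 2}" by blast
    then have "card {a, b, c, d} \<le> card {1, 2 :: 6}" by (intro card_mono) auto
    then show False using f by simp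
  qed
  have "\<exists>k. x = emb k" if "x \<in> {a, b, c, d}" for x using M[OF that] by (cases x rule: cases_6) auto
  then obtain s1 s2 t1 t2 where st: "a = emb s1" "b = emb s2" "c = emb t1" "d = emb t2" by (metis insertI1 insertI2)
  have "h i \<noteq> l" "h j \<noteq> l" using f h(1) st by auto
  moreover have "x = 1 \<or> x = 2" if "h x \<noteq> l" for x using that h(1) by (cases x rule: cases_6) auto
  ultimately have "i = 1 \<or> i = 2" "j = 1 \<or> j = 2" by auto
  then have "(i = 1 \<and> j = 2) \<or> (i = 2 \<and> j = 1)" using f by auto
  then have "\<forall>q. q \<noteq> 1 \<longrightarrow> G 1 q" "\<forall>q. q \<noteq> 2 \<longrightarrow> G 2 q" using f by auto
  moreover have "distinct [s1, s2, t1, t2]" using f st by auto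
  moreover have "G (emb s) (emb t)" if "s \<in> {s1, s2}" "t \<in> {t1, t2}" for s t using f st that by auto
  ultimately show ?thesis by (intro that) auto
qed

lemma weight_order_low_inj: "weight_order wlow i j = weight_order wlow p q \<Longrightarrow> i = p \<and> j = q"
  by (rule weight_order_inj[of wlow]) (rule sidon_low, assumption+)

lemma weight_order_high_inj: "weight_order whigh i j = weight_order whigh p q \<Longrightarrow> i = p \<and> j = q"
  by (rule weight_order_inj[of whigh]) (rule sidon_high, assumption+)

text \<open>The gap of about 1000 exceeds the spread of the other weights, so the eight positions in
  rows 1, 2 and columns 3 to 6 are exactly those of order at most -1000 and form an initial segment,
  as \<open>pivot_fill\<close> demands.\<close>

lemma low_fill:
  assumes "cmat.subspace V" and "\<And>k. pivot V (weight_order wlow) 1 (emb k)" "\<And>k. pivot V (weight_order wlow) 2 (emb k)"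
  shows "unit_mat 1 (emb k) \<in> V" "unit_mat 2 (emb k) \<in> V"
proof -
  let ?K = "{(i, q). (i = 1 \<or> i = 2) \<and> q \<noteq> 1 \<and> q \<noteq> 2}"
  have "unit_mat i q \<in> V" if iq: "(i, q) \<in> ?K" for i q
  proof (rule pivot_fill[OF assms(1), where \<kappa> = "weight_order wlow" and K = ?K])
    show "\<And>i j p q. weight_order wlow i j = weight_order wlow p q \<Longrightarrow> i = p \<and> j = q"
      by (rule weight_order_low_inj)
    show "(a, b) \<in> ?K" if pq: "(p, q) \<in> ?K" and ab: "weight_order wlow a b \<le> weight_order wlow p q" for p q a b
    proof -
      obtain k where k: "q = emb k" using pq by (cases q rule: cases_6) auto
      have "weight_order wlow p q \<le> -1000" using pq wM_bounds[of k] by (auto simp: weight_order_def k)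
      then have le: "weight_order wlow a b \<le> -1000" using ab by linarith
      have p: "weight_order wlow x x > 0" for x by (simp add: weight_order_def)
      have "a \<noteq> b" using le p[of a] by auto
      then have "real (wlow a) + 1000 \<le> real (wlow b)" using le by (simp add: weight_order_def)
      then have "wlow a + 1000 \<le> wlow b" by linarith
      then show ?thesis using wlow_range[of a] wlow_range[of b] by auto
    qed
    show "pivot V (weight_order wlow) p q" if "(p, q) \<in> ?K" for p q
      using that assms(2,3) by (cases q rule: cases_6) auto
    show "(i, q) \<in> ?K" by (rule iq)
  qed
  then show "unit_mat 1 (emb k) \<in> V" "unit_mat 2 (emb k) \<in> V" by auto
qed

text \<open>Under the high weights the bottom of the order consists of the positions in rows 3 to 6
  and columns 1, 2.\<close>

lemma high_fill:
  assumes "cmat.subspace V" and "\<And>k. pivot V (weight_order whigh) (emb k) 1" "\<And>k. pivot V (weight_order whigh) (emb k) 2"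
  shows "unit_mat (emb k) 1 \<in> V" "unit_mat (emb k) 2 \<in> V"
proof -
  let ?K = "{(q, i). (i = 1 \<or> i = 2) \<and> q \<noteq> 1 \<and> q \<noteq> (2::6)}"
  have "unit_mat q i \<in> V" if iq: "(q, i) \<in> ?K" for i q
  proof (rule pivot_fill[OF assms(1), where \<kappa> = "weight_order whigh" and K = ?K])
    show "\<And>i j p q. weight_order whigh i j = weight_order whigh p q \<Longrightarrow> i = p \<and> j = q"
      by (rule weight_order_high_inj)
    show "(a, b) \<in> ?K" if pq: "(p, q) \<in> ?K" and ab: "weight_order whigh a b \<le> weight_order whigh p q" for p q a b
    proof -
      obtain k where k: "p = emb k" using pq by (cases p rule: cases_6) auto
      have "weight_order whigh p q \<le> -1000" using pq wM_bounds[of k] by (auto simp: weight_order_def k)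
      then have le: "weight_order whigh a b \<le> -1000" using ab by linarith
      have p: "weight_order whigh x x > 0" for x by (simp add: weight_order_def)
      have "a \<noteq> b" using le p[of a] by auto
      then have "real (whigh a) + 1000 \<le> real (whigh b)" using le by (simp add: weight_order_def)
      then have "whigh a + 1000 \<le> whigh b" by linarith
      then show ?thesis using whigh_range[of a] whigh_range[of b] by auto
    qed
    show "pivot V (weight_order whigh) p q" if "(p, q) \<in> ?K" for p q
      using that assms(2,3) by (cases p rule: cases_6) auto
    show "(q, i) \<in> ?K" by (rule iq)
  qed
  then show "unit_mat (emb k) 1 \<in> V" "unit_mat (emb k) 2 \<in> V" by auto
qed

section \<open>Spaces in adapted position\<close>

lemma transpose_add: "transpose (X + Y) = transpose X + transpose Y" for X Y :: "complex ^ 'n ^ 'n"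
  by (simp add: vec_eq_iff transpose_def)
lemma transpose_scale: "transpose (mat_scale c X) = mat_scale c (transpose X)"
  by (simp add: vec_eq_iff transpose_def)
lemma transpose_nth: "transpose X $ i $ j = X $ j $ i" by (simp add: transpose_def)
lemma transpose_unit_mat: "transpose (unit_mat i j) = unit_mat j i" by (auto simp: vec_eq_iff transpose_def unit_mat_nth)

text \<open>The special vertices are 1 and 2, and the other four share the eigenvalue
  \<open>l\<close>. As \<open>S\<close> has no entries between different colours, its triangular
  form binds only the order of the last four indices, which is that of \<open>wM\<close>; so 1 and 2
  may receive the lowest or the highest weights.\<close>

locale adapted =
  fixes V :: "(complex ^ 6 ^ 6) set" and S :: "complex ^ 6 ^ 6" and h :: "6 \<Rightarrow> complex" and l :: complex
  assumes sub: "cmat.subspace V"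
    and rank2: "\<And>S T. S \<in> V \<Longrightarrow> T \<in> V \<Longrightarrow> rank_le2 (comm S T)"
    and dim: "cmat.dim V \<ge> 17"
    and eigenvals_bound: "\<And>T. T \<in> V \<Longrightarrow> card (eigenvals T) \<le> card (range h)"
    and S: "S \<in> V" and S_diag: "\<And>i. S$i$i = h i"
    and S_off: "\<And>i j. i \<noteq> j \<Longrightarrow> S$i$j \<noteq> 0 \<Longrightarrow> h i = h j"
    and S_upper: "\<And>k j. k \<noteq> j \<Longrightarrow> S $ emb k $ emb j \<noteq> 0 \<Longrightarrow> wM k < wM j"
    and h: "h 1 \<noteq> h 2" "\<And>k. h (emb k) = l" "h 1 \<noteq> l" "h 2 \<noteq> l"
begin

lemma S_zero: "S$1$2 = 0" "S$2$1 = 0" "S $ 1 $ emb k = 0" "S $ 2 $ emb k = 0" "S $ emb k $ 1 = 0" "S $ emb k $ 2 = 0"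
proof -
  have z: "S$i$j = 0" if "h i \<noteq> h j" for i j using S_off[of i j] that by (cases "i = j") auto
  show "S$1$2 = 0" "S$2$1 = 0" "S $ 1 $ emb k = 0" "S $ 2 $ emb k = 0" "S $ emb k $ 1 = 0" "S $ emb k $ 2 = 0"
    by (rule z; use h in simp)+
qed

lemma S_upper': "\<not> wM k < wM j \<Longrightarrow> k \<noteq> j \<Longrightarrow> S $ emb k $ emb j = 0"
  using S_upper by blast

lemma S_tri: "i \<noteq> j \<Longrightarrow> S$i$j \<noteq> 0 \<Longrightarrow> \<exists>k q. i = emb k \<and> j = emb q \<and> wM k < wM q"
proof -
  assume a: "i \<noteq> j" "S$i$j \<noteq> 0"
  obtain k where "i = emb k" using a S_zero by (cases i rule: cases_6; cases j rule: cases_6) auto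
  moreover obtain q where "j = emb q" using a S_zero by (cases i rule: cases_6; cases j rule: cases_6) auto
  ultimately show ?thesis using a S_upper[of k q] by auto
qed

lemma card6: "CARD(6) = 6" by simp

lemma deg_low: "degeneration V h wlow"
proof
  show "\<exists>S\<in>V. (\<forall>i. S$i$i = h i) \<and> (\<forall>i j. i \<noteq> j \<longrightarrow> S$i$j \<noteq> 0 \<longrightarrow> h i = h j \<and> wlow i < wlow j)"
  proof (intro bexI[of _ S] conjI allI impI)
    fix i j assume a: "i \<noteq> j" "S$i$j \<noteq> 0"
    then show "h i = h j" by (rule S_off)
    show "wlow i < wlow j" using S_tri[OF a] by auto
  qed (use S S_diag in auto)
  show "wlow i + wlow q = wlow p + wlow j \<Longrightarrow> i \<noteq> j \<Longrightarrow> p \<noteq> q \<Longrightarrow> i = p \<and> j = q" for i j p q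
    by (rule sidon_low)
qed (use sub rank2 dim eigenvals_bound card6 in auto)

lemma deg_high: "degeneration V h whigh"
proof
  show "\<exists>S\<in>V. (\<forall>i. S$i$i = h i) \<and> (\<forall>i j. i \<noteq> j \<longrightarrow> S$i$j \<noteq> 0 \<longrightarrow> h i = h j \<and> whigh i < whigh j)"
  proof (intro bexI[of _ S] conjI allI impI)
    fix i j assume a: "i \<noteq> j" "S$i$j \<noteq> 0"
    then show "h i = h j" by (rule S_off)
    show "whigh i < whigh j" using S_tri[OF a] by auto
  qed (use S S_diag in auto)
  show "whigh i + whigh q = whigh p + whigh j \<Longrightarrow> i \<noteq> j \<Longrightarrow> p \<noteq> q \<Longrightarrow> i = p \<and> j = q" for i j p q
    by (rule sidon_high)
qed (use sub rank2 dim eigenvals_bound card6 in auto)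

lemma reg_upper: "(\<And>j. (\<Sum>k\<in>UNIV. x$k * S $ emb k $ emb j) = a * x$j) \<Longrightarrow> a \<noteq> l \<Longrightarrow> x = 0"
  by (rule upper_triangular_reg[where N = "\<lambda>k j. S $ emb k $ emb j" and l = l and a = a])
     (simp_all add: S_diag h S_upper' wM_def del: emb_simps)

lemma reg_lower: "(\<And>j. (\<Sum>k\<in>UNIV. x$k * S $ emb j $ emb k) = a * x$j) \<Longrightarrow> a \<noteq> l \<Longrightarrow> x = 0"
  by (rule lower_triangular_reg[where N = "\<lambda>k j. S $ emb j $ emb k" and l = l and a = a])
     (simp_all add: S_diag h S_upper' wM_def del: emb_simps)

lemma rows_case:
  assumes G: "\<And>q. q \<noteq> 1 \<Longrightarrow> pivot V (weight_order wlow) 1 q" "\<And>q. q \<noteq> 2 \<Longrightarrow> pivot V (weight_order wlow) 2 q" "distinct [s1, s2, t1, t2]"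
    "\<And>s t. s \<in> {s1, s2} \<Longrightarrow> t \<in> {t1, t2} \<Longrightarrow> pivot V (weight_order wlow) (emb s) (emb t)"
  shows "\<exists>P Q. P ** Q = mat 1 \<and> Q ** P = mat 1 \<and> (\<forall>T\<in>V. Q ** T ** P \<in> calA)"
proof -
  have "\<forall>s t. \<exists>X. s \<in> {s1, s2} \<longrightarrow> t \<in> {t1, t2} \<longrightarrow> X \<in> V \<and> X $ emb s $ emb t = 1 \<and>
      (\<forall>p q. weight_order wlow p q > weight_order wlow (emb s) (emb t) \<longrightarrow> X$p$q = 0)"
    using G(4) unfolding pivot_def by blast
  then obtain X where X: "\<And>s t. s \<in> {s1, s2} \<Longrightarrow> t \<in> {t1, t2} \<Longrightarrow> X s t \<in> V \<and> X s t $ emb s $ emb t = 1 \<and>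
      (\<forall>p q. weight_order wlow p q > weight_order wlow (emb s) (emb t) \<longrightarrow> X s t $p$q = 0)" by metis
  have fill: "unit_mat 1 (emb k) \<in> V" "unit_mat 2 (emb k) \<in> V" for k
    by (rule low_fill[OF sub]; use G(1,2) in auto)+
  show ?thesis
  proof (rule lift_final[OF sub rank2 dim fill S S_zero, where X = X and ?s1.0 = s1 and ?s2.0 = s2 and ?t1.0 = t1 and ?t2.0 = t2])
    show "x = 0" if "\<And>j. (\<Sum>k\<in>UNIV. x$k * S $ emb k $ emb j) = S$1$1 * x$j" for x
      using that by (rule reg_upper) (simp add: S_diag h)
    show "x = 0" if "\<And>j. (\<Sum>k\<in>UNIV. x$k * S $ emb k $ emb j) = S$2$2 * x$j" for x
      using that by (rule reg_upper) (simp add: S_diag h)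
    show "X s t \<in> V \<and> X s t $ emb s $ emb t = 1" if "s \<in> {s1, s2}" "t \<in> {t1, t2}" for s t using X[OF that] by blast
    show "X s1 t $ emb s2 $ emb t = 0 \<or> X s2 t $ emb s1 $ emb t = 0" if t: "t \<in> {t1, t2}" for t
    proof -
      have ne: "s1 \<noteq> t" "s2 \<noteq> t" "s1 \<noteq> s2" using G(3) t by auto
      \<comment> \<open>Of two positions in one column, the lower one has a leading matrix that
        vanishes at the higher one.\<close>
      have "wM s1 \<noteq> wM s2" using ne(3) exhaust_4[of s1] exhaust_4[of s2] by (auto simp: wM_def)
      then have "weight_order wlow (emb s2) (emb t) > weight_order wlow (emb s1) (emb t) \<or> weight_order wlow (emb s1) (emb t) > weight_order wlow (emb s2) (emb t)"
        using ne by (simp add: weight_order_def) linarith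
      then show ?thesis using X[of s1 t] X[of s2 t] t by blast
    qed
    show "distinct [s1, s2, t1, t2]" by (rule G)
  qed
qed

text \<open>The transposed space is treated as in \<open>rows_case\<close>, while leading positions
  still refer to \<open>V\<close>; the high weights make columns 1 and 2 the bottom of its
  order.\<close>

lemma cols_case:
  assumes G: "\<And>q. q \<noteq> 1 \<Longrightarrow> pivot V (weight_order whigh) q 1" "\<And>q. q \<noteq> 2 \<Longrightarrow> pivot V (weight_order whigh) q 2" "distinct [s1, s2, t1, t2]"
    "\<And>s t. s \<in> {s1, s2} \<Longrightarrow> t \<in> {t1, t2} \<Longrightarrow> pivot V (weight_order whigh) (emb t) (emb s)"
  shows "\<exists>P Q. P ** Q = mat 1 \<and> Q ** P = mat 1 \<and> (\<forall>T\<in>transpose ` V. Q ** T ** P \<in> calA)"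
proof -
  have "\<forall>s t. \<exists>X. s \<in> {s1, s2} \<longrightarrow> t \<in> {t1, t2} \<longrightarrow> X \<in> V \<and> X $ emb t $ emb s = 1 \<and>
      (\<forall>p q. weight_order whigh p q > weight_order whigh (emb t) (emb s) \<longrightarrow> X$p$q = 0)"
    using G(4) unfolding pivot_def by blast
  then obtain X where X: "\<And>s t. s \<in> {s1, s2} \<Longrightarrow> t \<in> {t1, t2} \<Longrightarrow> X s t \<in> V \<and> X s t $ emb t $ emb s = 1 \<and>
      (\<forall>p q. weight_order whigh p q > weight_order whigh (emb t) (emb s) \<longrightarrow> X s t $p$q = 0)" by metis
  have fill: "unit_mat (emb k) 1 \<in> V" "unit_mat (emb k) 2 \<in> V" for k
    by (rule high_fill[OF sub]; use G(1,2) in auto)+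
  let ?V = "transpose ` V"
  have subT: "cmat.subspace ?V" by (rule subspace_map[OF transpose_add transpose_scale sub])
  have dimT: "cmat.dim ?V \<ge> 17"
    using dim_map_ge[where f = transpose and g = transpose, OF transpose_add transpose_scale transpose_add transpose_scale _ sub] dim
    by simp
  have rankT: "rank_le2 (comm A B)" if "A \<in> ?V" "B \<in> ?V" for A B
    using that rank2 by (auto simp: comm_transpose intro!: rank_le2_uminus rank_le2_transpose)
  show ?thesis
  proof (rule lift_final[OF subT rankT dimT, where S = "transpose S" and X = "\<lambda>s t. transpose (X s t)" and ?s1.0 = s1 and ?s2.0 = s2 and ?t1.0 = t1 and ?t2.0 = t2])
    have "transpose (unit_mat (emb k) 1) \<in> ?V" "transpose (unit_mat (emb k) 2) \<in> ?V" for k using fill[of k] by blast+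
    then show "unit_mat 1 (emb k) \<in> ?V" "unit_mat 2 (emb k) \<in> ?V" for k by (simp_all add: transpose_unit_mat)
    show "transpose S \<in> ?V" using S by simp
    show "x = 0" if "\<And>j. (\<Sum>k\<in>UNIV. x$k * transpose S $ emb k $ emb j) = transpose S$1$1 * x$j" for x
      using that unfolding transpose_nth by (rule reg_lower) (simp add: S_diag h)
    show "x = 0" if "\<And>j. (\<Sum>k\<in>UNIV. x$k * transpose S $ emb k $ emb j) = transpose S$2$2 * x$j" for x
      using that unfolding transpose_nth by (rule reg_lower) (simp add: S_diag h)
    show "transpose (X s t) \<in> ?V \<and> transpose (X s t) $ emb s $ emb t = 1" if "s \<in> {s1, s2}" "t \<in> {t1, t2}" for s t
      using X[OF that] by (simp add: transpose_nth)
    show "transpose (X s1 t) $ emb s2 $ emb t = 0 \<or> transpose (X s2 t) $ emb s1 $ emb t = 0" if t: "t \<in> {t1, t2}" for t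
    proof -
      have ne: "s1 \<noteq> t" "s2 \<noteq> t" "s1 \<noteq> s2" "t \<noteq> s1" "t \<noteq> s2" using G(3) t by auto
      have "wM s1 \<noteq> wM s2" using ne(3) exhaust_4[of s1] exhaust_4[of s2] by (auto simp: wM_def)
      then have "weight_order whigh (emb t) (emb s2) > weight_order whigh (emb t) (emb s1) \<or> weight_order whigh (emb t) (emb s1) > weight_order whigh (emb t) (emb s2)"
        using ne by (simp add: weight_order_def) linarith
      then show ?thesis using X[of s1 t] X[of s2 t] t unfolding transpose_nth by blast
    qed
    show "distinct [s1, s2, t1, t2]" by (rule G)
  qed (simp_all add: transpose_nth S_zero)
qed

lemma comm_left_block:
  assumes "i = 1 \<or> i = 2"
  shows "comm S X $ emb k $ i = (\<Sum>j\<in>UNIV. S $ emb k $ emb j * X $ emb j $ i) - X $ emb k $ i * h i"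
  using assms by (auto simp: comm_nth sum_6_split S_zero S_diag)

lemma comm_right_block:
  assumes "i = 1 \<or> i = 2"
  shows "comm S X $ i $ emb k = h i * X $ i $ emb k - (\<Sum>j\<in>UNIV. X $ i $ emb j * S $ emb j $ emb k)"
  using assms by (auto simp: comm_nth sum_6_split S_zero S_diag)

text \<open>Bracketing with \<open>S\<close> preserves leading terms in the blocks joining 1, 2 to
  the other indices: the diagonal of \<open>S\<close> multiplies the leading entry by a difference
  of distinct eigenvalues, and its strictly triangular part only brings in entries of larger weight,
  which vanish. Back substitution, under the low weights for the lower left block and under the high
  weights for the upper right one, gives the brackets that \<open>mixed_contradiction\<close> rules
  out.\<close>

lemma mixed_case:
  assumes C: "\<And>k. pivot V (weight_order wlow) (emb k) 1" "\<And>k. pivot V (weight_order wlow) (emb k) 2"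
    and R: "\<And>k. pivot V (weight_order whigh) 1 (emb k)" "\<And>k. pivot V (weight_order whigh) 2 (emb k)"
  shows False
proof -
  let ?L = "comm S ` V"
  have sL: "cmat.subspace ?L" by (rule subspace_map[OF comm_add(2) comm_scale(2) sub])
  let ?KC = "{(q, i). (i = 1 \<or> i = 2) \<and> q \<noteq> 1 \<and> q \<noteq> (2::6)}"
  let ?KR = "{(i, q). (i = 1 \<or> i = 2) \<and> q \<noteq> 1 \<and> q \<noteq> (2::6)}"
  have KC: "\<exists>Z\<in>?L. Z$p$q = 1 \<and> (\<forall>(a, b)\<in>?KC. (a, b) \<noteq> (p, q) \<longrightarrow> Z$a$b = 0)" if "(p, q) \<in> ?KC" for p q
  proof (rule dual_basis[OF sL _ _ that, where \<kappa> = "weight_order wlow"])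
    show "\<And>i j p q. weight_order wlow i j = weight_order wlow p q \<Longrightarrow> i = p \<and> j = q"
      by (rule weight_order_low_inj)
    show "\<forall>(p, q)\<in>?KC. \<exists>Z\<in>?L. Z$p$q \<noteq> 0 \<and> (\<forall>(a, b)\<in>?KC. weight_order wlow a b > weight_order wlow p q \<longrightarrow> Z$a$b = 0)"
    proof clarify
      fix p i :: 6 assume pi: "i = 1 \<or> i = 2" "p \<noteq> 1" "p \<noteq> 2"
      then obtain k where k: "p = emb k" by (cases p rule: cases_6) auto
      have "pivot V (weight_order wlow) (emb k) i" using C pi(1) by auto
      then obtain X where X: "X \<in> V" "X $ emb k $ i = 1" "\<And>a b. weight_order wlow a b > weight_order wlow (emb k) i \<Longrightarrow> X$a$b = 0"
        unfolding pivot_def by blast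
      have km: "weight_order wlow (emb j) i' = 1000 + real (wM j) - real (wlow i')" if "i' = 1 \<or> i' = 2" for j i'
        using that by (auto simp: weight_order_def)
      \<comment> \<open>Only the diagonal term of the sum survives: a nonzero entry of
        \<open>S\<close> at (emb j, emb q) with q other than j has wM j < wM q, so the corresponding
        entry of X lies above the leading position.\<close>
      have z: "comm S X $ emb j $ i' = (if (j, i') = (k, i) then l - h i else 0)"
        if i': "i' = 1 \<or> i' = 2" and ge: "weight_order wlow (emb j) i' \<ge> weight_order wlow (emb k) i" for j i'
      proof -
        have "(\<Sum>q\<in>UNIV. S $ emb j $ emb q * X $ emb q $ i') = (\<Sum>q\<in>UNIV. if q = j then l * X $ emb j $ i' else 0)"
        proof (rule sum.cong[OF refl])
          fix q
          show "S $ emb j $ emb q * X $ emb q $ i' = (if q = j then l * X $ emb j $ i' else 0)"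
          proof (cases "q = j")
            case True then show ?thesis by (simp add: S_diag h)
          next
            case False
            have "X $ emb q $ i' = 0" if "S $ emb j $ emb q \<noteq> 0"
            proof (rule X(3))
              have "wM j < wM q" using S_upper[of j q] that False by auto
              then have "weight_order wlow (emb q) i' > weight_order wlow (emb j) i'" by (simp add: km[OF i'])
              then show "weight_order wlow (emb q) i' > weight_order wlow (emb k) i" using ge by linarith
            qed
            then show ?thesis using False by auto
          qed
        qed
        then have c: "comm S X $ emb j $ i' = (l - h i') * X $ emb j $ i'"
          using comm_left_block[OF i', of X j] by (simp add: algebra_simps)
        show ?thesis
        proof (cases "(j, i') = (k, i)")
          case True then show ?thesis using c X(2) by simp
        next
          case False
          then have "weight_order wlow (emb j) i' \<noteq> weight_order wlow (emb k) i" using weight_order_low_inj[of "emb j" i' "emb k" i] by auto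
          then have "X $ emb j $ i' = 0" using ge by (intro X(3)) linarith
          then show ?thesis using c False by auto
        qed
      qed
      have "comm S X $ p $ i \<noteq> 0" using z[of i k] pi(1) h k by auto
      moreover have "comm S X $ a $ b = 0" if ab: "(a, b) \<in> ?KC" "weight_order wlow a b > weight_order wlow p i" for a b
      proof -
        obtain j where j: "a = emb j" using ab(1) by (cases a rule: cases_6) auto
        have "(j, b) \<noteq> (k, i)" using ab(2) j k by auto
        then show ?thesis using z[of b j] ab j k by auto
      qed
      ultimately show "\<exists>Z\<in>?L. Z$p$i \<noteq> 0 \<and> (\<forall>(a, b)\<in>?KC. weight_order wlow a b > weight_order wlow p i \<longrightarrow> Z$a$b = 0)"
        using X(1) by (intro bexI[of _ "comm S X"]) auto
    qed
  qed
  have KR: "\<exists>Z\<in>?L. Z$p$q = 1 \<and> (\<forall>(a, b)\<in>?KR. (a, b) \<noteq> (p, q) \<longrightarrow> Z$a$b = 0)" if "(p, q) \<in> ?KR" for p q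
  proof (rule dual_basis[OF sL _ _ that, where \<kappa> = "weight_order whigh"])
    show "\<And>i j p q. weight_order whigh i j = weight_order whigh p q \<Longrightarrow> i = p \<and> j = q"
      by (rule weight_order_high_inj)
    show "\<forall>(p, q)\<in>?KR. \<exists>Z\<in>?L. Z$p$q \<noteq> 0 \<and> (\<forall>(a, b)\<in>?KR. weight_order whigh a b > weight_order whigh p q \<longrightarrow> Z$a$b = 0)"
    proof clarify
      fix i p :: 6 assume pi: "i = 1 \<or> i = 2" "p \<noteq> 1" "p \<noteq> 2"
      then obtain k where k: "p = emb k" by (cases p rule: cases_6) auto
      have "pivot V (weight_order whigh) i (emb k)" using R pi(1) by auto
      then obtain X where X: "X \<in> V" "X $ i $ emb k = 1" "\<And>a b. weight_order whigh a b > weight_order whigh i (emb k) \<Longrightarrow> X$a$b = 0"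
        unfolding pivot_def by blast
      have km: "weight_order whigh i' (emb j) = real (whigh i') - real (wM j)" if "i' = 1 \<or> i' = 2" for j i'
        using that by (auto simp: weight_order_def)
      have z: "comm S X $ i' $ emb j = (if (j, i') = (k, i) then h i - l else 0)"
        if i': "i' = 1 \<or> i' = 2" and ge: "weight_order whigh i' (emb j) \<ge> weight_order whigh i (emb k)" for j i'
      proof -
        have "(\<Sum>q\<in>UNIV. X $ i' $ emb q * S $ emb q $ emb j) = (\<Sum>q\<in>UNIV. if q = j then l * X $ i' $ emb j else 0)"
        proof (rule sum.cong[OF refl])
          fix q
          show "X $ i' $ emb q * S $ emb q $ emb j = (if q = j then l * X $ i' $ emb j else 0)"
          proof (cases "q = j")
            case True then show ?thesis by (simp add: S_diag h)
          next
            case False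
            have "X $ i' $ emb q = 0" if "S $ emb q $ emb j \<noteq> 0"
            proof (rule X(3))
              have "wM q < wM j" using S_upper[of q j] that False by auto
              then have "weight_order whigh i' (emb q) > weight_order whigh i' (emb j)" by (simp add: km[OF i'])
              then show "weight_order whigh i' (emb q) > weight_order whigh i (emb k)" using ge by linarith
            qed
            then show ?thesis using False by auto
          qed
        qed
        then have c: "comm S X $ i' $ emb j = (h i' - l) * X $ i' $ emb j"
          using comm_right_block[OF i', of X j] by (simp add: algebra_simps)
        show ?thesis
        proof (cases "(j, i') = (k, i)")
          case True then show ?thesis using c X(2) by simp
        next
          case False
          then have "weight_order whigh i' (emb j) \<noteq> weight_order whigh i (emb k)" using weight_order_high_inj[of i' "emb j" i "emb k"] by auto
          then have "X $ i' $ emb j = 0" using ge by (intro X(3)) linarith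
          then show ?thesis using c False by auto
        qed
      qed
      have "comm S X $ i $ p \<noteq> 0" using z[of i k] pi(1) h k by auto
      moreover have "comm S X $ a $ b = 0" if ab: "(a, b) \<in> ?KR" "weight_order whigh a b > weight_order whigh i p" for a b
      proof -
        obtain j where j: "b = emb j" using ab(1) by (cases b rule: cases_6) auto
        have "(j, a) \<noteq> (k, i)" using ab(2) j k by auto
        then show ?thesis using z[of a j] ab j k by auto
      qed
      ultimately show "\<exists>Z\<in>?L. Z$i$p \<noteq> 0 \<and> (\<forall>(a, b)\<in>?KR. weight_order whigh a b > weight_order whigh i p \<longrightarrow> Z$a$b = 0)"
        using X(1) by (intro bexI[of _ "comm S X"]) auto
    qed
  qed
  have "\<forall>k. \<exists>Z. Z \<in> ?L \<and> (\<forall>j. Z $ emb j $ 1 = (if j = k then 1 else 0)) \<and> (\<forall>j. Z $ emb j $ 2 = 0)"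
  proof
    fix k
    obtain Z where Z: "Z \<in> ?L" "Z $ emb k $ 1 = 1" "\<forall>(a, b)\<in>?KC. (a, b) \<noteq> (emb k, 1) \<longrightarrow> Z$a$b = 0"
      using KC[of "emb k" 1] by auto
    then show "\<exists>Z. Z \<in> ?L \<and> (\<forall>j. Z $ emb j $ 1 = (if j = k then 1 else 0)) \<and> (\<forall>j. Z $ emb j $ 2 = 0)"
      by (intro exI[of _ Z]) auto
  qed
  then obtain C1 where C1: "\<And>k. C1 k \<in> ?L" "\<And>k j. C1 k $ emb j $ 1 = (if j = k then 1 else 0)" "\<And>k j. C1 k $ emb j $ 2 = 0"
    by metis
  have "\<forall>k. \<exists>Z. Z \<in> ?L \<and> (\<forall>j. Z $ emb j $ 2 = (if j = k then 1 else 0)) \<and> (\<forall>j. Z $ emb j $ 1 = 0)"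
  proof
    fix k
    obtain Z where Z: "Z \<in> ?L" "Z $ emb k $ 2 = 1" "\<forall>(a, b)\<in>?KC. (a, b) \<noteq> (emb k, 2) \<longrightarrow> Z$a$b = 0"
      using KC[of "emb k" 2] by auto
    then show "\<exists>Z. Z \<in> ?L \<and> (\<forall>j. Z $ emb j $ 2 = (if j = k then 1 else 0)) \<and> (\<forall>j. Z $ emb j $ 1 = 0)"
      by (intro exI[of _ Z]) auto
  qed
  then obtain C2 where C2: "\<And>k. C2 k \<in> ?L" "\<And>k j. C2 k $ emb j $ 2 = (if j = k then 1 else 0)" "\<And>k j. C2 k $ emb j $ 1 = 0"
    by metis
  have "\<forall>k. \<exists>Z. Z \<in> ?L \<and> (\<forall>j. Z $ 1 $ emb j = (if j = k then 1 else 0))"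
  proof
    fix k
    obtain Z where Z: "Z \<in> ?L" "Z $ 1 $ emb k = 1" "\<forall>(a, b)\<in>?KR. (a, b) \<noteq> (1, emb k) \<longrightarrow> Z$a$b = 0"
      using KR[of 1 "emb k"] by auto
    then show "\<exists>Z. Z \<in> ?L \<and> (\<forall>j. Z $ 1 $ emb j = (if j = k then 1 else 0))"
      by (intro exI[of _ Z]) auto
  qed
  then obtain B where B: "\<And>k. B k \<in> ?L" "\<And>k j. B k $ 1 $ emb j = (if j = k then 1 else 0)"
    by metis
  show False
  proof (rule mixed_contradiction[OF sL _ _ C1 C2 B])
    show "minor3 Z i1 i2 i3 j1 j2 j3 = 0" if "Z \<in> ?L" for Z i1 i2 i3 j1 j2 j3
      using that rank2[OF S] rank_le2_minor3 by blast
    show "Z$1$1 = 0 \<and> Z$2$2 = 0" if "Z \<in> ?L" for Z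
      using that by (auto simp: comm_nth sum_6_split S_zero)
  qed
qed

text \<open>Rows under the low weights or columns under the high weights lead to
  \<open>calA\<close>. The remaining combination, columns for low and rows for high, is refuted by
  \<open>mixed_case\<close>.\<close>

lemma conj_into_calA:
  "\<exists>P Q. P ** Q = mat 1 \<and> Q ** P = mat 1 \<and> ((\<forall>T\<in>V. Q ** T ** P \<in> calA) \<or> (\<forall>T\<in>transpose ` V. Q ** T ** P \<in> calA))"
proof -
  have Gl: "degeneration.G V wlow i j \<Longrightarrow> pivot V (weight_order wlow) i j" for i j by (simp add: degeneration.G_def[OF deg_low])
  have Gh: "degeneration.G V whigh i j \<Longrightarrow> pivot V (weight_order whigh) i j" for i j by (simp add: degeneration.G_def[OF deg_high])
  from pivot_graph.full_rows_or_cols[OF degeneration.pivot_graph[OF deg_low]]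
  consider (low_rows) i j a b c d where "full_rows h (degeneration.G V wlow) i j a b c d"
    | (low_cols) i j a b c d where "full_rows h (\<lambda>i j. degeneration.G V wlow j i) i j a b c d" by blast
  then show ?thesis
  proof cases
    case low_rows
    obtain s1 s2 t1 t2 where "\<And>q. q \<noteq> 1 \<Longrightarrow> degeneration.G V wlow 1 q" "\<And>q. q \<noteq> 2 \<Longrightarrow> degeneration.G V wlow 2 q"
      "distinct [s1, s2, t1, t2]" "\<And>s t. s \<in> {s1, s2} \<Longrightarrow> t \<in> {t1, t2} \<Longrightarrow> degeneration.G V wlow (emb s) (emb t)"
      by (rule locate_rows[OF low_rows h(2-4)]) blast
    then have "\<exists>P Q. P ** Q = mat 1 \<and> Q ** P = mat 1 \<and> (\<forall>T\<in>V. Q ** T ** P \<in> calA)"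
      by (intro rows_case[of s1 s2 t1 t2] Gl)
    then show ?thesis by blast
  next
    case low_cols
    obtain s1 s2 t1 t2 where lc: "\<And>q. q \<noteq> 1 \<Longrightarrow> degeneration.G V wlow q 1" "\<And>q. q \<noteq> 2 \<Longrightarrow> degeneration.G V wlow q 2"
      by (rule locate_rows[OF low_cols h(2-4)]) blast
    from pivot_graph.full_rows_or_cols[OF degeneration.pivot_graph[OF deg_high]]
    consider (high_rows) i j a b c d where "full_rows h (degeneration.G V whigh) i j a b c d"
      | (high_cols) i j a b c d where "full_rows h (\<lambda>i j. degeneration.G V whigh j i) i j a b c d" by blast
    then show ?thesis
    proof cases
      case high_rows
      obtain s1 s2 t1 t2 where hr: "\<And>q. q \<noteq> 1 \<Longrightarrow> degeneration.G V whigh 1 q" "\<And>q. q \<noteq> 2 \<Longrightarrow> degeneration.G V whigh 2 q"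
        by (rule locate_rows[OF high_rows h(2-4)]) blast
      have False by (rule mixed_case) (use lc hr Gl Gh in auto)
      then show ?thesis by blast
    next
      case high_cols
      obtain s1 s2 t1 t2 where "\<And>q. q \<noteq> 1 \<Longrightarrow> degeneration.G V whigh q 1" "\<And>q. q \<noteq> 2 \<Longrightarrow> degeneration.G V whigh q 2"
        "distinct [s1, s2, t1, t2]" "\<And>s t. s \<in> {s1, s2} \<Longrightarrow> t \<in> {t1, t2} \<Longrightarrow> degeneration.G V whigh (emb t) (emb s)"
        by (rule locate_rows[OF high_cols h(2-4)]) blast
      then have "\<exists>P Q. P ** Q = mat 1 \<and> Q ** P = mat 1 \<and> (\<forall>T\<in>transpose ` V. Q ** T ** P \<in> calA)"
        by (intro cols_case[of s1 s2 t1 t2] Gh)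
      then show ?thesis by blast
    qed
  qed
qed

end

section \<open>Reduction to adapted position and conclusion\<close>

lemma conj_properties:
  fixes P Q :: "complex ^ 6 ^ 6"
  assumes PQ: "P ** Q = mat 1" "Q ** P = mat 1" and sub: "cmat.subspace V"
    and rank2: "\<forall>S\<in>V. \<forall>T\<in>V. rank_le2 (comm S T)"
  defines "V' \<equiv> (\<lambda>T. Q ** T ** P) ` V"
  shows "cmat.subspace V'" "\<forall>S\<in>V'. \<forall>T\<in>V'. rank_le2 (comm S T)"
    "cmat.dim V' \<ge> cmat.dim V" "\<And>T. T \<in> V' \<Longrightarrow> \<exists>R\<in>V. eigenvals T = eigenvals R"
proof -
  show "cmat.subspace V'" unfolding V'_def by (rule subspace_map[OF conj_add conj_scale sub])
  show "\<forall>S\<in>V'. \<forall>T\<in>V'. rank_le2 (comm S T)"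
    using rank2 unfolding V'_def by (auto simp: comm_conj[OF PQ(1)] intro!: rank_le2_mult)
  show "cmat.dim V' \<ge> cmat.dim V"
    unfolding V'_def
    by (rule dim_map_ge[where g = "\<lambda>T. P ** T ** Q", OF conj_add conj_scale conj_add conj_scale _ sub])
       (rule conj_inverse[OF PQ(1)])
  show "\<exists>R\<in>V. eigenvals T = eigenvals R" if "T \<in> V'" for T
    using that unfolding V'_def by (auto simp: eigenvals_conj[OF PQ(2)])
qed

lemma permutation_conj:
  fixes \<sigma> :: "'n::finite \<Rightarrow> 'n"
  assumes "inj \<sigma>"
  obtains P Q :: "complex ^ 'n ^ 'n" where "P ** Q = mat 1" "Q ** P = mat 1"
    "\<And>X i j. (Q ** X ** P) $ i $ j = X $ \<sigma> i $ \<sigma> j"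
proof -
  define P :: "complex ^ 'n ^ 'n" where "P = (\<chi> i j. if i = \<sigma> j then 1 else 0)"
  define Q :: "complex ^ 'n ^ 'n" where "Q = (\<chi> i j. if j = \<sigma> i then 1 else 0)"
  have Q: "(Q ** X) $ i $ j = X $ \<sigma> i $ j" for X :: "complex ^ 'n ^ 'n" and i j
    by (simp add: matrix_matrix_mult_def Q_def if_distrib[of "\<lambda>c. c * _"] cong: if_cong)
  have P: "(X ** P) $ i $ j = X $ i $ \<sigma> j" for X :: "complex ^ 'n ^ 'n" and i j
    by (simp add: matrix_matrix_mult_def P_def if_distrib[of "\<lambda>c. _ * c"] cong: if_cong)
  have "Q ** P = mat 1"
    using assms by (simp add: vec_eq_iff Q P_def mat_def inj_eq)
  then show ?thesis using that[of P Q] by (simp add: matrix_left_right_inverse P Q)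
qed

lemma card4_sorted:
  fixes A :: "'a::linorder set"
  assumes "card A = 4"
  obtains a b c d where "A = {a, b, c, d}" "a < b" "b < c" "c < d"
proof -
  have fin: "finite A" using assms by (metis card.infinite zero_neq_numeral)
  define xs where "xs = sorted_list_of_set A"
  have xs: "set xs = A" "sorted xs" "distinct xs" "length xs = 4" using fin assms by (simp_all add: xs_def)
  then obtain a b c d where "xs = [a, b, c, d]"
    by (auto simp: numeral_eq_Suc length_Suc_conv)
  then show ?thesis using that[of a b c d] xs by auto
qed

text \<open>The preliminary degeneration uses the weights 2^k, with k the rank of the index, which
  increase along the triangular form. It yields the colour pattern, two simple eigenvalues and one
  of multiplicity four, and the permutation adapts the indices to it.\<close>

lemma adapted_exists:
  fixes V :: "(complex ^ 6 ^ 6) set"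
  assumes sub: "cmat.subspace V" and dim: "cmat.dim V \<ge> 17"
    and rank2: "\<forall>S\<in>V. \<forall>T\<in>V. rank_le2 (comm S T)"
  obtains P Q S h l where "P ** Q = mat 1" "Q ** P = mat 1" "adapted ((\<lambda>T. Q ** T ** P) ` V) S h l"
proof -
  have "card (eigenvals T) \<le> CARD(6)" for T :: "complex ^ 6 ^ 6" by (rule card_eigenvals_le)
  then have "(\<lambda>T. card (eigenvals T)) ` V \<subseteq> {..CARD(6)}" by blast
  then have fin: "finite ((\<lambda>T. card (eigenvals T)) ` V)" by (rule finite_subset) (rule finite_atMost)
  have "V \<noteq> {}" using cmat.subspace_0[OF sub] by auto
  then have "Max ((\<lambda>T. card (eigenvals T)) ` V) \<in> (\<lambda>T. card (eigenvals T)) ` V" using fin by (intro Max_in) auto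
  then obtain S where S: "S \<in> V" "card (eigenvals S) = Max ((\<lambda>T. card (eigenvals T)) ` V)" by auto
  have max: "card (eigenvals T) \<le> card (eigenvals S)" if "T \<in> V" for T
    unfolding S(2) using fin that by (intro Max_ge) auto
  obtain P Q :: "complex ^ 6 ^ 6" where PQ: "P ** Q = mat 1" "Q ** P = mat 1"
    and tri: "\<And>i j. (Q ** S ** P) $ i $ j \<noteq> 0 \<Longrightarrow> i \<noteq> j \<Longrightarrow>
       i < j \<and> (Q ** S ** P) $ i $ i = (Q ** S ** P) $ j $ j"
    by (rule block_triangular_form[of S]) blast
  define V1 where "V1 = (\<lambda>T. Q ** T ** P) ` V"
  define M where "M = Q ** S ** P"
  define h where "h i = M $ i $ i" for i
  note V1 = conj_properties[OF PQ sub rank2, folded V1_def]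
  have M: "M \<in> V1" using S(1) by (simp add: V1_def M_def)
  have Mtri: "i < j" "h i = h j" if "M $ i $ j \<noteq> 0" "i \<noteq> j" for i j
    using tri[of i j] that by (auto simp: M_def h_def)
  have specM: "eigenvals M = range h" unfolding h_def by (rule eigenvals_triangular) (rule Mtri)
  have "eigenvals M = eigenvals S" unfolding M_def by (rule eigenvals_conj[OF PQ(2)])
  then have bound1: "card (eigenvals T) \<le> card (range h)" if "T \<in> V1" for T
    using V1(4)[OF that] max specM by auto
  define w where "w i = (2::nat) ^ card {k. k < i}" for i :: 6
  have mono: "card {k. k < i} < card {k. k < j}" if "i < j" for i j :: 6
    by (rule psubset_card_mono) (use that in auto)
  have inj: "i = j" if "card {k. k < i} = card {k. k < j}" for i j :: 6
    using mono[of i j] mono[of j i] that by (metis less_irrefl linorder_neqE)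
  have "degeneration V1 h w"
  proof
    show "\<exists>S\<in>V1. (\<forall>i. S $ i $ i = h i) \<and> (\<forall>i j. i \<noteq> j \<longrightarrow> S $ i $ j \<noteq> 0 \<longrightarrow> h i = h j \<and> w i < w j)"
      using M Mtri mono by (intro bexI[of _ M]) (auto simp: h_def w_def)
    show "i = p \<and> j = q" if "w i + w q = w p + w j" "i \<noteq> j" "p \<noteq> q" for i j p q
      using pow2_sidon[OF that(1)[unfolded w_def]] inj that(2,3) by blast
    show "17 \<le> cmat.dim V1" using V1(3) dim by simp
  qed (use V1 bound1 in auto)
  then have "pivot_graph h (degeneration.G V1 w)" by (rule degeneration.pivot_graph)
  then have "\<exists>i j s1 s2 t1 t2. full_rows h (degeneration.G V1 w) i j s1 s2 t1 t2 \<or>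
      full_rows h (\<lambda>i j. degeneration.G V1 w j i) i j s1 s2 t1 t2"
    by (rule pivot_graph.full_rows_or_cols)
  then obtain p q s1 s2 t1 t2 where "distinct [p, q, s1, s2, t1, t2]" "h p \<noteq> h q" "h s1 \<noteq> h p" "h s1 \<noteq> h q"
    "h s2 = h s1" "h t1 = h s1" "h t2 = h s1"
    unfolding full_rows_def by blast
  note pq = this
  define l where "l = h s1"
  have U: "UNIV = {p, q, s1, s2, t1, t2}"
  proof -
    have "card {p, q, s1, s2, t1, t2} = CARD(6)" using pq(1) by simp
    then show ?thesis using card_eq_UNIV_imp_eq_UNIV[of "{p, q, s1, s2, t1, t2}"] by simp
  qed
  have rest: "h x = l" if "x \<noteq> p" "x \<noteq> q" for x
    using U that pq unfolding l_def by (metis UNIV_I empty_iff insert_iff)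
  have "card (UNIV - {p, q}) = 4" using pq(1) by (simp add: card_Diff_subset)
  then obtain a b c d where abcd: "UNIV - {p, q} = {a, b, c, d}" "a < b" "b < c" "c < d"
    by (rule card4_sorted)
  \<comment> \<open>The four remaining indices stay in increasing order, so the permuted matrix is
    still upper triangular on them.\<close>
  define \<sigma> where "\<sigma> i = (if i = 1 then p else if i = 2 then q else if i = 3 then a else if i = 4 then b
     else if i = 5 then c else d)" for i :: 6
  have ne: "a \<notin> {p, q}" "b \<notin> {p, q}" "c \<notin> {p, q}" "d \<notin> {p, q}" "p \<noteq> q"
    using abcd(1) pq(1) by auto
  have \<sigma>: "\<sigma> 1 = p" "\<sigma> 2 = q" "\<sigma> 3 = a" "\<sigma> 4 = b" "\<sigma> 5 = c" "\<sigma> 6 = d" by (simp_all add: \<sigma>_def)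
  have "\<forall>i j. \<sigma> i = \<sigma> j \<longrightarrow> i = j"
    unfolding forall_6 \<sigma> using ne abcd(2-4) by auto
  then have "inj \<sigma>" by (simp add: inj_def)
  then obtain P' Q' :: "complex ^ 6 ^ 6" where PQ': "P' ** Q' = mat 1" "Q' ** P' = mat 1"
    and perm: "\<And>X i j. (Q' ** X ** P') $ i $ j = X $ \<sigma> i $ \<sigma> j"
    by (rule permutation_conj) blast
  define V2 where "V2 = (\<lambda>T. Q' ** T ** P') ` V1"
  note V2 = conj_properties[OF PQ' V1(1) V1(2), folded V2_def]
  define S2 where "S2 = Q' ** M ** P'"
  have S2: "S2 $ i $ j = M $ \<sigma> i $ \<sigma> j" for i j by (simp add: S2_def perm)
  have \<sigma>emb: "\<sigma> (emb k) \<noteq> p" "\<sigma> (emb k) \<noteq> q" for k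
    using \<open>inj \<sigma>\<close> \<sigma>(1,2) by (metis injD emb_neq)+
  have "range (\<lambda>i. h (\<sigma> i)) = range h"
  proof -
    have "surj \<sigma>" using \<open>inj \<sigma>\<close> by (simp add: finite_UNIV_inj_surj)
    then show ?thesis by (metis image_image)
  qed
  have \<sigma>mono: "wM k < wM j" if lt: "\<sigma> (emb k) < \<sigma> (emb j)" for k j
  proof -
    have "\<forall>k j. \<sigma> (emb k) < \<sigma> (emb j) \<longrightarrow> wM k < wM j"
      unfolding forall_4 emb_simps \<sigma> using abcd(2-4) by (auto simp: wM_def)
    then show ?thesis using lt by blast
  qed
  have "adapted V2 S2 (\<lambda>i. h (\<sigma> i)) l"
  proof
    show "cmat.subspace V2" by (rule V2)
    show "rank_le2 (comm A B)" if "A \<in> V2" "B \<in> V2" for A B using V2(2) that by blast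
    show "17 \<le> cmat.dim V2" using V2(3) V1(3) dim by simp
    show "card (eigenvals T) \<le> card (range (\<lambda>i. h (\<sigma> i)))" if "T \<in> V2" for T
      using V2(4)[OF that] bound1 unfolding \<open>range (\<lambda>i. h (\<sigma> i)) = range h\<close> by auto
    show "S2 \<in> V2" using M by (simp add: V2_def S2_def)
    show "S2 $ i $ i = h (\<sigma> i)" for i by (simp add: S2 h_def)
    show "h (\<sigma> i) = h (\<sigma> j)" if "i \<noteq> j" "S2 $ i $ j \<noteq> 0" for i j
      using that Mtri(2)[of "\<sigma> i" "\<sigma> j"] \<open>inj \<sigma>\<close> by (auto simp: S2 inj_eq)
    show "wM k < wM j" if "k \<noteq> j" "S2 $ emb k $ emb j \<noteq> 0" for k j
      using that Mtri(1)[of "\<sigma> (emb k)" "\<sigma> (emb j)"] \<open>inj \<sigma>\<close> by (intro \<sigma>mono) (auto simp: S2 inj_eq)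
    show "h (\<sigma> 1) \<noteq> h (\<sigma> 2)" "h (\<sigma> 1) \<noteq> l" "h (\<sigma> 2) \<noteq> l" using pq by (auto simp: \<sigma> l_def)
    show "h (\<sigma> (emb k)) = l" for k using rest \<sigma>emb by blast
  qed
  moreover have "V2 = (\<lambda>T. (Q' ** Q) ** T ** (P ** P')) ` V"
    unfolding V2_def V1_def image_image by (simp add: matrix_mul_assoc)
  moreover have "(P ** P') ** (Q' ** Q) = mat 1" "(Q' ** Q) ** (P ** P') = mat 1"
    using PQ PQ' by (metis matrix_mul_assoc matrix_mul_rid)+
  ultimately show ?thesis using that by metis
qed

theorem theorem1p1:
  fixes V :: "(complex ^ 6 ^ 6) set"
  assumes "cmat.subspace V"
    and "cmat.dim V = 17"
    and "\<forall>S\<in>V. \<forall>T\<in>V. rank (S ** T - T ** S) \<le> 2"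
  shows "\<exists>P :: complex ^ 6 ^ 6. invertible P \<and>
    ((\<lambda>S. matrix_inv P ** S ** P) ` V = calA \<or>
     (\<lambda>S. matrix_inv P ** S ** P) ` (transpose ` V) = calA)"
proof -
  have rank2: "\<forall>S\<in>V. \<forall>T\<in>V. rank_le2 (comm S T)"
    using assms(3) unfolding comm_def by (intro ballI rank_le2I) blast
  have dim: "cmat.dim V \<ge> 17" using assms(2) by simp
  obtain P Q S h l where PQ: "P ** Q = mat 1" "Q ** P = mat 1"
    and ad: "adapted ((\<lambda>T. Q ** T ** P) ` V) S h l"
    by (rule adapted_exists[OF assms(1) dim rank2])
  obtain A B where AB: "A ** B = mat 1" "B ** A = mat 1"
    and or: "(\<forall>T\<in>(\<lambda>T. Q ** T ** P) ` V. B ** T ** A \<in> calA) \<or>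
       (\<forall>T\<in>transpose ` (\<lambda>T. Q ** T ** P) ` V. B ** T ** A \<in> calA)"
    using adapted.conj_into_calA[OF ad] by blast
  \<comment> \<open>\<open>matrix_inv\<close> is defined by choice, so its value has to be
    identified with the two-sided inverse at hand.\<close>
  have inv: "invertible X" "matrix_inv X = Y" if "X ** Y = mat 1" "Y ** X = mat 1" for X Y :: "complex ^ 6 ^ 6"
  proof -
    show i: "invertible X" using that unfolding invertible_def by blast
    have left: "matrix_inv X ** X = mat 1"
      unfolding matrix_inv_def using i[unfolded invertible_def] by (rule someI2_ex) blast
    have "matrix_inv X = matrix_inv X ** (X ** Y)" by (simp add: that)
    also have "\<dots> = (matrix_inv X ** X) ** Y" by (simp add: matrix_mul_assoc)
    also have "\<dots> = Y" using left by simp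
    finally show "matrix_inv X = Y" .
  qed
  from or show ?thesis
  proof
    assume in_calA: "\<forall>T\<in>(\<lambda>T. Q ** T ** P) ` V. B ** T ** A \<in> calA"
    have c: "(P ** A) ** (B ** Q) = mat 1" "(B ** Q) ** (P ** A) = mat 1"
      using PQ AB by (metis matrix_mul_assoc matrix_mul_rid)+
    have "(\<lambda>T. (B ** Q) ** T ** (P ** A)) ` V = calA"
    proof (rule conj_eq_calA[OF assms(1,2) c])
      fix T assume "T \<in> V"
      then have "B ** (Q ** T ** P) ** A \<in> calA" using in_calA by blast
      then show "(B ** Q) ** T ** (P ** A) \<in> calA" by (simp add: matrix_mul_assoc)
    qed
    then show ?thesis using inv[OF c] by (intro exI[of _ "P ** A"]) simp
  next
    assume in_calA: "\<forall>T\<in>transpose ` (\<lambda>T. Q ** T ** P) ` V. B ** T ** A \<in> calA"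
    \<comment> \<open>The transpose of Q T P is P^T T^T Q^T, so the transposed space is conjugated
      by Q^T A, with inverse B P^T.\<close>
    let ?X = "transpose Q ** A" and ?Y = "B ** transpose P"
    have t: "transpose P ** transpose Q = mat 1" "transpose Q ** transpose P = mat 1"
      using PQ by (metis matrix_transpose_mul transpose_mat)+
    have c: "?X ** ?Y = mat 1" "?Y ** ?X = mat 1"
      using t AB by (metis matrix_mul_assoc matrix_mul_rid)+
    have subT: "cmat.subspace (transpose ` V)" by (rule subspace_map[OF transpose_add transpose_scale assms(1)])
    have "cmat.dim (transpose ` V) \<ge> cmat.dim V"
      by (rule dim_map_ge[where g = transpose, OF transpose_add transpose_scale transpose_add transpose_scale _ assms(1)]) simp
    moreover have "cmat.dim (transpose ` transpose ` V) \<ge> cmat.dim (transpose ` V)"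
      by (rule dim_map_ge[where g = transpose, OF transpose_add transpose_scale transpose_add transpose_scale _ subT]) simp
    ultimately have dimT: "cmat.dim (transpose ` V) = 17" using assms(2) by (simp add: image_image)
    have "(\<lambda>T. ?Y ** T ** ?X) ` transpose ` V = calA"
    proof (rule conj_eq_calA[OF subT dimT c])
      fix R assume "R \<in> transpose ` V"
      then obtain T where T: "T \<in> V" "R = transpose T" by blast
      then have "B ** transpose (Q ** T ** P) ** A \<in> calA" using in_calA by blast
      then show "?Y ** R ** ?X \<in> calA" unfolding T(2) by (simp add: matrix_transpose_mul matrix_mul_assoc)
    qed
    then show ?thesis using inv[OF c] by (intro exI[of _ ?X]) simp
  qed
qed

end
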